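(* Let $a$, $b$, and $n$ be positive integers. (i) If $a+b=n-1$, then $\operatorname{ind}\mathfrak{p}_n^{\mathrm C}((n)\mid(a,b))=\gcd(a+b,\,b+1)-1$. (ii) If $a+b=n-2$, then $\operatorname{ind}\mathfrak{p}_n^{\mathrm C}((n)\mid(a,b))=\gcd(a+b,\,b+2)-1$.
   Context: The ground field is algebraically closed of characteristic zero. Index. For a Lie algebra $\mathfrak{g}$, $\operatorname{ind}\mathfrak{g}=\min_{f\in\mathfrak{g}^*}\dim\ker(B_f)$, where $B_f(x,y)=f([x,y])$ for $x,y\in\mathfrak{g}$. Symplectic Lie algebra. $\mathfrak{sp}(2n)$ is the Lie algebra of $2n\times 2n$ block matrices $\begin{bmatrix}A&B\\C&-\widehat{A}\end{bmatrix}$ with $A,B,C$ of size $n\times n$, $B=\widehat{B}$, $C=\widehat{C}$, where $\widehat{X}$ is the transpose of $X$ with respect to the antidiagonal. Use the triangular decomposition $\mathfrak{sp}(2n)=\mathfrak{u}_+\oplus\mathfrak{h}\oplus\mathfrak{u}_-$ into strictly upper triangular, diagonal, and strictly lower triangular matrices. Let $\Pi=\{\alpha_1,\dots,\alpha_n\}$ be the simple roots in the standard order with $\alpha_n$ the exceptional (long) root: writing $\epsilon_i$ for the $i$-th diagonal entry functional on $\mathfrak h$, $\alpha_i=\epsilon_i-\epsilon_{i+1}$ for $i<n$ and $\alpha_n=2\epsilon_n$. Let $\mathfrak{g}_\alpha$ denote the root space of $\alpha$. Seaweeds. For $\Psi,\Psi'\subseteq\Pi$, $\mathfrak{p}_n^{\mathrm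 C}(\Psi\mid\Psi')$ is the (standard) seaweed subalgebra $\mathfrak{p}\cap\mathfrak{p}'$ of $\mathfrak{sp}(2n)$, where $\mathfrak{p}\supseteq\mathfrak{h}\oplus\mathfrak{u}_+$ and $\mathfrak{p}'\supseteq\mathfrak{h}\oplus\mathfrak{u}_-$ are the parabolic subalgebras determined by $\Psi=\{\alpha\in\Pi:\mathfrak{g}_{-\alpha}\not\subseteq\mathfrak{p}\}$ and $\Psi'=\{\alpha\in\Pi:\mathfrak{g}_{\alpha}\not\subseteq\mathfrak{p}'\}$. Let $C_{\leq n}$ be the set of finite strings of positive integers (possibly the empty string $\emptyset$) with sum at most $n$. For $\underline{a}=(a_1,\dots,a_m)\in C_{\leq n}$ put $\varphi_{\mathrm C}(\underline{a})=\{\alpha_{a_1},\alpha_{a_1+a_2},\dots,\alpha_{a_1+\dots+a_m}\}$ (with $\varphi_{\mathrm C}(\emptyset)=\emptyset$), and define $\mathfrak{p}_n^{\mathrm C}(\underline{a}\mid\underline{b})=\mathfrak{p}_n^{\mathrm C}(\varphi_{\mathrm C}(\underline{a})\mid\varphi_{\mathrm C}(\underline{b}))$. *)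

theory Defs
  imports "Jordan_Normal_Form.VS_Connect"
begin

definition lie_bracket :: "'a::comm_ring_1 mat \<Rightarrow> 'a mat \<Rightarrow> 'a mat" where
  "lie_bracket X Y = X * Y - Y * X"

definition lie_subalgebra :: "nat \<Rightarrow> 'a::field mat set \<Rightarrow> 'a mat set \<Rightarrow> bool" where
  "lie_subalgebra N \<gg> \<pp> \<longleftrightarrow>
     \<pp> \<subseteq> \<gg> \<and> VectorSpace.subspace class_ring \<pp> (module_mat TYPE('a) N N) \<and>
     (\<forall>X\<in>\<pp>. \<forall>Y\<in>\<pp>. lie_bracket X Y \<in> \<pp>)"

(* Elements of the dual space are functions on all matrices of which only the values on the
   given space matter. *)
definition linear_functionals :: "'a::field mat set \<Rightarrow> ('a mat \<Rightarrow> 'a) set" where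
  "linear_functionals V =
     {f. (\<forall>X\<in>V. \<forall>Y\<in>V. f (X + Y) = f X + f Y) \<and> (\<forall>c. \<forall>X\<in>V. f (c \<cdot>\<^sub>m X) = c * f X)}"

definition kirillov_kernel :: "'a::field mat set \<Rightarrow> ('a mat \<Rightarrow> 'a) \<Rightarrow> 'a mat set" where
  "kirillov_kernel \<gg> f = {X \<in> \<gg>. \<forall>Y\<in>\<gg>. f (lie_bracket X Y) = 0}"

definition subspace_dim :: "nat \<Rightarrow> 'a::field mat set \<Rightarrow> nat" where
  "subspace_dim N W =
     vectorspace.dim class_ring ((module_mat TYPE('a) N N)\<lparr>carrier := W\<rparr>)"

(* The index of a Lie algebra of N x N matrices. *)
definition lie_index :: "nat \<Rightarrow> 'a::field mat set \<Rightarrow> nat" where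
  "lie_index N \<gg> =
     (LEAST d. \<exists>f \<in> linear_functionals \<gg>. d = subspace_dim N (kirillov_kernel \<gg> f))"

(* Transpose with respect to the antidiagonal; matrix indices start at 0. *)
definition antitranspose :: "'a mat \<Rightarrow> 'a mat" where
  "antitranspose X =
     mat (dim_col X) (dim_row X) (\<lambda>(i, j). X $$ (dim_row X - 1 - j, dim_col X - 1 - i))"

definition sp :: "nat \<Rightarrow> 'a::field mat set" where
  "sp n = {four_block_mat A B C (- antitranspose A) | A B C.
     A \<in> carrier_mat n n \<and> B \<in> carrier_mat n n \<and> C \<in> carrier_mat n n \<and>
     B = antitranspose B \<and> C = antitranspose C}"

definition sp_cartan :: "nat \<Rightarrow> 'a::field mat set" where
  "sp_cartan n = {X \<in> sp n. diagonal_mat X}"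

definition sp_upper :: "nat \<Rightarrow> 'a::field mat set" where
  "sp_upper n = {X \<in> sp n. \<forall>i < 2 * n. \<forall>j \<le> i. X $$ (i, j) = 0}"

definition sp_lower :: "nat \<Rightarrow> 'a::field mat set" where
  "sp_lower n = {X \<in> sp n. \<forall>j < 2 * n. \<forall>i \<le> j. X $$ (i, j) = 0}"

definition sp_borel_plus :: "nat \<Rightarrow> 'a::field mat set" where
  "sp_borel_plus n = {H + U | H U. H \<in> sp_cartan n \<and> U \<in> sp_upper n}"

definition sp_borel_minus :: "nat \<Rightarrow> 'a::field mat set" where
  "sp_borel_minus n = {H + U | H U. H \<in> sp_cartan n \<and> U \<in> sp_lower n}"

(* The functional diag_entry i, for i = 1, ..., n, is epsilon_i.  Roots are functionals
   on the Cartan subalgebra; they are given here by the same formula on all matrices. *)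
definition diag_entry :: "nat \<Rightarrow> 'a mat \<Rightarrow> 'a" where
  "diag_entry i H = H $$ (i - 1, i - 1)"

definition simple_root :: "nat \<Rightarrow> nat \<Rightarrow> 'a::field mat \<Rightarrow> 'a" where
  "simple_root n i = (if i < n then (\<lambda>H. diag_entry i H - diag_entry (i + 1) H) else (\<lambda>H. 2 * diag_entry n H))"

definition simple_roots :: "nat \<Rightarrow> ('a::field mat \<Rightarrow> 'a) set" where
  "simple_roots n = simple_root n ` {1..n}"

definition root_space :: "nat \<Rightarrow> ('a::field mat \<Rightarrow> 'a) \<Rightarrow> 'a mat set" where
  "root_space n \<alpha> = {X \<in> sp n. \<forall>H \<in> sp_cartan n. lie_bracket H X = \<alpha> H \<cdot>\<^sub>m X}"

(* The parabolic subalgebras containing a fixed Borel subalgebra correspond bijectively to the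
   subsets of the set of simple roots, so the following descriptions are definite for
   \<Psi> \<subseteq> simple_roots n over a field of characteristic 0. *)
definition parabolic_plus :: "nat \<Rightarrow> ('a::field mat \<Rightarrow> 'a) set \<Rightarrow> 'a mat set" where
  "parabolic_plus n \<Psi> =
     (THE \<pp>. lie_subalgebra (2 * n) (sp n) \<pp> \<and> sp_borel_plus n \<subseteq> \<pp> \<and>
           \<Psi> = {\<alpha> \<in> simple_roots n. \<not> root_space n (\<lambda>H. - \<alpha> H) \<subseteq> \<pp>})"

definition parabolic_minus :: "nat \<Rightarrow> ('a::field mat \<Rightarrow> 'a) set \<Rightarrow> 'a mat set" where
  "parabolic_minus n \<Psi> =
     (THE \<pp>. lie_subalgebra (2 * n) (sp n) \<pp> \<and> sp_borel_minus n \<subseteq> \<pp> \<and>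
           \<Psi> = {\<alpha> \<in> simple_roots n. \<not> root_space n \<alpha> \<subseteq> \<pp>})"

definition seaweed :: "nat \<Rightarrow> ('a::field mat \<Rightarrow> 'a) set \<Rightarrow> ('a mat \<Rightarrow> 'a) set \<Rightarrow> 'a mat set" where
  "seaweed n \<Psi> \<Psi>' = parabolic_plus n \<Psi> \<inter> parabolic_minus n \<Psi>'"

(* Meaningful for strings in C_{<=n}: lists of positive integers with sum at most n. *)
definition comp_roots :: "nat \<Rightarrow> nat list \<Rightarrow> ('a::field mat \<Rightarrow> 'a) set" where
  "comp_roots n as = {simple_root n (sum_list (take k as)) | k. 1 \<le> k \<and> k \<le> length as}"

definition seaweed_C :: "nat \<Rightarrow> nat list \<Rightarrow> nat list \<Rightarrow> 'a::field mat set" where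
  "seaweed_C n as bs = seaweed n (comp_roots n as) (comp_roots n bs)"

end

theory Submission
  imports Defs
begin

text \<open>For matrices supported on a transitive relation \<open>\<rho>\<close>, a generic functional restricted to an abelian ideal
  of block shape is conjugate to a standard one, and the index is the index of the stabilizer of that standard
  functional, which is again the algebra of a transitive relation. Iterating this on block triangular
  subalgebras with two big blocks and a diagonal block of size one or two is the Euclidean algorithm; it
  ends with the algebra of diagonal block matrices, whose index is its rank.

  The seaweed \<open>(n) | (a, b)\<close> is the semidirect product of block triangular \<open>n \<times> n\<close> matrices with blocks
  \<open>a, b, r = n - a - b\<close> and the abelian ideal of symmetric forms on the block of size \<open>r\<close>. The stabilizer of
  a generic form acts on that block through \<open>so(r)\<close>, that is by \<open>0\<close> if \<open>r = 1\<close> and by \<open>diag(t, -t)\<close> if \<open>r = 2\<close>.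
  Adding the scalar matrices, which raises the index by one, gives matrices that are diagonal on the
  block for which the reduction applies. Conclusions on generic functionals are transferred to all
  functionals by semicontinuity along lines.\<close>

subsection \<open>Linear algebra of matrices of unbounded size\<close>

text \<open>The index is a minimum: an upper bound needs one functional, a lower bound needs all of
  them. The standard functional of each step is therefore also the base point of lines on which only
  finitely many parameters are bad. For blocks Y, T, C with T diagonal, the pair fed to the
  Euclidean algorithm is (|Y| + |T|, |C| + |T|), and a step lowers |C| by |Y| + |T|. The obstacle is
  the end of the descent, where |C| lies between |Y| and |Y| + |T| and nothing fits any more. There
  a reduction is run backwards with a fresh copy of T, for which the ambient size keeps spare room.
  The scalars are added because a trace condition cannot be expressed by a relation on positions.
  For r = 2 the stabilizer of a generic form is only conjugate to the traceless diagonal one; the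
  conjugation takes a square root, and this is where algebraic closedness enters.\<close>

typedef 'a fm = "UNIV :: (nat \<Rightarrow> nat \<Rightarrow> 'a) set"
  morphisms ent Fm ..

lemma ent_Fm [simp]: "ent (Fm f) = f"
  by (simp add: Fm_inverse)

lemma fm_eq_iff: "A = B \<longleftrightarrow> (\<forall>i j. ent A i j = ent B i j)"
  by (simp add: ent_inject[symmetric] fun_eq_iff)

lemma fm_eqI: "(\<And>i j. ent A i j = ent B i j) \<Longrightarrow> A = B"
  by (simp add: fm_eq_iff)

instantiation fm :: (ab_group_add) ab_group_add
begin

definition "0 = Fm (\<lambda>_ _. 0)"
definition "A + B = Fm (\<lambda>i j. ent A i j + ent B i j)"
definition "A - B = Fm (\<lambda>i j. ent A i j - ent B i j)"
definition "- A = Fm (\<lambda>i j. - ent A i j)"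

instance
  by standard (auto simp: zero_fm_def plus_fm_def minus_fm_def uminus_fm_def fm_eq_iff)

end

definition mscale :: "'a::field \<Rightarrow> 'a fm \<Rightarrow> 'a fm" where
  "mscale c A = Fm (\<lambda>i j. c * ent A i j)"

lemma ent_simps [simp]:
  "ent 0 i j = 0" "ent (A + B) i j = ent A i j + ent B i j"
  "ent (A - B) i j = ent A i j - ent B i j" "ent (- A) i j = - ent A i j"
  by (auto simp: zero_fm_def plus_fm_def minus_fm_def uminus_fm_def)

lemma ent_mscale [simp]: "ent (mscale c A) i j = c * ent A i j"
  by (simp add: mscale_def)

lemma ent_sum [simp]: "ent (sum f S) i j = (\<Sum>s\<in>S. ent (f s) i j)"
  by (induction S rule: infinite_finite_induct) auto

interpretation fm: vector_space "mscale :: 'a::field \<Rightarrow> _"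
  by standard (auto simp: fm_eq_iff algebra_simps)

interpretation fmp: vector_space_pair "mscale :: 'a::field \<Rightarrow> _" "mscale :: 'a::field \<Rightarrow> _" ..

interpretation scl: vector_space "(*) :: 'a::field \<Rightarrow> 'a \<Rightarrow> 'a"
  by standard (auto simp: algebra_simps)

declare scl.scale_scale [simp del]

interpretation fmf: vector_space_pair "mscale :: 'a::field \<Rightarrow> _" "(*) :: 'a::field \<Rightarrow> 'a \<Rightarrow> 'a" ..

abbreviation lin :: "('a::field fm \<Rightarrow> 'a fm) \<Rightarrow> bool" where
  "lin \<equiv> Vector_Spaces.linear mscale mscale"

abbreviation linf :: "('a::field fm \<Rightarrow> 'a) \<Rightarrow> bool" where
  "linf \<equiv> Vector_Spaces.linear mscale (*)"

text \<open>One infinite-dimensional type holds all matrices, so that subspaces, spans and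
  dimensions come from a vector space on a whole type. Finite dimension then has to be carried as a
  predicate: an infinite basis has cardinality 0, and monotonicity of \<open>fm.dim\<close> would
  fail.\<close>

definition fd :: "'a::field fm set \<Rightarrow> bool" where
  "fd L \<longleftrightarrow> fm.subspace L \<and> (\<exists>B. finite B \<and> L \<subseteq> fm.span B)"

lemma linI: "(\<And>A B. f (A + B) = f A + f B) \<Longrightarrow> (\<And>c A. f (mscale c A) = mscale c (f A)) \<Longrightarrow> lin f"
  using fm.vector_space_axioms by (simp add: Vector_Spaces.linear_iff)

lemma linfI: "(\<And>A B. f (A + B) = f A + f B) \<Longrightarrow> (\<And>c A. f (mscale c A) = c * f A) \<Longrightarrow> linf f"
  using fm.vector_space_axioms scl.vector_space_axioms by (simp add: Vector_Spaces.linear_iff)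

lemma fd_subspace: "fd L \<Longrightarrow> fm.subspace L"
  by (simp add: fd_def)

lemma fd_subset: "fd L \<Longrightarrow> fm.subspace K \<Longrightarrow> K \<subseteq> L \<Longrightarrow> fd K"
  unfolding fd_def by blast

lemma fd_basis:
  assumes "fd L"
  obtains B where "B \<subseteq> L" "finite B" "fm.independent B" "fm.span B = L" "card B = fm.dim L"
proof -
  obtain B where B: "B \<subseteq> L" "fm.independent B" "L \<subseteq> fm.span B" "card B = fm.dim L"
    using fm.basis_exists by blast
  obtain A where A: "finite A" "L \<subseteq> fm.span A" using assms by (auto simp: fd_def)
  have "finite B" using fm.independent_span_bound[OF A(1) B(2)] A B by auto
  moreover have "fm.span B = L"
    using B fd_subspace[OF assms] by (simp add: fm.span_subspace)
  ultimately show ?thesis using B that by blast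
qed

lemma fd_independent:
  assumes "fd L" "B \<subseteq> L" "fm.independent B"
  shows "finite B" "card B \<le> fm.dim L"
proof -
  obtain C where C: "C \<subseteq> L" "finite C" "fm.independent C" "fm.span C = L" "card C = fm.dim L"
    using fd_basis[OF assms(1)] .
  have "finite B \<and> card B \<le> card C"
    using fm.independent_span_bound[OF C(2) assms(3)] C assms(2) by auto
  then show "finite B" "card B \<le> fm.dim L" using C by auto
qed

lemma fd_dim_mono:
  assumes "fd L" "K \<subseteq> L"
  shows "fm.dim K \<le> fm.dim L"
proof -
  obtain B where B: "B \<subseteq> K" "fm.independent B" "K \<subseteq> fm.span B" "card B = fm.dim K"
    using fm.basis_exists by blast
  then show ?thesis using fd_independent(2)[OF assms(1), of B] assms(2) by auto
qed

lemma fd_eqI: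
  assumes "fd L" "fm.subspace K" "K \<subseteq> L" "fm.dim K = fm.dim L"
  shows "K = L"
proof (rule ccontr)
  assume "K \<noteq> L"
  then obtain x where x: "x \<in> L" "x \<notin> K" using assms by auto
  obtain B where B: "B \<subseteq> K" "finite B" "fm.independent B" "fm.span B = K" "card B = fm.dim K"
    using fd_basis[OF fd_subset[OF assms(1-3)]] .
  have "fm.independent (insert x B)" using B x by (simp add: fm.independent_insertI)
  then have "card (insert x B) \<le> fm.dim L"
    using fd_independent(2)[OF assms(1)] x B assms(3) by auto
  moreover have "x \<notin> B" using x B by auto
  ultimately show False using B assms(4) by simp
qed

lemma dim_image_inj:
  assumes "lin f" "fm.subspace S" "inj_on f S"
  shows "fm.dim (f ` S) = fm.dim S"
proof -
  obtain B where B: "B \<subseteq> S" "fm.independent B" "S \<subseteq> fm.span B" "card B = fm.dim S"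
    using fm.basis_exists by blast
  have sp: "fm.span B = S" using B assms by (simp add: fm.span_subspace)
  have "fm.independent (f ` B)"
    using fmp.linear_independent_injective_image[OF assms(1) B(2)] assms(3) sp by simp
  moreover have "f ` S = fm.span (f ` B)" using fmp.linear_span_image[OF assms(1), of B] sp by simp
  ultimately show ?thesis
    using fm.dim_span_eq_card_independent card_image inj_on_subset[OF assms(3) B(1)] B(4)
    by metis
qed

lemma endo_inj_imp_surj:
  assumes "lin f" "fd L" "f ` L \<subseteq> L" "inj_on f L"
  shows "f ` L = L"
  using fd_eqI[OF assms(2) _ assms(3)] dim_image_inj[OF assms(1) fd_subspace[OF assms(2)] assms(4)]
    fmp.linear_subspace_image[OF assms(1) fd_subspace[OF assms(2)]] by simp

section \<open>Eigenvectors and complements\<close>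

lemma independent_eigenvectors:
  fixes x :: "'a::field \<Rightarrow> 'a fm"
  assumes "lin C" "finite E" "\<And>e. e \<in> E \<Longrightarrow> C (x e) = mscale e (x e)" "\<And>e. e \<in> E \<Longrightarrow> x e \<noteq> 0"
    "(\<Sum>e\<in>E. mscale (c e) (x e)) = 0" "e \<in> E"
  shows "c e = 0"
  using assms(2-)
proof (induction E arbitrary: c e rule: finite_induct)
  case (insert d E)
  have s: "mscale (c d) (x d) + (\<Sum>e\<in>E. mscale (c e) (x e)) = 0"
    using insert.prems(3) unfolding sum.insert[OF insert.hyps(1,2)] .
  have "C (mscale (c d) (x d) + (\<Sum>e\<in>E. mscale (c e) (x e)))
      = mscale (c d * d) (x d) + (\<Sum>e\<in>E. mscale (c e * e) (x e))"
    using insert.prems(1)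
    by (simp add: fmp.linear_add[OF assms(1)] fmp.linear_sum[OF assms(1)]
        fmp.linear_scale[OF assms(1)] cong: sum.cong)
  then have 1: "mscale (c d * d) (x d) + (\<Sum>e\<in>E. mscale (c e * e) (x e)) = 0"
    using s fmp.linear_0[OF assms(1)] by simp
  have "mscale d (mscale (c d) (x d) + (\<Sum>e\<in>E. mscale (c e) (x e))) = 0" using s by simp
  then have 2: "mscale (c d * d) (x d) + (\<Sum>e\<in>E. mscale (c e * d) (x e)) = 0"
    by (simp add: fm.scale_right_distrib fm.scale_sum_right mult.commute)
  \<comment> \<open>Subtracting \<open>d\<close> times the relation from its image under
    \<open>C\<close> removes the new vector \<open>x d\<close>.\<close>
  have "(\<Sum>e\<in>E. mscale (c e * (e - d)) (x e)) = 0"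
  proof -
    have "(\<Sum>e\<in>E. mscale (c e * (e - d)) (x e))
      = (\<Sum>e\<in>E. mscale (c e * e) (x e)) - (\<Sum>e\<in>E. mscale (c e * d) (x e))"
      by (simp add: algebra_simps fm.scale_left_diff_distrib flip: sum_subtractf)
    then show ?thesis using 1 2 by (simp add: add_eq_0_iff)
  qed
  then have "c e * (e - d) = 0" if "e \<in> E" for e
    using insert.IH[of "\<lambda>e. c e * (e - d)"] insert.prems that by auto
  then have z: "c e = 0" if "e \<in> E" for e using insert.hyps that by fastforce
  then have "mscale (c d) (x d) = 0" using s by simp
  then have "c d = 0" using insert.prems by auto
  then show ?case using z insert.prems by auto
qed simp

text \<open>\<open>C\<close> need not map \<open>L\<close> to itself: eigenvectors inside
  \<open>L\<close> for distinct eigenvalues are independent, so \<open>fm.dim L\<close> bounds their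
  number. The finite sets of parameters excluded for pencils and for conjugations come from
  here.\<close>

lemma finite_eigenvalues:
  fixes C :: "'a::field fm \<Rightarrow> 'a fm"
  assumes "lin C" "fd L"
  shows "finite {e. \<exists>x\<in>L. x \<noteq> 0 \<and> C x = mscale e x}" (is "finite ?E")
proof (rule ccontr)
  assume inf: "infinite ?E"
  define x where "x e = (SOME x. x \<in> L \<and> x \<noteq> 0 \<and> C x = mscale e x)" for e
  have x: "x e \<in> L \<and> x e \<noteq> 0 \<and> C (x e) = mscale e (x e)" if "e \<in> ?E" for e
    unfolding x_def by (rule someI_ex[of "\<lambda>x. x \<in> L \<and> x \<noteq> 0 \<and> C x = mscale e x"]) (use that in blast)
  obtain E where E: "finite E" "E \<subseteq> ?E" "card E = Suc (fm.dim L)"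
    using infinite_arbitrarily_large[OF inf] by blast
  have inj: "inj_on x E"
  proof (rule inj_onI)
    fix d e assume de: "d \<in> E" "e \<in> E" "x d = x e"
    have "d \<in> ?E" "e \<in> ?E" using de E by blast+
    have "mscale d (x e) = C (x e)" using x[OF \<open>d \<in> ?E\<close>] unfolding de(3) by argo
    also have "\<dots> = mscale e (x e)" using x[OF \<open>e \<in> ?E\<close>] by blast
    finally show "d = e" using fm.scale_cancel_right[of d "x e" e] x[OF \<open>e \<in> ?E\<close>] by blast
  qed
  have "fm.independent (x ` E)"
  proof (rule fm.independent_if_scalars_zero)
    show "finite (x ` E)" using E(1) by simp
    fix f y assume f: "(\<Sum>y\<in>x ` E. mscale (f y) y) = 0" and y: "y \<in> x ` E"
    then obtain e where e: "e \<in> E" "y = x e" by blast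
    have "(\<Sum>e\<in>E. mscale (f (x e)) (x e)) = 0" using f unfolding sum.reindex[OF inj] by simp
    moreover have "\<And>e. e \<in> E \<Longrightarrow> C (x e) = mscale e (x e)" "\<And>e. e \<in> E \<Longrightarrow> x e \<noteq> 0"
      using x E(2) by blast+
    ultimately show "f y = 0"
      using independent_eigenvectors[OF assms(1) E(1), of x "\<lambda>e. f (x e)" e] e by blast
  qed
  then have "card (x ` E) \<le> fm.dim L"
    using fd_independent(2)[OF assms(2), of "x ` E"] x E(2) by blast
  then show False using E(3) card_image[OF inj] by simp
qed

text \<open>\<open>W\<close> is the kernel in \<open>L\<close> of a linear map \<open>g\<close> with
  range \<open>K\<close> that fixes \<open>K\<close> pointwise. A larger subspace cannot inject into
  \<open>K\<close> under \<open>g\<close>, hence it meets \<open>W\<close>.\<close>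

lemma complement_meets:
  assumes "fd L" "fm.subspace K" "K \<subseteq> L"
  obtains W where "fm.subspace W" "W \<subseteq> L" "K \<inter> W = {0}"
    "\<And>K'. fm.subspace K' \<Longrightarrow> K' \<subseteq> L \<Longrightarrow> fm.dim K < fm.dim K' \<Longrightarrow> \<exists>x\<in>K' \<inter> W. x \<noteq> 0"
proof -
  obtain B where B: "B \<subseteq> K" "finite B" "fm.independent B" "fm.span B = K" "card B = fm.dim K"
    using fd_basis[OF fd_subset[OF assms]] .
  obtain g where g0: "lin g" "\<forall>x\<in>B. g x = id x" "range g = fm.span (id ` B)"
    using fmp.linear_independent_extend_subspace[OF B(3), of id] by blast
  have g: "lin g" "\<And>x. x \<in> K \<Longrightarrow> g x = x" "range g = K"
  proof -
    show "g x = x" if "x \<in> K" for x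
      using fmp.linear_eq_on[OF g0(1) fm.linear_id, of x B] g0(2) that B(4) by simp
  qed (use g0 B(4) in simp_all)
  define W where "W = {x \<in> L. g x = 0}"
  show ?thesis
  proof
    show "fm.subspace W" unfolding W_def
      using fd_subspace[OF assms(1)] fmp.linear_add[OF g(1)] fmp.linear_scale[OF g(1)] fmp.linear_0[OF g(1)]
      by (auto simp: fm.subspace_def)
    show "W \<subseteq> L" by (auto simp: W_def)
    show "K \<inter> W = {0}" 
    proof (intro equalityI subsetI)
      fix x assume "x \<in> K \<inter> W"
      then have "x = 0" using g(2)[of x] unfolding W_def by auto
      then show "x \<in> {0}" by simp
    next
      fix x :: "'a fm" assume "x \<in> {0}"
      then show "x \<in> K \<inter> W" using fm.subspace_0[OF assms(2)] assms(3) fmp.linear_0[OF g(1)]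
        unfolding W_def by auto
    qed
    fix K' assume K': "fm.subspace K'" "K' \<subseteq> L" "fm.dim K < fm.dim K'"
    show "\<exists>x\<in>K' \<inter> W. x \<noteq> 0"
    proof (rule ccontr)
      assume "\<not> ?thesis"
      then have "inj_on g K'"
        unfolding fmp.linear_inj_on_iff_eq_0[OF g(1) K'(1)] W_def using K'(2) by blast
      then have "fm.dim (g ` K') = fm.dim K'" using dim_image_inj[OF g(1) K'(1)] by simp
      moreover have "fm.dim (g ` K') \<le> fm.dim K"
        using g(3) by (intro fd_dim_mono[OF fd_subset[OF assms]]) auto
      ultimately show False using K' by simp
    qed
  qed
qed

subsection \<open>Radicals of bilinear forms\<close>

definition bilin :: "('a::field fm \<Rightarrow> 'a fm \<Rightarrow> 'a) \<Rightarrow> bool" where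
  "bilin B \<longleftrightarrow> (\<forall>x. linf (B x)) \<and> (\<forall>y. linf (\<lambda>x. B x y))"

definition rad :: "'a::field fm set \<Rightarrow> ('a fm \<Rightarrow> 'a fm \<Rightarrow> 'a) \<Rightarrow> 'a fm set" where
  "rad L B = {x \<in> L. \<forall>y\<in>L. B x y = 0}"

lemma bilin_simps:
  assumes "bilin B"
  shows "B (x + x') y = B x y + B x' y" "B x (y + y') = B x y + B x y'"
    "B (x - x') y = B x y - B x' y" "B x (y - y') = B x y - B x y'"
    "B (mscale c x) y = c * B x y" "B x (mscale c y) = c * B x y" "B 0 y = 0" "B x 0 = 0"
    "B (- x) y = - B x y" "B x (- y) = - B x y"
proof -
  have l: "linf (B x)" "linf (\<lambda>x. B x y)" for x y using assms by (auto simp: bilin_def)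
  show "B (x + x') y = B x y + B x' y" by (rule fmf.linear_add[OF l(2)])
  show "B x (y + y') = B x y + B x y'" by (rule fmf.linear_add[OF l(1)])
  show "B (x - x') y = B x y - B x' y" by (rule fmf.linear_diff[OF l(2)])
  show "B x (y - y') = B x y - B x y'" by (rule fmf.linear_diff[OF l(1)])
  show "B (mscale c x) y = c * B x y" by (rule fmf.linear_scale[OF l(2)])
  show "B x (mscale c y) = c * B x y" by (rule fmf.linear_scale[OF l(1)])
  show "B 0 y = 0" by (rule fmf.linear_0[OF l(2)])
  show "B x 0 = 0" by (rule fmf.linear_0[OF l(1)])
  show "B (- x) y = - B x y" by (rule fmf.linear_neg[OF l(2)])
  show "B x (- y) = - B x y" by (rule fmf.linear_neg[OF l(1)])
qed

lemma bilin_sum: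
  assumes "bilin B"
  shows "B x (\<Sum>i\<in>I. mscale (c i) (y i)) = (\<Sum>i\<in>I. c i * B x (y i))"
  by (induction I rule: infinite_finite_induct) (simp_all add: bilin_simps[OF assms])

lemma bilin_span_0:
  assumes "bilin B" "\<And>b. b \<in> S \<Longrightarrow> B x b = 0" "y \<in> fm.span S"
  shows "B x y = 0"
  using assms(3)
proof (induction rule: fm.span_induct_alt)
  case base
  then show ?case by (simp add: bilin_simps[OF assms(1)])
next
  case (step c b z)
  then show ?case using assms(2)[of b] by (simp add: bilin_simps[OF assms(1)])
qed

lemma subspace_rad:
  assumes "bilin B" "fm.subspace L"
  shows "fm.subspace (rad L B)"
  using assms(2) unfolding rad_def fm.subspace_def by (auto simp: bilin_simps[OF assms(1)])

lemma bilin_pencil: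
  assumes "bilin B" "bilin C"
  shows "bilin (\<lambda>x y. B x y + u * C x y)"
  unfolding bilin_def
  by (intro conjI allI linfI) (simp_all add: bilin_simps[OF assms(1)] bilin_simps[OF assms(2)] algebra_simps)

text \<open>A vector of the radical of \<open>B + u C\<close> lying in a complement of the radical of \<open>B\<close> is an
  eigenvector, with eigenvalue \<open>- 1 / u\<close>, of a fixed operator.\<close>

lemma rad_semicontinuous_0:
  fixes B C :: "'a::field_char_0 fm \<Rightarrow> 'a fm \<Rightarrow> 'a"
  assumes "fd L" "bilin B" "bilin C"
    and fin: "finite {u. \<not> d \<le> fm.dim (rad L (\<lambda>x y. B x y + u * C x y))}"
  shows "d \<le> fm.dim (rad L B)"
proof (rule ccontr)
  assume "\<not> ?thesis"
  then have less: "fm.dim (rad L B) < d" by simp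
  obtain W where W: "fm.subspace W" "W \<subseteq> L" "rad L B \<inter> W = {0}"
    "\<And>K'. fm.subspace K' \<Longrightarrow> K' \<subseteq> L \<Longrightarrow> fm.dim (rad L B) < fm.dim K' \<Longrightarrow> \<exists>x\<in>K' \<inter> W. x \<noteq> 0"
    using complement_meets[OF assms(1) subspace_rad[OF assms(2) fd_subspace[OF assms(1)]]]
    by (auto simp: rad_def)
  obtain S where S: "S \<subseteq> L" "finite S" "fm.independent S" "fm.span S = L" "card S = fm.dim L"
    using fd_basis[OF assms(1)] .
  obtain b m where bm: "S = b ` {i::nat. i < m}"
    using finite_imp_nat_seg_image_inj_on[OF S(2)] by blast
  \<comment> \<open>The functional \<open>D x\<close> is stored as the column of its values on the
    basis \<open>S\<close>. It is then again an element of \<open>'a fm\<close>, and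
    \<open>T B\<close>, being injective on \<open>W\<close>, has a linear left inverse.\<close>
  define T where "T D x = Fm (\<lambda>p q. if q = 0 \<and> p < m then D x (b p) else 0)"
    for D :: "'a fm \<Rightarrow> 'a fm \<Rightarrow> 'a" and x
  have linT: "lin (T D)" if "bilin D" for D
    by (rule linI; rule fm_eqI) (simp_all add: T_def bilin_simps[OF that])
  have T0: "T D x = 0 \<Longrightarrow> y \<in> L \<Longrightarrow> D x y = 0" if "bilin D" for D x y
  proof (rule bilin_span_0[OF that])
    fix z assume "T D x = 0" "z \<in> S"
    then obtain p where p: "p < m" "z = b p" using bm by blast
    have "ent (T D x) p 0 = 0" using \<open>T D x = 0\<close> by simp
    then show "D x z = 0" using p by (simp add: T_def)
  qed (use S in auto)
  have "inj_on (T B) W"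
    unfolding fmp.linear_inj_on_iff_eq_0[OF linT[OF assms(2)] W(1)]
  proof (intro ballI impI)
    fix x assume x: "x \<in> W" "T B x = 0"
    have "x \<in> rad L B" unfolding rad_def using x(1) W(2) T0[OF assms(2) x(2)] by blast
    then show "x = 0" using x(1) W(3) by blast
  qed
  then obtain g where g: "lin g" "\<forall>v\<in>W. g (T B v) = v"
    using fmp.linear_exists_left_inverse_on[OF linT[OF assms(2)] W(1)] by blast
  have lgT: "lin (\<lambda>x. g (T C x))"
    using Vector_Spaces.linear_compose[OF linT[OF assms(3)] g(1)] by (simp add: o_def)
  let ?E = "{e. \<exists>x\<in>L. x \<noteq> 0 \<and> g (T C x) = mscale e x}"
  have "finite ?E" using finite_eigenvalues[OF lgT assms(1)] .
  \<comment> \<open>Besides the bad parameters, 0 and the values -1/e are excluded, with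
    \<open>e\<close> an eigenvalue of \<open>g\<close> after \<open>T C\<close>.\<close>
  then have "finite ({u. \<not> d \<le> fm.dim (rad L (\<lambda>x y. B x y + u * C x y))} \<union> {0} \<union> (\<lambda>e. - (1 / e)) ` ?E)"
    (is "finite ?F") using fin by simp
  from ex_new_if_finite[OF infinite_UNIV_char_0 this] obtain u where "u \<notin> ?F" ..
  then have u: "d \<le> fm.dim (rad L (\<lambda>x y. B x y + u * C x y))" "u \<noteq> 0" "u \<notin> (\<lambda>e. - (1 / e)) ` ?E"
    by simp_all
  let ?R = "rad L (\<lambda>x y. B x y + u * C x y)"
  have "\<exists>x\<in>?R \<inter> W. x \<noteq> 0"
    using u(1) less
    by (intro W(4) subspace_rad bilin_pencil assms fd_subspace[OF assms(1)]) (auto simp: rad_def)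
  then obtain x where x: "x \<in> ?R" "x \<in> W" "x \<noteq> 0" by blast
  have "T B x + mscale u (T C x) = 0"
  proof (rule fm_eqI)
    fix p q
    have "p < m \<Longrightarrow> b p \<in> L" using bm S(1) by blast
    then show "ent (T B x + mscale u (T C x)) p q = ent 0 p q"
      using x(1) by (auto simp: T_def rad_def)
  qed
  then have "g (T B x) + mscale u (g (T C x)) = 0"
    using fmp.linear_add[OF g(1)] fmp.linear_scale[OF g(1)] fmp.linear_0[OF g(1)] by metis
  then have z: "x + mscale u (g (T C x)) = 0" using g(2) x(2) by simp
  have "g (T C x) = mscale (- (1 / u)) x"
  proof (rule fm_eqI)
    fix i j
    have "ent x i j + u * ent (g (T C x)) i j = 0" using arg_cong[OF z, of "\<lambda>y. ent y i j"] by simp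
    then show "ent (g (T C x)) i j = ent (mscale (- (1 / u)) x) i j"
      using u(2) by (simp add: field_simps eq_neg_iff_add_eq_0 add.commute)
  qed
  then have "- (1 / u) \<in> ?E" using x W(2) by blast
  then have "- (1 / (- (1 / u))) \<in> (\<lambda>e. - (1 / e)) ` ?E" by (rule imageI)
  then show False using u by simp
qed

text \<open>Any form of the pencil can serve as base point; moving it to \<open>v\<close> only
  translates the exceptional set.\<close>

lemma rad_semicontinuous:
  fixes B C :: "'a::field_char_0 fm \<Rightarrow> 'a fm \<Rightarrow> 'a"
  assumes "fd L" "bilin B" "bilin C"
    and fin: "finite {u. \<not> d \<le> fm.dim (rad L (\<lambda>x y. B x y + u * C x y))}"
  shows "d \<le> fm.dim (rad L (\<lambda>x y. B x y + v * C x y))"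
proof (rule rad_semicontinuous_0[OF assms(1) bilin_pencil[OF assms(2,3)] assms(3)])
  have "{u. \<not> d \<le> fm.dim (rad L (\<lambda>x y. B x y + v * C x y + u * C x y))}
    = (\<lambda>u. u - v) ` {u. \<not> d \<le> fm.dim (rad L (\<lambda>x y. B x y + u * C x y))}" (is "?l = ?r")
  proof (intro equalityI subsetI)
    fix u assume "u \<in> ?l"
    then show "u \<in> ?r" by (intro image_eqI[of _ _ "u + v"]) (auto simp: algebra_simps)
  qed (auto simp: algebra_simps)
  then show "finite ?l" using fin by simp
qed

text \<open>This finds an element of a subspace with prescribed pairings. The induction restricts to
  the kernel of one \<open>g k\<close>; the coefficient of \<open>g k\<close> is then read off at a
  vector \<open>y\<close> outside that kernel.\<close>

lemma functional_in_span:
  fixes g :: "'i \<Rightarrow> 'a::field fm \<Rightarrow> 'a"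
  assumes "finite G" "\<And>i. i \<in> G \<Longrightarrow> linf (g i)" "linf \<psi>" "fm.subspace S"
    "\<And>x. x \<in> S \<Longrightarrow> (\<And>i. i \<in> G \<Longrightarrow> g i x = 0) \<Longrightarrow> \<psi> x = 0"
  shows "\<exists>c. \<forall>x\<in>S. \<psi> x = (\<Sum>i\<in>G. c i * g i x)"
  using assms
proof (induction G arbitrary: S rule: finite_induct)
  case (insert k G)
  note lk = insert.prems(1)[of k, simplified]
  define S' where "S' = {x \<in> S. g k x = 0}"
  have "fm.subspace S'" unfolding S'_def
    using insert.prems(3) fmf.linear_add[OF lk] fmf.linear_scale[OF lk] fmf.linear_0[OF lk]
    by (auto simp: fm.subspace_def)
  then have "\<exists>c. \<forall>x\<in>S'. \<psi> x = (\<Sum>i\<in>G. c i * g i x)"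
    using insert.prems(1,2,4) by (intro insert.IH) (auto simp: S'_def)
  then obtain c where c: "\<And>x. x \<in> S' \<Longrightarrow> \<psi> x = (\<Sum>i\<in>G. c i * g i x)" by blast
  show ?case
  proof (cases "\<exists>y\<in>S. g k y \<noteq> 0")
    case False
    then have "S' = S" by (auto simp: S'_def)
    then have "\<forall>x\<in>S. \<psi> x = (\<Sum>i\<in>insert k G. (c(k := 0)) i * g i x)"
      using c insert.hyps by (auto intro!: sum.cong)
    then show ?thesis by blast
  next
    case True
    then obtain y where y: "y \<in> S" "g k y \<noteq> 0" by blast
    define a where "a = (\<psi> y - (\<Sum>i\<in>G. c i * g i y)) / g k y"
    have "\<psi> x = (\<Sum>i\<in>insert k G. (c(k := a)) i * g i x)" if x: "x \<in> S" for x
    proof -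
      define t where "t = g k x / g k y"
      define z where "z = x - mscale t y"
      have "z \<in> S" unfolding z_def
        using x y insert.prems(3) by (simp add: fm.subspace_diff fm.subspace_scale)
      moreover have "g k z = 0" unfolding z_def
        using y by (simp add: fmf.linear_diff[OF lk] fmf.linear_scale[OF lk] t_def)
      ultimately have "\<psi> z = (\<Sum>i\<in>G. c i * g i z)" by (intro c) (simp add: S'_def)
      moreover have "\<psi> z = \<psi> x - t * \<psi> y" unfolding z_def
        by (simp add: fmf.linear_diff[OF insert.prems(2)] fmf.linear_scale[OF insert.prems(2)])
      moreover have "(\<Sum>i\<in>G. c i * g i z) = (\<Sum>i\<in>G. c i * g i x) - t * (\<Sum>i\<in>G. c i * g i y)"
      proof -
        have "g i z = g i x - t * g i y" if "i \<in> G" for i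
          using insert.prems(1)[of i] that unfolding z_def
          by (simp add: fmf.linear_diff fmf.linear_scale)
        then have "(\<Sum>i\<in>G. c i * g i z) = (\<Sum>i\<in>G. c i * (g i x - t * g i y))"
          by (intro sum.cong) auto
        then show ?thesis
          by (simp add: algebra_simps sum_subtractf sum_distrib_left)
      qed
      ultimately have "\<psi> x = (\<Sum>i\<in>G. c i * g i x) + t * (\<psi> y - (\<Sum>i\<in>G. c i * g i y))"
        by (simp add: algebra_simps)
      also have "t * (\<psi> y - (\<Sum>i\<in>G. c i * g i y)) = a * g k x"
        using y by (simp add: a_def t_def)
      finally have "\<psi> x = a * g k x + (\<Sum>i\<in>G. c i * g i x)" by simp
      also have "(\<Sum>i\<in>G. c i * g i x) = (\<Sum>i\<in>G. (c(k := a)) i * g i x)"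
        using insert.hyps by (intro sum.cong) auto
      finally show ?thesis using insert.hyps by simp
    qed
    then show ?thesis by blast
  qed
qed simp

text \<open>\<open>L\<close> is the direct sum of \<open>S\<close> and the isotropic
  \<open>V\<close>, with projection \<open>pr\<close> to \<open>S\<close>. By nondegeneracy the
  radical meets \<open>V\<close> in 0, so \<open>pr\<close> is injective on it; conversely a vector
  \<open>z\<close> in the reduced radical can be corrected by an element of \<open>V\<close>. If
  \<open>V\<close> is an abelian ideal and \<open>B\<close> a Kirillov form, the part of
  \<open>S\<close> orthogonal to \<open>V\<close> is the stabilizer of the functional on
  \<open>V\<close>, so the index passes to a smaller algebra.\<close>

lemma symplectic_reduction:
  fixes B :: "'a::field fm \<Rightarrow> 'a fm \<Rightarrow> 'a"
  assumes L: "fd L" and B: "bilin B" and alt: "\<And>x y. B y x = - B x y"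
    and S: "fm.subspace S" "S \<subseteq> L" and V: "fm.subspace V" "V \<subseteq> L"
    and pr: "lin pr" "\<And>x. x \<in> L \<Longrightarrow> pr x \<in> S" "\<And>x. x \<in> L \<Longrightarrow> x - pr x \<in> V"
      "\<And>x. x \<in> S \<Longrightarrow> pr x = x" "\<And>x. x \<in> V \<Longrightarrow> pr x = 0"
    and iso: "\<And>v w. v \<in> V \<Longrightarrow> w \<in> V \<Longrightarrow> B v w = 0"
    and nondeg: "\<And>v. v \<in> V \<Longrightarrow> (\<And>x. x \<in> S \<Longrightarrow> B x v = 0) \<Longrightarrow> v = 0"
  shows "fm.dim (rad L B) = fm.dim (rad {x \<in> S. \<forall>v\<in>V. B x v = 0} B)"
proof -
  define S0 where "S0 = {x \<in> S. \<forall>v\<in>V. B x v = 0}"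
  note b = bilin_simps[OF B]
  have split: "\<exists>s\<in>S. \<exists>v\<in>V. x = s + v" if "x \<in> L" for x
    using pr(2,3)[OF that] by (intro bexI[of _ "pr x"] bexI[of _ "x - pr x"]) auto
  have "inj_on pr (rad L B)"
    unfolding fmp.linear_inj_on_iff_eq_0[OF pr(1) subspace_rad[OF B fd_subspace[OF L]]]
  proof (intro ballI impI)
    fix x assume x: "x \<in> rad L B" "pr x = 0"
    then have "x \<in> V" using pr(3)[of x] by (simp add: rad_def)
    then show "x = 0"
    proof (rule nondeg)
      fix y assume "y \<in> S"
      then have "B x y = 0" using x S(2) by (auto simp: rad_def)
      then show "B y x = 0" using alt[of x y] by simp
    qed
  qed
  then have "fm.dim (pr ` rad L B) = fm.dim (rad L B)"
    by (rule dim_image_inj[OF pr(1) subspace_rad[OF B fd_subspace[OF L]]])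
  moreover have "pr ` rad L B = rad S0 B"
  proof (intro equalityI subsetI)
    fix z assume "z \<in> pr ` rad L B"
    then obtain x where x: "x \<in> rad L B" "z = pr x" by blast
    then have xL: "x \<in> L" by (simp add: rad_def)
    define v where "v = x - pr x"
    have v: "v \<in> V" "x = z + v" using pr(3)[OF xL] x(2) by (auto simp: v_def)
    have z: "z \<in> S" using pr(2)[OF xL] x by simp
    have zw: "B z w = 0" if "w \<in> V" for w
    proof -
      have "B x w = 0" using x that V(2) by (auto simp: rad_def)
      then show ?thesis using iso[OF v(1) that] by (simp add: v(2) b)
    qed
    have "B z y = 0" if y: "y \<in> S0" for y
    proof -
      have "B x y = 0" using x y S(2) by (auto simp: rad_def S0_def)
      moreover have "B v y = 0" using y v(1) alt[of y v] by (simp add: S0_def)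
      ultimately show ?thesis by (simp add: v(2) b)
    qed
    then show "z \<in> rad S0 B" using z zw by (simp add: rad_def S0_def)
  next
    fix z assume z: "z \<in> rad S0 B"
    then have zS: "z \<in> S" "\<And>v. v \<in> V \<Longrightarrow> B z v = 0" by (auto simp: rad_def S0_def)
    obtain G where G: "G \<subseteq> V" "finite G" "fm.independent G" "fm.span G = V" "card G = fm.dim V"
      using fd_basis[OF fd_subset[OF L V]] .
    \<comment> \<open>\<open>B z\<close> vanishes on \<open>S0\<close>, the common kernel in
      \<open>S\<close> of the pairings with a basis of \<open>V\<close>. Hence on \<open>S\<close>
      it is the pairing with some \<open>w\<close> in \<open>V\<close>, and \<open>z + w\<close>
      lies in the radical of \<open>L\<close>.\<close>
    have "\<exists>c. \<forall>y\<in>S. B z y = (\<Sum>v\<in>G. c v * B y v)"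
    proof (rule functional_in_span[OF G(2)])
      fix y assume y: "y \<in> S" "\<And>v. v \<in> G \<Longrightarrow> B y v = 0"
      have "B y v = 0" if "v \<in> V" for v
        by (rule bilin_span_0[OF B, of G]) (use y(2) that G(4) in auto)
      then have "y \<in> S0" using y(1) by (simp add: S0_def)
      then show "B z y = 0" using z by (simp add: rad_def)
    qed (use B S(1) in \<open>auto simp: bilin_def\<close>)
    then obtain c where c: "\<And>y. y \<in> S \<Longrightarrow> B z y = (\<Sum>v\<in>G. c v * B y v)" by blast
    define w where "w = (\<Sum>v\<in>G. mscale (c v) v)"
    have w: "w \<in> V" unfolding w_def
      using G(1) V(1) by (intro fm.subspace_sum fm.subspace_scale) auto
    have cw: "B z y = B y w" if "y \<in> S" for y
      using c[OF that] by (simp add: w_def bilin_sum[OF B])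
    have "B (z + w) y = 0" if yL: "y \<in> L" for y
    proof -
      obtain s v where sv: "s \<in> S" "v \<in> V" "y = s + v" using split[OF yL] by blast
      then show ?thesis using cw[OF sv(1)] zS(2)[OF sv(2)] iso[OF w sv(2)] alt[of s w] by (simp add: b)
    qed
    then have "z + w \<in> rad L B"
      using zS(1) w S(2) V(2) fm.subspace_add[OF fd_subspace[OF L], of z w] by (auto simp: rad_def)
    moreover have "pr (z + w) = z" using pr(4)[OF zS(1)] pr(5)[OF w] fmp.linear_add[OF pr(1)] by simp
    ultimately show "z \<in> pr ` rad L B" by (metis imageI)
  qed
  ultimately show ?thesis by (simp add: S0_def)
qed

subsection \<open>Matrix Lie algebras and their index\<close>

text \<open>Matrices of all sizes share the type \<open>fm\<close>; the size \<open>N\<close> only bounds the summation in products.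
  \<open>Inc \<rho>\<close> is the incidence algebra of \<open>\<rho>\<close> when \<open>\<rho>\<close> is transitive.\<close>

definition mm :: "nat \<Rightarrow> 'a::field fm \<Rightarrow> 'a fm \<Rightarrow> 'a fm" where
  "mm N A B = Fm (\<lambda>i j. \<Sum>k<N. ent A i k * ent B k j)"

definition br :: "nat \<Rightarrow> 'a::field fm \<Rightarrow> 'a fm \<Rightarrow> 'a fm" where
  "br N A B = mm N A B - mm N B A"

definition one_fm :: "nat \<Rightarrow> 'a::field fm" where
  "one_fm N = Fm (\<lambda>i j. if i = j \<and> i < N then 1 else 0)"

definition munit :: "nat \<Rightarrow> nat \<Rightarrow> 'a::field fm" where
  "munit i j = Fm (\<lambda>p q. if p = i \<and> q = j then 1 else 0)"

definition Inc :: "(nat \<times> nat) set \<Rightarrow> 'a::field fm set" where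
  "Inc \<rho> = {A. \<forall>i j. (i, j) \<notin> \<rho> \<longrightarrow> ent A i j = 0}"

definition mask :: "(nat \<times> nat) set \<Rightarrow> 'a::field fm \<Rightarrow> 'a fm" where
  "mask \<rho> A = Fm (\<lambda>i j. if (i, j) \<in> \<rho> then ent A i j else 0)"

definition kform :: "nat \<Rightarrow> ('a::field fm \<Rightarrow> 'a) \<Rightarrow> 'a fm \<Rightarrow> 'a fm \<Rightarrow> 'a" where
  "kform N \<phi> = (\<lambda>x y. \<phi> (br N x y))"

text \<open>Functionals are taken on the whole type, since every functional on a subspace extends;
  only the values on brackets of elements of \<open>L\<close> enter.\<close>

definition lieind :: "nat \<Rightarrow> 'a::field fm set \<Rightarrow> nat" where
  "lieind N L = (LEAST d. \<exists>\<phi>. linf \<phi> \<and> d = fm.dim (rad L (kform N \<phi>)))"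

lemma ent_mm: "ent (mm N A B) i j = (\<Sum>k<N. ent A i k * ent B k j)"
  by (simp add: mm_def)

lemma mm_add: "mm N (A + A') B = mm N A B + mm N A' B" "mm N A (B + B') = mm N A B + mm N A B'"
  by (simp_all add: fm_eq_iff ent_mm algebra_simps sum.distrib)

lemma mm_scale: "mm N (mscale c A) B = mscale c (mm N A B)" "mm N A (mscale c B) = mscale c (mm N A B)"
  by (simp_all add: fm_eq_iff ent_mm sum_distrib_left algebra_simps)

lemma mm_diff: "mm N (A - A') B = mm N A B - mm N A' B" "mm N A (B - B') = mm N A B - mm N A B'"
  by (simp_all add: fm_eq_iff ent_mm algebra_simps sum_subtractf)

lemma mm_0: "mm N 0 B = 0" "mm N A 0 = 0"
  by (simp_all add: fm_eq_iff ent_mm)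

lemma mm_assoc: "mm N (mm N A B) C = mm N A (mm N B C)"
proof (rule fm_eqI)
  fix i j
  have "(\<Sum>k<N. (\<Sum>l<N. ent A i l * ent B l k) * ent C k j)
      = (\<Sum>k<N. \<Sum>l<N. ent A i l * (ent B l k * ent C k j))"
    by (simp add: sum_distrib_right mult.assoc)
  also have "\<dots> = (\<Sum>l<N. \<Sum>k<N. ent A i l * (ent B l k * ent C k j))"
    by (rule sum.swap)
  also have "\<dots> = (\<Sum>l<N. ent A i l * (\<Sum>k<N. ent B l k * ent C k j))"
    by (simp add: sum_distrib_left)
  finally show "ent (mm N (mm N A B) C) i j = ent (mm N A (mm N B C)) i j"
    by (simp add: ent_mm)
qed

lemma lin_mm: "lin (mm N A)" "lin (\<lambda>B. mm N B A)"
  by (rule linI; simp add: mm_add mm_scale)+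

lemma ent_munit: "ent (munit i j) p q = (if p = i \<and> q = j then 1 else 0)"
  by (simp add: munit_def)

lemma ent_one_fm: "ent (one_fm N) i j = (if i = j \<and> i < N then 1 else 0)"
  by (simp add: one_fm_def)

lemma ent_mask: "ent (mask \<rho> A) i j = (if (i, j) \<in> \<rho> then ent A i j else 0)"
  by (simp add: mask_def)

lemma mm_munit:
  "ent (mm N A (munit i j)) p q = (if q = j \<and> i < N then ent A p i else 0)"
  "ent (mm N (munit i j) A) p q = (if p = i \<and> j < N then ent A j q else 0)"
  by (simp_all add: ent_mm ent_munit if_distrib if_distribR sum.delta cong: if_cong)
    (auto intro!: sum.neutral)

lemma mm_one:
  assumes "A \<in> Inc ({..<N} \<times> {..<N})"
  shows "mm N (one_fm N) A = A" "mm N A (one_fm N) = A"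
proof -
  have z: "ent A i j = 0" if "\<not> (i < N \<and> j < N)" for i j using assms that by (auto simp: Inc_def)
  have 1: "ent (mm N (one_fm N) A) i j = ent A i j" for i j
  proof -
    have "ent (mm N (one_fm N) A) i j = (\<Sum>k<N. if i = k then ent A k j else 0)"
      unfolding ent_mm ent_one_fm by (rule sum.cong) auto
    then show ?thesis using z[of i j] by (auto simp: sum.delta)
  qed
  have 2: "ent (mm N A (one_fm N)) i j = ent A i j" for i j
  proof -
    have "ent (mm N A (one_fm N)) i j = (\<Sum>k<N. if k = j then ent A i k else 0)"
      unfolding ent_mm ent_one_fm by (rule sum.cong) auto
    then show ?thesis using z[of i j] by (auto simp: sum.delta')
  qed
  show "mm N (one_fm N) A = A" "mm N A (one_fm N) = A" using 1 2 by (auto simp: fm_eq_iff)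
qed

lemma IncI: "(\<And>i j. (i, j) \<notin> \<rho> \<Longrightarrow> ent A i j = 0) \<Longrightarrow> A \<in> Inc \<rho>"
  by (simp add: Inc_def)

lemma IncD: "A \<in> Inc \<rho> \<Longrightarrow> (i, j) \<notin> \<rho> \<Longrightarrow> ent A i j = 0"
  by (simp add: Inc_def)

lemma Inc_mono: "\<rho> \<subseteq> \<sigma> \<Longrightarrow> Inc \<rho> \<subseteq> Inc \<sigma>"
  by (auto simp: Inc_def)

lemma Inc_mm: "A \<in> Inc \<rho> \<Longrightarrow> B \<in> Inc \<sigma> \<Longrightarrow> mm N A B \<in> Inc (\<rho> O \<sigma>)"
proof (rule IncI)
  fix i j assume A: "A \<in> Inc \<rho>" "B \<in> Inc \<sigma>" "(i, j) \<notin> \<rho> O \<sigma>"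
  have "ent A i k * ent B k j = 0" for k
  proof (cases "(i, k) \<in> \<rho>")
    case True
    then have "(k, j) \<notin> \<sigma>" using A(3) by blast
    then show ?thesis using IncD[OF A(2)] by simp
  qed (use IncD[OF A(1)] in simp)
  then show "ent (mm N A B) i j = 0" by (simp add: ent_mm)
qed

lemma subspace_Inc: "fm.subspace (Inc \<rho>)"
  by (auto simp: Inc_def fm.subspace_def)

lemma munit_Inc: "munit i j \<in> Inc \<rho> \<longleftrightarrow> (i, j) \<in> \<rho>"
  by (auto simp: Inc_def ent_munit)

lemma Inc_expand:
  assumes "finite \<rho>" "A \<in> Inc \<rho>"
  shows "A = (\<Sum>p\<in>\<rho>. mscale (ent A (fst p) (snd p)) (munit (fst p) (snd p)))"
proof (rule fm_eqI)
  fix i j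
  have "ent (\<Sum>p\<in>\<rho>. mscale (ent A (fst p) (snd p)) (munit (fst p) (snd p))) i j
     = (\<Sum>p\<in>\<rho>. if p = (i, j) then ent A i j else 0)"
    unfolding ent_sum by (rule sum.cong) (auto simp: ent_munit)
  also have "\<dots> = ent A i j" using assms IncD[OF assms(2)] by (simp add: sum.delta')
  finally show "ent A i j = ent (\<Sum>p\<in>\<rho>. mscale (ent A (fst p) (snd p)) (munit (fst p) (snd p))) i j" ..
qed

lemma Inc_span:
  assumes "finite \<rho>"
  shows "Inc \<rho> = fm.span ((\<lambda>p. munit (fst p) (snd p)) ` \<rho>)"
proof (intro equalityI subsetI)
  fix A assume A: "A \<in> Inc \<rho>"
  show "A \<in> fm.span ((\<lambda>p. munit (fst p) (snd p)) ` \<rho>)"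
    by (subst Inc_expand[OF assms A]) (intro fm.span_sum fm.span_scale fm.span_base imageI)
next
  fix A :: "'a fm" assume "A \<in> fm.span ((\<lambda>p. munit (fst p) (snd p)) ` \<rho>)"
  moreover have "fm.span ((\<lambda>p. munit (fst p) (snd p)) ` \<rho>) \<subseteq> Inc \<rho>"
    by (rule fm.span_minimal) (auto simp: munit_Inc subspace_Inc)
  ultimately show "A \<in> Inc \<rho>" by blast
qed

lemma fd_Inc: "finite \<rho> \<Longrightarrow> fd (Inc \<rho>)"
  unfolding fd_def using subspace_Inc Inc_span[of \<rho>] by blast

lemma dim_Inc:
  assumes "finite \<rho>"
  shows "fm.dim (Inc \<rho> :: 'a::field fm set) = card \<rho>"
proof -
  let ?u = "\<lambda>p. munit (fst p) (snd p) :: 'a fm"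
  have inj: "inj_on ?u \<rho>"
  proof (rule inj_onI)
    fix p q assume "?u p = ?u q"
    then have "ent (?u p) (fst p) (snd p) = ent (?u q) (fst p) (snd p)" by simp
    then show "p = q" by (simp add: ent_munit prod_eq_iff split: if_splits)
  qed
  have "fm.independent (?u ` \<rho>)"
  proof (rule fm.independent_if_scalars_zero)
    show "finite (?u ` \<rho>)" using assms by simp
    fix f x assume f: "(\<Sum>x\<in>?u ` \<rho>. mscale (f x) x) = 0" and "x \<in> ?u ` \<rho>"
    then obtain p where p: "p \<in> \<rho>" "x = ?u p" by blast
    have "(\<Sum>p\<in>\<rho>. mscale (f (?u p)) (?u p)) = 0" using f unfolding sum.reindex[OF inj] by simp
    then have "ent (\<Sum>p\<in>\<rho>. mscale (f (?u p)) (?u p)) (fst p) (snd p) = 0" by simp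
    then have "(\<Sum>q\<in>\<rho>. if q = p then f (?u p) else 0) = 0"
      unfolding ent_sum by (subst (asm) sum.cong[OF refl, of _ _ "\<lambda>q. if q = p then f (?u p) else 0"])
        (auto simp: ent_munit prod_eq_iff)
    then show "f x = 0" using p assms by (simp add: sum.delta')
  qed
  then show ?thesis
    unfolding Inc_span[OF assms] using fm.dim_span_eq_card_independent card_image[OF inj] by metis
qed

lemma linf_eq_Inc:
  assumes "finite \<rho>" "linf \<phi>" "linf \<psi>" "\<And>i j. (i, j) \<in> \<rho> \<Longrightarrow> \<phi> (munit i j) = \<psi> (munit i j)" "A \<in> Inc \<rho>"
  shows "\<phi> A = \<psi> A"
proof (rule fmf.linear_eq_on[OF assms(2,3)])
  show "A \<in> fm.span ((\<lambda>p. munit (fst p) (snd p)) ` \<rho>)" using Inc_span[OF assms(1)] assms(5) by blast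
qed (use assms(4) in auto)

lemma lin_mask: "lin (mask \<rho>)"
  by (rule linI) (auto simp: fm_eq_iff ent_mask)

lemma mask_Inc: "mask \<rho> A \<in> Inc \<rho>"
  by (auto simp: Inc_def ent_mask)

lemma mask_ident: "A \<in> Inc \<rho> \<Longrightarrow> \<rho> \<subseteq> \<sigma> \<Longrightarrow> mask \<sigma> A = A"
  by (rule fm_eqI) (auto simp: Inc_def ent_mask)

lemma linf_ent: "linf (\<lambda>A. ent A i j)"
  by (rule linfI) auto

lemma linf_sum_ent: "linf (\<lambda>A. \<Sum>z\<in>Z. ent A (f z) (g z))"
  by (rule linfI) (auto simp: sum.distrib sum_distrib_left)

lemma linf_compose: "lin f \<Longrightarrow> linf \<phi> \<Longrightarrow> linf (\<lambda>A. \<phi> (f A))"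
  using Vector_Spaces.linear_compose[of mscale mscale f "(*)" \<phi>] by (simp add: o_def)

lemma linf_add: "linf \<phi> \<Longrightarrow> linf \<psi> \<Longrightarrow> linf (\<lambda>A. \<phi> A + \<psi> A)"
  by (rule linfI) (simp_all add: fmf.linear_add fmf.linear_scale algebra_simps)

lemma linf_diff: "linf \<phi> \<Longrightarrow> linf \<psi> \<Longrightarrow> linf (\<lambda>A. \<phi> A - \<psi> A)"
  by (rule linfI) (simp_all add: fmf.linear_add fmf.linear_scale algebra_simps)

lemma linf_cmult: "linf \<phi> \<Longrightarrow> linf (\<lambda>A. c * \<phi> A)"
  by (rule linfI) (simp_all add: fmf.linear_add fmf.linear_scale algebra_simps)

lemma bilin_kform: "linf \<phi> \<Longrightarrow> bilin (kform N \<phi>)"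
  unfolding bilin_def kform_def br_def
  by (intro conjI allI linfI) (simp_all add: mm_add mm_scale fmf.linear_add fmf.linear_diff fmf.linear_scale algebra_simps)

lemma kform_alt: "linf \<phi> \<Longrightarrow> kform N \<phi> y x = - kform N \<phi> x y"
  by (simp add: kform_def br_def fmf.linear_diff)

lemma lieind_le: "linf \<phi> \<Longrightarrow> lieind N L \<le> fm.dim (rad L (kform N \<phi>))"
  unfolding lieind_def by (rule Least_le) blast

lemma lieind_attained:
  obtains \<phi> where "linf \<phi>" "fm.dim (rad L (kform N \<phi>)) = lieind N L"
proof -
  have "\<exists>d \<phi>. linf \<phi> \<and> d = fm.dim (rad L (kform N \<phi>))" using linf_ent by blast
  from LeastI_ex[OF this] show ?thesis using that unfolding lieind_def by metis
qed

lemma lieind_eqI: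
  assumes "\<And>\<phi>. linf \<phi> \<Longrightarrow> d \<le> fm.dim (rad L (kform N \<phi>))"
    and "linf \<psi>" "fm.dim (rad L (kform N \<psi>)) \<le> d"
  shows "lieind N L = d"
  using lieind_attained[of L N] lieind_le[OF assms(2), of N L] assms(1,3) by (metis order_antisym order_trans)

lemma rad_image:
  assumes "lin f" "fm.subspace L" "inj_on f L" "bilin B"
    "\<And>x y. x \<in> L \<Longrightarrow> y \<in> L \<Longrightarrow> B x y = s * B' (f x) (f y)" "s \<noteq> 0"
  shows "fm.dim (rad (f ` L) B') = fm.dim (rad L B)"
proof -
  have "rad (f ` L) B' = f ` rad L B" using assms(5,6) by (auto simp: rad_def)
  then show ?thesis
    using dim_image_inj[OF assms(1) subspace_rad[OF assms(4,2)]] inj_on_subset[OF assms(3), of "rad L B"]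
    by (simp add: rad_def subset_iff)
qed

text \<open>The factor \<open>s\<close> admits anti-isomorphisms of associative algebras, which
  respect brackets up to the sign -1. Functionals move forward along a linear left inverse of
  \<open>f\<close> and back by composition.\<close>

lemma lieind_image:
  assumes f: "lin f" "fm.subspace L" "inj_on f L"
    and hom: "\<And>x y. x \<in> L \<Longrightarrow> y \<in> L \<Longrightarrow> f (br N x y) = mscale s (br N (f x) (f y))" "s \<noteq> 0"
    and cl: "\<And>x y. x \<in> L \<Longrightarrow> y \<in> L \<Longrightarrow> br N x y \<in> L"
  shows "lieind N (f ` L) = lieind N L"
proof (rule order_antisym)
  obtain \<phi> where \<phi>: "linf \<phi>" "fm.dim (rad L (kform N \<phi>)) = lieind N L" using lieind_attained .
  obtain g where g: "lin g" "\<forall>v\<in>L. g (f v) = v"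
    using fmp.linear_exists_left_inverse_on[OF f] by blast
  have l: "linf (\<lambda>A. \<phi> (g A))" by (rule linf_compose[OF g(1) \<phi>(1)])
  have "fm.dim (rad (f ` L) (kform N (\<lambda>A. \<phi> (g A)))) = fm.dim (rad L (kform N \<phi>))"
  proof (rule rad_image[OF f bilin_kform[OF \<phi>(1)] _ hom(2)])
    fix x y assume xy: "x \<in> L" "y \<in> L"
    have "br N x y = g (f (br N x y))" using g(2) cl[OF xy] by simp
    also have "\<dots> = mscale s (g (br N (f x) (f y)))" unfolding hom(1)[OF xy] by (rule fmp.linear_scale[OF g(1)])
    finally show "kform N \<phi> x y = s * kform N (\<lambda>A. \<phi> (g A)) (f x) (f y)"
      using fmf.linear_scale[OF \<phi>(1)] by (simp add: kform_def)
  qed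
  then show "lieind N (f ` L) \<le> lieind N L" using lieind_le[OF l, of N "f ` L"] \<phi>(2) by simp
next
  obtain \<phi> where \<phi>: "linf \<phi>" "fm.dim (rad (f ` L) (kform N \<phi>)) = lieind N (f ` L)" using lieind_attained .
  have l: "linf (\<lambda>A. \<phi> (f A))" by (rule linf_compose[OF f(1) \<phi>(1)])
  have "fm.dim (rad (f ` L) (kform N \<phi>)) = fm.dim (rad L (kform N (\<lambda>A. \<phi> (f A))))"
    by (rule rad_image[OF f bilin_kform[OF l] _ hom(2)])
      (simp add: kform_def hom fmf.linear_scale[OF \<phi>(1)])
  then show "lieind N L \<le> lieind N (f ` L)" using lieind_le[OF l, of N L] \<phi>(2) by simp
qed

lemma br_Inc:
  assumes "trans \<rho>" "A \<in> Inc \<rho>" "B \<in> Inc \<rho>"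
  shows "br N A B \<in> Inc \<rho>"
proof -
  have "mm N X Y \<in> Inc \<rho>" if "X \<in> Inc \<rho>" "Y \<in> Inc \<rho>" for X Y :: "'a fm"
    using Inc_mm[OF that] Inc_mono[OF trans_O_subset[OF assms(1)]] by blast
  then show ?thesis unfolding br_def using assms(2,3) by (intro fm.subspace_diff subspace_Inc)
qed

definition transp :: "'a fm \<Rightarrow> 'a fm" where
  "transp A = Fm (\<lambda>i j. ent A j i)"

text \<open>Transposition reverses products, hence the factor -1. This is what allows the two outer
  blocks of a shape to be exchanged.\<close>

lemma lieind_converse:
  assumes "trans \<rho>"
  shows "lieind N (Inc (\<rho>\<inverse>) :: 'a::field fm set) = lieind N (Inc \<rho> :: 'a fm set)"
proof -
  have img: "(Inc (\<rho>\<inverse>) :: 'a fm set) = transp ` Inc \<rho>"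
  proof (intro equalityI subsetI)
    fix A :: "'a fm" assume "A \<in> Inc (\<rho>\<inverse>)"
    then have "transp A \<in> Inc \<rho>" by (auto simp: Inc_def transp_def)
    moreover have "A = transp (transp A)" by (simp add: fm_eq_iff transp_def)
    ultimately show "A \<in> transp ` Inc \<rho>" by blast
  qed (auto simp: Inc_def transp_def)
  show ?thesis unfolding img
  proof (rule lieind_image[where s = "-1"])
    show "lin (transp :: 'a fm \<Rightarrow> _)" by (rule linI) (auto simp: fm_eq_iff transp_def)
    show "inj_on transp (Inc \<rho> :: 'a fm set)" by (rule inj_onI) (auto simp: fm_eq_iff transp_def)
    show "transp (br N x y) = mscale (- 1) (br N (transp x) (transp y))" for x y :: "'a fm"
      by (simp add: fm_eq_iff transp_def br_def ent_mm mult.commute)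
  qed (use br_Inc[OF assms] subspace_Inc in auto)
qed

subsection \<open>Reduction along an abelian ideal\<close>

lemma bilin_Inc_0:
  assumes "bilin B" "finite \<rho>" "\<And>i j. (i, j) \<in> \<rho> \<Longrightarrow> B x (munit i j) = 0" "v \<in> Inc \<rho>"
  shows "B x v = 0"
proof (rule bilin_span_0[OF assms(1)])
  show "v \<in> fm.span ((\<lambda>p. munit (fst p) (snd p)) ` \<rho>)" using assms(4) Inc_span[OF assms(2)] by blast
qed (use assms(3) in auto)

text \<open>\<open>Inc (Z \<times> W')\<close> is the abelian ideal: \<open>cl\<close> makes it
  stable under the \<open>W\<close> block, disjointness makes its products vanish. A generic
  functional on it is a matrix of full rank |Z|, with normal form the matching
  \<open>\<iota>\<close> of \<open>Z\<close> with part of \<open>W'\<close>. By \<open>full\<close>,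
  the rows in \<open>W'\<close> have every entry in the matched columns, which suffices to bring a
  generic functional to this form.\<close>

locale reduction =
  fixes N :: nat and Z W W' :: "nat set" and D \<omega> :: "(nat \<times> nat) set" and \<iota> :: "nat \<Rightarrow> nat"
  assumes disj: "Z \<inter> W = {}" and W': "W' \<subseteq> W" and bound: "Z \<subseteq> {..<N}" "W \<subseteq> {..<N}"
    and D: "D \<subseteq> Z \<times> Z" "trans D" and \<omega>: "\<omega> \<subseteq> W \<times> W" "trans \<omega>"
    and cl: "\<And>w v. w \<in> W' \<Longrightarrow> (w, v) \<in> \<omega> \<Longrightarrow> v \<in> W'"
    and \<iota>: "inj_on \<iota> Z" "\<iota> ` Z \<subseteq> W'"
    and full: "\<And>w z. w \<in> W' \<Longrightarrow> z \<in> Z \<Longrightarrow> (w, \<iota> z) \<in> \<omega>"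
begin

definition "\<rho> = D \<union> \<omega> \<union> Z \<times> W'"
text \<open>The shape of the stabilizer as seen on \<open>W\<close> alone. In the rows of
  \<open>W'\<close> the matched columns are not free any more: they repeat the \<open>Z\<close>
  block, hence the copy of \<open>D\<close>. Rows outside \<open>W'\<close> impose no condition and
  keep all entries.\<close>

definition "\<rho>' = {(w, v) \<in> \<omega>. v \<notin> \<iota> ` Z \<or> w \<notin> W'} \<union> (\<lambda>(z, y). (\<iota> z, \<iota> y)) ` D"

lemma finite_ZW: "finite Z" "finite W" "finite W'"
  using bound W' finite_subset[of _ "{..<N}"] by (meson finite_lessThan finite_subset)+

lemma finite_rels: "finite \<rho>" "finite D" "finite \<omega>" "finite (Z \<times> W')"
proof -
  show "finite D" by (rule finite_subset[OF D(1)]) (simp add: finite_ZW)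
  moreover show "finite \<omega>" by (rule finite_subset[OF \<omega>(1)]) (simp add: finite_ZW)
  moreover show "finite (Z \<times> W')" by (simp add: finite_ZW)
  ultimately show "finite \<rho>" by (simp add: \<rho>_def)
qed

lemma trans_\<rho>: "trans \<rho>"
proof (rule transI)
  fix x y z assume "(x, y) \<in> \<rho>" "(y, z) \<in> \<rho>"
  then show "(x, z) \<in> \<rho>"
    unfolding \<rho>_def using D \<omega> disj W' cl
    by (auto dest: transD)
qed

lemma \<rho>_sub: "\<rho> \<subseteq> {..<N} \<times> {..<N}"
  unfolding \<rho>_def using D(1) \<omega>(1) bound W' by blast

lemma \<rho>'_sub: "\<rho>' \<subseteq> \<omega>"
  unfolding \<rho>'_def using full \<iota> D(1) by (auto simp: image_subset_iff)

lemma \<rho>'_D: "(\<iota> z, \<iota> y) \<in> \<rho>' \<longleftrightarrow> (z, y) \<in> D" if "z \<in> Z" "y \<in> Z"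
proof -
  have "(z, y) \<in> D" if "(\<iota> z, \<iota> y) = (\<iota> z', \<iota> y')" "(z', y') \<in> D" for z' y'
    using that D(1) \<iota>(1) \<open>z \<in> Z\<close> \<open>y \<in> Z\<close> by (auto dest!: inj_onD[OF \<iota>(1)])
  then show ?thesis unfolding \<rho>'_def using that \<iota>(2) by auto
qed

text \<open>The inverse of forgetting the \<open>Z\<close> block: an element of the stabilizer is
  determined by its \<open>W\<close> block, which contains a copy of the \<open>Z\<close> block
  under \<open>\<iota>\<close>.\<close>

definition lift :: "'a::field fm \<Rightarrow> 'a fm" where
  "lift X = Fm (\<lambda>i j. if i \<in> Z \<and> j \<in> Z then ent X (\<iota> i) (\<iota> j)
    else if i \<in> W \<and> j \<in> W then ent X i j else 0)"

lemma ent_lift: "ent (lift X) i j = (if i \<in> Z \<and> j \<in> Z then ent X (\<iota> i) (\<iota> j)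
    else if i \<in> W \<and> j \<in> W then ent X i j else 0)"
  by (simp add: lift_def)

lemma lin_lift: "lin lift"
  by (rule linI) (auto simp: fm_eq_iff ent_lift)

lemma sum_ZW:
  assumes "\<And>k. k < N \<Longrightarrow> k \<notin> A \<Longrightarrow> f k = 0" "A \<subseteq> {..<N}"
  shows "(\<Sum>k<N. f k) = sum f A"
  by (rule sum.mono_neutral_right) (use assms in auto)

text \<open>Only the \<open>Z\<close> block is at issue. From \<open>\<iota> i\<close> the relation
  leads into \<open>W'\<close> by \<open>cl\<close>, and an entry from a row in \<open>W'\<close> to
  a matched column can only come from \<open>D\<close>; so the intermediate index is itself
  matched.\<close>

lemma lift_mm:
  assumes X: "X \<in> Inc \<rho>'" and Y: "Y \<in> Inc \<rho>'"
  shows "lift (mm N X Y) = mm N (lift X) (lift Y)"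
proof (rule fm_eqI)
  fix i j
  have WX: "ent X p q = 0" if "p \<notin> W \<or> q \<notin> W" for p q
    using IncD[OF X] that \<rho>'_sub \<omega>(1) by blast
  have WY: "ent Y p q = 0" if "p \<notin> W \<or> q \<notin> W" for p q
    using IncD[OF Y] that \<rho>'_sub \<omega>(1) by blast
  consider "i \<in> Z" "j \<in> Z" | "i \<in> W" "j \<in> W" | "i \<in> Z" "j \<notin> Z" | "i \<in> W" "j \<notin> W" | "i \<notin> Z" "i \<notin> W"
    by blast
  then show "ent (lift (mm N X Y)) i j = ent (mm N (lift X) (lift Y)) i j"
  proof cases
    case 1
    have "ent X (\<iota> i) k * ent Y k (\<iota> j) = 0" if "k \<notin> \<iota> ` Z" for k
    proof (rule ccontr)
      assume "\<not> ?thesis"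
      then have k: "(\<iota> i, k) \<in> \<rho>'" "(k, \<iota> j) \<in> \<rho>'" using IncD[OF X] IncD[OF Y] by fastforce+
      then have "k \<in> W'" using \<rho>'_sub cl \<iota>(2) 1 by blast
      moreover have "(k, \<iota> j) \<notin> (\<lambda>(z, y). (\<iota> z, \<iota> y)) ` D" using that D(1) by auto
      ultimately show False using k(2) 1 unfolding \<rho>'_def by auto
    qed
    then have "(\<Sum>k<N. ent X (\<iota> i) k * ent Y k (\<iota> j)) = (\<Sum>k\<in>\<iota> ` Z. ent X (\<iota> i) k * ent Y k (\<iota> j))"
      using \<iota>(2) W' bound by (intro sum_ZW) auto
    also have "\<dots> = (\<Sum>k\<in>Z. ent X (\<iota> i) (\<iota> k) * ent Y (\<iota> k) (\<iota> j))"
      using \<iota>(1) by (simp add: sum.reindex)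
    also have "\<dots> = (\<Sum>k\<in>Z. ent (lift X) i k * ent (lift Y) k j)"
      using 1 by (intro sum.cong) (auto simp: ent_lift)
    also have "\<dots> = (\<Sum>k<N. ent (lift X) i k * ent (lift Y) k j)"
      using bound 1 disj by (intro sum_ZW[symmetric]) (auto simp: ent_lift)
    finally show ?thesis using 1 by (simp add: ent_lift ent_mm)
  next
    case 2
    then have "i \<notin> Z" "j \<notin> Z" using disj by auto
    have "(\<Sum>k<N. ent X i k * ent Y k j) = (\<Sum>k<N. ent (lift X) i k * ent (lift Y) k j)"
      using 2 \<open>i \<notin> Z\<close> \<open>j \<notin> Z\<close> WX by (intro sum.cong) (auto simp: ent_lift)
    then show ?thesis using 2 \<open>i \<notin> Z\<close> \<open>j \<notin> Z\<close> by (simp add: ent_lift ent_mm)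
  next
    case 3
    then have "ent (lift X) i k * ent (lift Y) k j = 0" for k using disj by (auto simp: ent_lift)
    then show ?thesis using 3 disj by (auto simp: ent_lift ent_mm)
  next
    case 4
    then have "ent (lift X) i k * ent (lift Y) k j = 0" for k using disj by (auto simp: ent_lift)
    then show ?thesis using 4 disj by (auto simp: ent_lift ent_mm)
  next
    case 5
    then show ?thesis by (simp add: ent_lift ent_mm)
  qed
qed

lemma inj_lift: "inj_on lift (Inc \<rho>')"
proof (rule inj_onI, rule fm_eqI)
  fix X Y i j assume X: "X \<in> Inc \<rho>'" "Y \<in> Inc \<rho>'" and eq: "lift X = lift Y"
  show "ent X i j = ent Y i j"
  proof (cases "i \<in> W \<and> j \<in> W")
    case True
    then have "i \<notin> Z" using disj by auto
    then show ?thesis using arg_cong[OF eq, of "\<lambda>A. ent A i j"] True by (simp add: ent_lift)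
  next
    case False
    then have "(i, j) \<notin> \<rho>'" using \<rho>'_sub \<omega>(1) by blast
    then show ?thesis using X by (simp add: IncD)
  qed
qed

definition std :: "'a::field fm \<Rightarrow> 'a" where
  "std A = (\<Sum>z\<in>Z. ent A z (\<iota> z))"

lemma linf_std: "linf std"
  unfolding std_def by (rule linf_sum_ent)

lemma std_munit: "z \<in> Z \<Longrightarrow> std (munit z w) = (if w = \<iota> z then 1 else 0)"
proof -
  assume z: "z \<in> Z"
  have "std (munit z w) = (\<Sum>y\<in>Z. if y = z then if w = \<iota> z then 1 else 0 else 0)"
    unfolding std_def ent_munit by (rule sum.cong) auto
  then show ?thesis using z finite_ZW by (simp add: sum.delta')
qed

text \<open>The condition says that \<open>\<iota>\<close> intertwines the \<open>Z\<close>-block and the \<open>W'\<close>-block of \<open>x\<close>: it cuts out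
  the stabilizer of the functional \<open>std\<close> on the ideal \<open>Inc (Z \<times> W')\<close>.\<close>

lemma stabilizer:
  fixes \<phi> :: "'a::field fm \<Rightarrow> 'a"
  assumes \<phi>: "linf \<phi>" "\<And>z w. z \<in> Z \<Longrightarrow> w \<in> W' \<Longrightarrow> \<phi> (munit z w) = (if w = \<iota> z then 1 else 0)"
    and x: "x \<in> Inc (D \<union> \<omega>)"
  shows "z \<in> Z \<Longrightarrow> w \<in> W' \<Longrightarrow>
      kform N \<phi> x (munit z w) = (\<Sum>y\<in>Z. if w = \<iota> y then ent x y z else 0) - ent x w (\<iota> z)"
proof -
  assume zw: "z \<in> Z" "w \<in> W'"
  then have zwN: "z < N" "w < N" using bound W' by auto
  let ?c = "br N x (munit z w)"
  have "x \<in> Inc \<rho>" "munit z w \<in> Inc \<rho>"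
    using x zw Inc_mono[of "D \<union> \<omega>" \<rho>] by (auto simp: \<rho>_def munit_Inc)
  have e: "ent ?c p q = (if q = w then ent x p z else 0) - (if p = z then ent x w q else 0)" for p q
    using zwN by (simp add: br_def mm_munit)
  have "?c \<in> Inc (Z \<times> W')"
  proof (rule IncI)
    fix p q assume pq: "(p, q) \<notin> Z \<times> W'"
    have 1: "ent x p z = 0" if "q = w"
      by (rule IncD[OF x]) (use pq that zw D(1) \<omega>(1) disj in auto)
    have 2: "ent x w q = 0" if "p = z"
      by (rule IncD[OF x]) (use pq that zw D(1) W' disj cl in auto)
    show "ent ?c p q = 0" unfolding e using 1 2 by simp
  qed
  then have "\<phi> ?c = std ?c"
    by (rule linf_eq_Inc[OF finite_rels(4) \<phi>(1) linf_std, rotated]) (auto simp: \<phi>(2) std_munit)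
  also have "\<dots> = (\<Sum>y\<in>Z. if w = \<iota> y then ent x y z else 0) - (\<Sum>y\<in>Z. if y = z then ent x w (\<iota> z) else 0)"
    unfolding std_def e sum_subtractf by (intro arg_cong2[where f = minus] sum.cong refl) auto
  finally show ?thesis using zw finite_ZW by (simp add: kform_def sum.delta')
qed

text \<open>Isotropic reduction with \<open>V\<close> the ideal and \<open>S\<close> the algebra
  \<open>Inc (D \<union> \<omega>)\<close>. Off the ideal \<open>\<phi>\<close> stays arbitrary, and
  its values there define the reduced form.\<close>

lemma dim_rad_std:
  fixes \<phi> :: "'a::field fm \<Rightarrow> 'a"
  assumes \<phi>: "linf \<phi>" "\<And>z w. z \<in> Z \<Longrightarrow> w \<in> W' \<Longrightarrow> \<phi> (munit z w) = (if w = \<iota> z then 1 else 0)"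
  shows "fm.dim (rad (Inc \<rho>) (kform N \<phi>)) = fm.dim (rad (Inc \<rho>') (kform N (\<lambda>A. \<phi> (lift A))))"
proof -
  let ?S = "Inc (D \<union> \<omega>) :: 'a fm set" and ?V = "Inc (Z \<times> W') :: 'a fm set" and ?B = "kform N \<phi>"
  let ?T = "{x \<in> ?S. \<forall>v\<in>?V. ?B x v = 0}"
  have B: "bilin ?B" by (rule bilin_kform[OF \<phi>(1)])
  have sub: "D \<union> \<omega> \<subseteq> \<rho>" "Z \<times> W' \<subseteq> \<rho>" by (auto simp: \<rho>_def)
  have "fm.dim (rad (Inc \<rho>) ?B) = fm.dim (rad ?T ?B)"
  proof (rule symplectic_reduction[where pr = "mask (D \<union> \<omega>)" and V = ?V, OF fd_Inc[OF finite_rels(1)] B])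
    show "?B y x = - ?B x y" for x y by (rule kform_alt[OF \<phi>(1)])
    show "x - mask (D \<union> \<omega>) x \<in> ?V" if "x \<in> Inc \<rho>" for x
      using that by (auto simp: Inc_def ent_mask \<rho>_def)
    show "mask (D \<union> \<omega>) x = x" if "x \<in> ?S" for x using mask_ident[OF that] by simp
    show "mask (D \<union> \<omega>) x = 0" if x: "x \<in> ?V" for x
    proof (rule fm_eqI)
      fix i j
      have "(i, j) \<notin> Z \<times> W'" if "(i, j) \<in> D \<union> \<omega>" using that D(1) \<omega>(1) disj W' by blast
      then show "ent (mask (D \<union> \<omega>) x) i j = ent 0 i j" using IncD[OF x] by (auto simp: ent_mask)
    qed
    show "?B v w = 0" if "v \<in> ?V" "w \<in> ?V" for v w
    proof -
      have "(Z \<times> W') O (Z \<times> W') = {}" using disj W' by auto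
      then have "mm N v w = 0" "mm N w v = 0"
        using Inc_mm[OF that, of N] Inc_mm[OF that(2,1), of N] by (auto simp: Inc_def fm_eq_iff)
      then show ?thesis by (simp add: kform_def br_def fmf.linear_0[OF \<phi>(1)])
    qed
    show "v = 0" if v: "v \<in> ?V" and 0: "\<And>x. x \<in> ?S \<Longrightarrow> ?B x v = 0" for v
    proof (rule fm_eqI)
      fix z w
      show "ent v z w = ent 0 z w"
      proof (cases "z \<in> Z \<and> w \<in> W'")
        case True
        then have zw: "z \<in> Z" "w \<in> W'" by auto
        \<comment> \<open>Available by \<open>full\<close>; the pairing with this unit reads off the
          entry \<open>(z, w)\<close> of \<open>v\<close> up to sign.\<close>
        have m: "munit w (\<iota> z) \<in> ?S" using full[OF zw(2,1)] by (simp add: munit_Inc)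
        have "?B (munit w (\<iota> z)) v = - ent v z w"
        proof -
          have "(\<lambda>u. ?B (munit w (\<iota> z)) u) v = (\<lambda>u. - ent u z w) v"
          proof (rule linf_eq_Inc[OF finite_rels(4) _ _ _ v])
            show "linf (\<lambda>u. - ent u z w)" by (rule linfI) auto
            fix y u assume yu: "(y, u) \<in> Z \<times> W'"
            have "(\<Sum>t\<in>Z. if u = \<iota> t then ent (munit w (\<iota> z)) t y else 0) = 0"
              using disj W' zw(2) by (intro sum.neutral) (auto simp: ent_munit)
            then show "?B (munit w (\<iota> z)) (munit y u) = - ent (munit y u) z w"
              using stabilizer[OF \<phi> m, of y u] yu inj_onD[OF \<iota>(1), of z y] zw
              by (auto simp: ent_munit)
          qed (use B in \<open>auto simp: bilin_def\<close>)
          then show ?thesis by simp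
        qed
        then show ?thesis using 0[OF m] by simp
      next
        case False
        then show ?thesis using IncD[OF v] by auto
      qed
    qed
  qed (rule lin_mask mask_Inc subspace_Inc Inc_mono[OF sub(1)] Inc_mono[OF sub(2)])+
  \<comment> \<open>Orthogonality to the units of the ideal says: in a row matched with
    \<open>y\<close>, the column of \<open>\<iota> z\<close> repeats the entry \<open>(y, z)\<close>
    (\<open>st1\<close>); in an unmatched row of \<open>W'\<close> it vanishes (\<open>st2\<close>).
    So \<open>x\<close> is the lift of its \<open>W\<close> block.\<close>
  also have "?T = lift ` Inc \<rho>'"
  proof (intro equalityI subsetI)
    fix x assume x: "x \<in> ?T"
    then have xS: "x \<in> ?S" by simp
    have st: "ent x w (\<iota> z) = (\<Sum>y\<in>Z. if w = \<iota> y then ent x y z else 0)" if "z \<in> Z" "w \<in> W'" for z w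
      using stabilizer[OF \<phi> xS that] x that by (auto simp: munit_Inc)
    have st1: "ent x (\<iota> y) (\<iota> z) = ent x y z" if "y \<in> Z" "z \<in> Z" for y z
    proof -
      have "(\<Sum>t\<in>Z. if \<iota> y = \<iota> t then ent x t z else 0) = (\<Sum>t\<in>Z. if t = y then ent x y z else 0)"
        using inj_onD[OF \<iota>(1)] that by (intro sum.cong) auto
      then show ?thesis using st[OF that(2), of "\<iota> y"] that \<iota>(2) finite_ZW by (auto simp: sum.delta')
    qed
    have st2: "ent x w (\<iota> z) = 0" if "z \<in> Z" "w \<in> W'" "w \<notin> \<iota> ` Z" for z w
    proof -
      have "(\<Sum>y\<in>Z. if w = \<iota> y then ent x y z else 0) = 0" using that(3) by (intro sum.neutral) auto
      then show ?thesis using st[OF that(1,2)] by simp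
    qed
    define X where "X = mask (W \<times> W) x"
    have "X \<in> Inc \<rho>'"
    proof (rule IncI)
      fix i j assume ij: "(i, j) \<notin> \<rho>'"
      show "ent X i j = 0"
      proof (cases "(i, j) \<in> \<omega>")
        case True
        then obtain z where z: "j = \<iota> z" "z \<in> Z" "i \<in> W'" using ij unfolding \<rho>'_def by blast
        have "ent x i j = 0"
        proof (cases "i \<in> \<iota> ` Z")
          case True
          then obtain y where y: "i = \<iota> y" "y \<in> Z" by blast
          then have "(y, z) \<notin> D" using ij z \<rho>'_D by blast
          then have "ent x y z = 0" using y z disj \<omega>(1) by (intro IncD[OF xS]) auto
          then show ?thesis using st1[OF y(2) z(2)] y z by simp
        qed (use st2 z in auto)
        then show ?thesis by (simp add: X_def ent_mask)
      next
        case False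
        show ?thesis
        proof (cases "(i, j) \<in> W \<times> W")
          case True
          then have "ent x i j = 0" using False D(1) disj by (intro IncD[OF xS]) auto
          then show ?thesis by (simp add: X_def ent_mask)
        qed (auto simp: X_def ent_mask)
      qed
    qed
    moreover have "lift X = x"
    proof (rule fm_eqI)
      fix i j
      consider "i \<in> Z" "j \<in> Z" | "i \<in> W" "j \<in> W" "i \<notin> Z" | "\<not> (i \<in> Z \<and> j \<in> Z)" "\<not> (i \<in> W \<and> j \<in> W)"
        using disj by blast
      then show "ent (lift X) i j = ent x i j"
      proof cases
        case 1
        have "ent (lift X) i j = ent x (\<iota> i) (\<iota> j)" using 1 \<iota>(2) W' by (auto simp: ent_lift X_def ent_mask)
        then show ?thesis using st1[OF 1] by simp
      next
        case 2
        then show ?thesis by (simp add: ent_lift X_def ent_mask)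
      next
        case 3
        then have "ent x i j = 0" using D(1) \<omega>(1) by (intro IncD[OF xS]) auto
        moreover have "ent (lift X) i j = 0" unfolding ent_lift using 3 by presburger
        ultimately show ?thesis by simp
      qed
    qed
    ultimately show "x \<in> lift ` Inc \<rho>'" by blast
  next
    fix x :: "'a fm" assume "x \<in> lift ` Inc \<rho>'"
    then obtain X where X: "X \<in> Inc \<rho>'" "x = lift X" by blast
    have xS: "x \<in> ?S"
    proof (rule IncI)
      fix i j assume ij: "(i, j) \<notin> D \<union> \<omega>"
      have "ent X (\<iota> i) (\<iota> j) = 0" if "i \<in> Z" "j \<in> Z" using IncD[OF X(1)] \<rho>'_D[OF that] ij by blast
      moreover have "ent X i j = 0" using IncD[OF X(1)] \<rho>'_sub ij by blast
      ultimately show "ent x i j = 0" by (simp add: X(2) ent_lift)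
    qed
    have "?B x (munit z w) = 0" if zw: "z \<in> Z" "w \<in> W'" for z w
    proof -
      have w: "w \<in> W" "w \<notin> Z" using zw W' disj by auto
      have zW: "\<iota> z \<in> W" "\<iota> z \<notin> Z" using zw \<iota>(2) W' disj by auto
      have "(\<Sum>y\<in>Z. if w = \<iota> y then ent x y z else 0) = ent X w (\<iota> z)"
      proof (cases "w \<in> \<iota> ` Z")
        case True
        then obtain y where y: "w = \<iota> y" "y \<in> Z" by blast
        have "(\<Sum>t\<in>Z. if w = \<iota> t then ent x t z else 0) = (\<Sum>t\<in>Z. if t = y then ent x y z else 0)"
          using inj_onD[OF \<iota>(1)] y by (intro sum.cong) auto
        then show ?thesis using y zw finite_ZW by (simp add: sum.delta' X(2) ent_lift)
      next
        case False
        have "(w, \<iota> z) \<notin> \<rho>'" using False zw D(1) by (auto simp: \<rho>'_def)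
        then have "ent X w (\<iota> z) = 0" by (rule IncD[OF X(1)])
        moreover have "(\<Sum>y\<in>Z. if w = \<iota> y then ent x y z else 0) = 0"
          using False by (intro sum.neutral) auto
        ultimately show ?thesis by simp
      qed
      moreover have "ent x w (\<iota> z) = ent X w (\<iota> z)" using w zW by (simp add: X(2) ent_lift)
      ultimately show ?thesis using stabilizer[OF \<phi> xS zw] by simp
    qed
    then have "?B x v = 0" if "v \<in> ?V" for v
      by (rule bilin_Inc_0[OF B finite_rels(4) _ that]) auto
    then show "x \<in> ?T" using xS by simp
  qed
  also have "fm.dim (rad (lift ` Inc \<rho>') ?B) = fm.dim (rad (Inc \<rho>') (kform N (\<lambda>A. \<phi> (lift A))))"
  proof (rule rad_image[OF lin_lift subspace_Inc inj_lift, where s = 1])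
    show "bilin (kform N (\<lambda>A. \<phi> (lift A)))" by (rule bilin_kform[OF linf_compose[OF lin_lift \<phi>(1)]])
    show "kform N (\<lambda>A. \<phi> (lift A)) x y = 1 * kform N \<phi> (lift x) (lift y)"
      if "x \<in> Inc \<rho>'" "y \<in> Inc \<rho>'" for x y
      using lift_mm[OF that] lift_mm[OF that(2,1)] by (simp add: kform_def br_def fmp.linear_diff[OF lin_lift])
  qed simp
  finally show ?thesis .
qed

lemma lieind_upper: "lieind N (Inc \<rho> :: 'a::field fm set) \<le> lieind N (Inc \<rho>' :: 'a fm set)"
proof -
  obtain \<psi> where \<psi>: "linf \<psi>" "fm.dim (rad (Inc \<rho>' :: 'a fm set) (kform N \<psi>)) = lieind N (Inc \<rho>' :: 'a fm set)"
    using lieind_attained .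
  \<comment> \<open>\<open>std\<close> reads rows in \<open>Z\<close> and columns in
    \<open>W\<close>, where lifted matrices vanish. Adding it fixes the values on the ideal and
    changes nothing that is seen through \<open>lift\<close>.\<close>
  define \<phi> where "\<phi> A = \<psi> (mask (W \<times> W) A) + std A" for A
  have l: "linf \<phi>" unfolding \<phi>_def by (intro linf_add linf_std linf_compose[OF lin_mask \<psi>(1)])
  have "\<phi> (munit z w) = (if w = \<iota> z then 1 else 0)" if "z \<in> Z" "w \<in> W'" for z w
  proof -
    have "mask (W \<times> W) (munit z w) = (0 :: 'a fm)"
      using that disj by (auto simp: fm_eq_iff ent_mask ent_munit)
    then show ?thesis using that by (simp add: \<phi>_def std_munit fmf.linear_0[OF \<psi>(1)])
  qed
  then have "fm.dim (rad (Inc \<rho>) (kform N \<phi>)) = fm.dim (rad (Inc \<rho>') (kform N (\<lambda>A. \<phi> (lift A))))"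
    by (rule dim_rad_std[OF l])
  also have "rad (Inc \<rho>') (kform N (\<lambda>A. \<phi> (lift A))) = rad (Inc \<rho>') (kform N \<psi>)"
  proof -
    have "\<phi> (lift (br N x y)) = \<psi> (br N x y)" if "x \<in> Inc \<rho>'" "y \<in> Inc \<rho>'" for x y
    proof -
      have "br N x y \<in> Inc (W \<times> W)"
        using that Inc_mono[OF \<rho>'_sub] Inc_mono[OF \<omega>(1)] by (intro br_Inc) (auto simp: trans_def)
      then have "mask (W \<times> W) (lift (br N x y)) = br N x y"
        using disj by (auto simp: fm_eq_iff ent_mask ent_lift Inc_def)
      moreover have "std (lift (br N x y)) = 0"
        using \<iota>(2) W' disj unfolding std_def by (intro sum.neutral) (auto simp: ent_lift)
      ultimately show ?thesis by (simp add: \<phi>_def)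
    qed
    then show ?thesis by (auto simp: rad_def kform_def)
  qed
  finally show ?thesis using \<psi>(2) lieind_le[OF l, of N "Inc \<rho>"] by simp
qed

text \<open>A functional that is generic on the ideal \<open>Inc (Z \<times> W')\<close> is carried to \<open>std\<close> by conjugation with
  an invertible element \<open>1 + u G\<close>, where \<open>G\<close> is supported on the columns \<open>\<iota> ` Z\<close>.\<close>

lemma generic_lower:
  fixes \<phi> :: "'a::field fm \<Rightarrow> 'a"
  assumes \<phi>: "linf \<phi>"
  obtains F where "finite F"
    "\<And>u. u \<notin> F \<Longrightarrow> lieind N (Inc \<rho>' :: 'a fm set) \<le> fm.dim (rad (Inc \<rho>) (kform N (\<lambda>A. std A + u * (\<phi> A - std A))))"
proof -
  \<comment> \<open>The deviation of \<open>\<phi>\<close> from \<open>std\<close> on the ideal.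
    \<open>G\<close> carries it in the matched columns, so that these columns of 1 + u G contain
    exactly the values of \<open>std + u (\<phi> - std)\<close> on the ideal.\<close>
  define c where "c z w = \<phi> (munit z w) - (if w = \<iota> z then 1 else 0)" for z w
  define G :: "'a fm" where
    "G = Fm (\<lambda>w v. if w \<in> W' then \<Sum>z\<in>Z. if v = \<iota> z then c z w else 0 else 0)"
  let ?sq = "{..<N} \<times> {..<N}"
  have GI: "G \<in> Inc \<omega>"
  proof (rule IncI)
    fix w v assume "(w, v) \<notin> \<omega>"
    then have "w \<in> W' \<Longrightarrow> z \<in> Z \<Longrightarrow> v \<noteq> \<iota> z" for z using full by blast
    then show "ent G w v = 0" by (auto simp: G_def intro!: sum.neutral)
  qed
  have Gc: "ent G w (\<iota> z) = c z w" if "z \<in> Z" "w \<in> W'" for z w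
  proof -
    have "(\<Sum>y\<in>Z. if \<iota> z = \<iota> y then c y w else 0) = (\<Sum>y\<in>Z. if y = z then c z w else 0)"
      using inj_onD[OF \<iota>(1)] that by (intro sum.cong) auto
    then show ?thesis using that finite_ZW by (simp add: G_def sum.delta')
  qed
  have Gsq: "G \<in> Inc ?sq"
    using GI Inc_mono[of \<omega> ?sq] \<omega>(1) bound by blast
  have sqcl: "mm N A B \<in> Inc ?sq" if "A \<in> Inc ?sq" "B \<in> Inc ?sq" for A B :: "'a fm"
    using Inc_mm[OF that] Inc_mono[of "?sq O ?sq" ?sq] by blast
  define E where "E = {e. \<exists>x\<in>Inc ?sq. x \<noteq> 0 \<and> mm N G x = mscale e x}"
  have "finite E" unfolding E_def by (rule finite_eigenvalues[OF lin_mm(1) fd_Inc]) simp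
  then have "finite ((\<lambda>e. - (1 / e)) ` E)" by simp
  moreover have "lieind N (Inc \<rho>' :: 'a fm set) \<le> fm.dim (rad (Inc \<rho>) (kform N (\<lambda>A. std A + u * (\<phi> A - std A))))"
    if u: "u \<notin> (\<lambda>e. - (1 / e)) ` E" for u
  proof -
    define \<psi> where "\<psi> A = std A + u * (\<phi> A - std A)" for A
    have l\<psi>: "linf \<psi>" unfolding \<psi>_def by (intro linf_add linf_cmult linf_diff linf_std \<phi>)
    define g where "g = one_fm N + mscale u G"
    have g_mm: "mm N g x = x + mscale u (mm N G x)" if "x \<in> Inc ?sq" for x
      by (simp add: g_def mm_add mm_scale mm_one[OF that])
    have one: "one_fm N \<in> Inc (Id_on {..<N})" "one_fm N \<in> Inc ?sq"
      by (auto simp: Inc_def ent_one_fm)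
    have gsq: "g \<in> Inc ?sq" unfolding g_def
      using one Gsq by (intro fm.subspace_add fm.subspace_scale subspace_Inc)
    have g_inj: "x = 0" if x: "x \<in> Inc ?sq" "mm N g x = 0" for x
    proof (rule ccontr)
      assume "x \<noteq> 0"
      have z: "x + mscale u (mm N G x) = 0" using x g_mm by simp
      then have "u \<noteq> 0" using \<open>x \<noteq> 0\<close> by auto
      have "mm N G x = mscale (- (1 / u)) x"
      proof (rule fm_eqI)
        fix i j
        have "ent x i j + u * ent (mm N G x) i j = 0" using arg_cong[OF z, of "\<lambda>y. ent y i j"] by simp
        then show "ent (mm N G x) i j = ent (mscale (- (1 / u)) x) i j"
          using \<open>u \<noteq> 0\<close> by (simp add: field_simps eq_neg_iff_add_eq_0 add.commute)
      qed
      then have "- (1 / u) \<in> E" using x(1) \<open>x \<noteq> 0\<close> unfolding E_def by blast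
      then have "- (1 / (- (1 / u))) \<in> (\<lambda>e. - (1 / e)) ` E" by (rule imageI)
      then show False using u by simp
    qed
    \<comment> \<open>\<open>\<omega>\<close> need not be reflexive. With the diagonal added it
      gives a finite-dimensional unital algebra containing \<open>g\<close>, where injective
      multiplication is onto; so the inverse \<open>h\<close> has the same shape and conjugation
      preserves \<open>Inc \<rho>\<close>.\<close>
    let ?r1 = "\<omega> \<union> Id_on {..<N}"
    have r1: "?r1 \<subseteq> ?sq" "?r1 O ?r1 \<subseteq> ?r1"
      using \<omega> bound by (auto dest: transD)
    have gK: "g \<in> Inc ?r1" unfolding g_def
      using one(1) GI Inc_mono[of \<omega> ?r1] Inc_mono[of "Id_on {..<N}" ?r1]
      by (intro fm.subspace_add fm.subspace_scale subspace_Inc) auto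
    have Ksq: "Inc ?r1 \<subseteq> Inc ?sq" by (rule Inc_mono[OF r1(1)])
    have fin1: "finite ?r1" by (rule finite_subset[OF r1(1)]) simp
    have "mm N g ` Inc ?r1 = Inc ?r1"
    proof (rule endo_inj_imp_surj[OF lin_mm(1) fd_Inc[OF fin1]])
      show "mm N g ` Inc ?r1 \<subseteq> Inc ?r1" using Inc_mm[OF gK] Inc_mono[OF r1(2)] by blast
      show "inj_on (mm N g) (Inc ?r1)"
        unfolding fmp.linear_inj_on_iff_eq_0[OF lin_mm(1) subspace_Inc] using g_inj Ksq by blast
    qed
    moreover have "one_fm N \<in> Inc ?r1" using one(1) Inc_mono[of "Id_on {..<N}" ?r1] by auto
    ultimately obtain h where h: "h \<in> Inc ?r1" "mm N g h = one_fm N" by (metis imageE)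
    have hsq: "h \<in> Inc ?sq" using h(1) Ksq by blast
    have hg: "mm N h g = one_fm N"
    proof -
      have "mm N g (mm N h g - one_fm N) = 0"
        by (simp add: mm_diff mm_assoc[symmetric] h(2) mm_one[OF gsq])
      moreover have "mm N h g - one_fm N \<in> Inc ?sq"
        using sqcl[OF hsq gsq] one(2) by (intro fm.subspace_diff subspace_Inc)
      ultimately show ?thesis using g_inj[of "mm N h g - one_fm N"] by simp
    qed
    define \<theta> where "\<theta> A = mm N g (mm N A h)" for A
    have lin\<theta>: "lin \<theta>" unfolding \<theta>_def by (rule linI) (simp_all add: mm_add mm_scale)
    have Lsq: "Inc \<rho> \<subseteq> Inc ?sq" by (rule Inc_mono[OF \<rho>_sub])
    have \<theta>L: "\<theta> A \<in> Inc \<rho>" if A: "A \<in> Inc \<rho>" for A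
    proof -
      have "?r1 O (\<rho> O ?r1) \<subseteq> \<rho>"
      proof -
        have "\<omega> \<subseteq> \<rho>" by (auto simp: \<rho>_def)
        then have "\<rho> O ?r1 \<subseteq> \<rho>" "?r1 O \<rho> \<subseteq> \<rho>" using trans_O_subset[OF trans_\<rho>] by blast+
        then show ?thesis by blast
      qed
      then show ?thesis unfolding \<theta>_def
        using Inc_mm[OF gK Inc_mm[OF A h(1)]] Inc_mono[of "?r1 O (\<rho> O ?r1)" \<rho>] by blast
    qed
    have inj\<theta>: "inj_on \<theta> (Inc \<rho>)"
    proof (rule inj_onI)
      fix A B assume AB: "A \<in> Inc \<rho>" "B \<in> Inc \<rho>" "\<theta> A = \<theta> B"
      have inv: "mm N h (mm N (\<theta> X) g) = X" if "X \<in> Inc \<rho>" for X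
      proof -
        have X: "X \<in> Inc ?sq" using that Lsq by blast
        have "mm N h (mm N (\<theta> X) g) = mm N (mm N h g) (mm N X (mm N h g))"
          by (simp add: \<theta>_def mm_assoc)
        then show ?thesis by (simp add: hg mm_one[OF X])
      qed
      have "mm N h (mm N (\<theta> B) g) = A" using inv[OF AB(1)] unfolding AB(3) .
      then show "A = B" unfolding inv[OF AB(2)] ..
    qed
    have img: "\<theta> ` Inc \<rho> = Inc \<rho>"
      by (rule endo_inj_imp_surj[OF lin\<theta> fd_Inc[OF finite_rels(1)] _ inj\<theta>]) (use \<theta>L in blast)
    have \<theta>mm: "\<theta> (mm N A B) = mm N (\<theta> A) (\<theta> B)" if "A \<in> Inc \<rho>" "B \<in> Inc \<rho>" for A B
    proof -
      have "B \<in> Inc ?sq" using that Lsq by blast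
      have "mm N (\<theta> A) (\<theta> B) = mm N g (mm N A (mm N (mm N h g) (mm N B h)))"
        by (simp add: \<theta>_def mm_assoc)
      then show ?thesis using sqcl[OF \<open>B \<in> Inc ?sq\<close> hsq] by (simp add: hg mm_one \<theta>_def mm_assoc)
    qed
    \<comment> \<open>\<open>G\<close> has no column in \<open>Z\<close>, so left multiplication by
      \<open>g\<close> leaves the row \<open>z\<close> alone, while right multiplication by
      \<open>h\<close> puts row \<open>w\<close> of \<open>h\<close> there. Evaluating
      \<open>\<psi>\<close> gives the entry \<open>(w, \<iota> z)\<close> of
      \<open>h g = 1\<close>.\<close>
    have std\<theta>: "\<psi> (\<theta> (munit z w)) = (if w = \<iota> z then 1 else 0)" if zw: "z \<in> Z" "w \<in> W'" for z w
    proof -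
      have zwN: "z < N" "w < N" using zw bound W' by auto
      have hw: "ent h w v = 0" if "v \<notin> W'" for v
        by (rule IncD[OF h(1)]) (use that zw cl in auto)
      have \<theta>m: "\<theta> (munit z w) = (\<Sum>v\<in>W'. mscale (ent h w v) (munit z v))" (is "_ = ?rhs")
      proof (rule fm_eqI)
        fix p q
        have row: "ent (mm N (munit z w) h) p q = (if p = z then ent h w q else 0)" for p q
          using zwN by (simp add: mm_munit)
        have "ent (mm N G (mm N (munit z w) h)) p q = 0"
          unfolding ent_mm[of N G] row
          using IncD[OF GI, of p z] \<omega>(1) disj zw by (intro sum.neutral) auto
        moreover have "mm N (munit z w) h \<in> Inc ?sq"
          using zwN hsq by (intro sqcl) (auto simp: munit_Inc)
        ultimately have 1: "ent (\<theta> (munit z w)) p q = (if p = z then ent h w q else 0)"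
          unfolding \<theta>_def by (simp add: g_mm row)
        have "ent ?rhs p q = (\<Sum>v\<in>W'. if v = q then if p = z then ent h w q else 0 else 0)"
          unfolding ent_sum by (intro sum.cong) (auto simp: ent_munit)
        also have "\<dots> = (if p = z then ent h w q else 0)"
          using hw[of q] finite_ZW(3) by (simp add: sum.delta')
        finally show "ent (\<theta> (munit z w)) p q = ent ?rhs p q" using 1 by simp
      qed
      have \<psi>m: "\<psi> (munit z v) = ent g v (\<iota> z)" if "v \<in> W'" for v
      proof -
        have "v < N" using that W' bound by auto
        then show ?thesis using that zw(1)
          by (simp add: \<psi>_def std_munit g_def ent_one_fm Gc c_def)
      qed
      have "\<psi> (\<theta> (munit z w)) = (\<Sum>v\<in>W'. ent h w v * \<psi> (munit z v))"
        unfolding \<theta>m by (simp add: fmf.linear_sum[OF l\<psi>] fmf.linear_scale[OF l\<psi>])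
      also have "\<dots> = (\<Sum>v\<in>W'. ent h w v * ent g v (\<iota> z))"
        by (intro sum.cong refl) (simp add: \<psi>m)
      also have "\<dots> = (\<Sum>v<N. ent h w v * ent g v (\<iota> z))"
        using hw W' bound by (intro sum_ZW[symmetric]) auto
      also have "\<dots> = ent (one_fm N) w (\<iota> z)" unfolding hg[symmetric] ent_mm ..
      finally show ?thesis using zwN by (simp add: ent_one_fm)
    qed
    have l\<psi>\<theta>: "linf (\<lambda>A. \<psi> (\<theta> A))" by (rule linf_compose[OF lin\<theta> l\<psi>])
    have "fm.dim (rad (\<theta> ` Inc \<rho>) (kform N \<psi>)) = fm.dim (rad (Inc \<rho>) (kform N (\<lambda>A. \<psi> (\<theta> A))))"
    proof (rule rad_image[OF lin\<theta> subspace_Inc inj\<theta> bilin_kform[OF l\<psi>\<theta>], where s = 1])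
      show "kform N (\<lambda>A. \<psi> (\<theta> A)) x y = 1 * kform N \<psi> (\<theta> x) (\<theta> y)"
        if "x \<in> Inc \<rho>" "y \<in> Inc \<rho>" for x y
        using \<theta>mm[OF that] \<theta>mm[OF that(2,1)] by (simp add: kform_def br_def fmp.linear_diff[OF lin\<theta>])
    qed simp
    also have "\<dots> = fm.dim (rad (Inc \<rho>') (kform N (\<lambda>A. \<psi> (\<theta> (lift A)))))"
      by (rule dim_rad_std[OF l\<psi>\<theta> std\<theta>])
    finally have "fm.dim (rad (Inc \<rho>) (kform N \<psi>)) = \<dots>" unfolding img .
    then show ?thesis unfolding \<psi>_def[abs_def, symmetric]
      using lieind_le[OF linf_compose[OF lin_lift l\<psi>\<theta>], of N "Inc \<rho>'"] by simp
  qed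
  ultimately show ?thesis by (rule that)
qed

theorem lieind_reduction: "lieind N (Inc \<rho> :: 'a::field_char_0 fm set) = lieind N (Inc \<rho>' :: 'a fm set)"
proof (rule order_antisym[OF lieind_upper])
  let ?d = "lieind N (Inc \<rho>' :: 'a fm set)"
  obtain \<phi> :: "'a fm \<Rightarrow> 'a" where \<phi>: "linf \<phi>" "fm.dim (rad (Inc \<rho>) (kform N \<phi>)) = lieind N (Inc \<rho> :: 'a fm set)"
    using lieind_attained .
  obtain F where F: "finite F"
    "\<And>u. u \<notin> F \<Longrightarrow> ?d \<le> fm.dim (rad (Inc \<rho>) (kform N (\<lambda>A. std A + u * (\<phi> A - std A))))"
    using generic_lower[OF \<phi>(1)] by blast
  \<comment> \<open>The parameter 1 on the line starting at \<open>std\<close> is the given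
    \<open>\<phi>\<close>.\<close>
  have "?d \<le> fm.dim (rad (Inc \<rho>) (\<lambda>x y. kform N std x y + 1 * kform N (\<lambda>A. \<phi> A - std A) x y))"
  proof (rule rad_semicontinuous[OF fd_Inc[OF finite_rels(1)]])
    show "finite {u. \<not> ?d \<le> fm.dim (rad (Inc \<rho>) (\<lambda>x y. kform N std x y + u * kform N (\<lambda>A. \<phi> A - std A) x y))}"
      using F(2) by (intro finite_subset[OF _ F(1)]) (auto simp: kform_def)
  qed (intro bilin_kform linf_std linf_diff \<phi>(1))+
  then show "?d \<le> lieind N (Inc \<rho> :: 'a fm set)" using \<phi>(2) by (simp add: kform_def)
qed

end

subsection \<open>Block triangular matrices with a diagonal block\<close>

lemma lieind_reduction_eq:
  assumes "reduction N Z W W' D \<omega> \<iota>"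
    and "\<rho> = D \<union> \<omega> \<union> Z \<times> W'"
    and "\<rho>' = {(w, v) \<in> \<omega>. v \<notin> \<iota> ` Z \<or> w \<notin> W'} \<union> (\<lambda>(z, y). (\<iota> z, \<iota> y)) ` D"
  shows "lieind N (Inc \<rho> :: 'a::field_char_0 fm set) = lieind N (Inc \<rho>' :: 'a fm set)"
  using reduction.lieind_reduction[OF assms(1)] assms(2,3)
  unfolding reduction.\<rho>_def[OF assms(1)] reduction.\<rho>'_def[OF assms(1)] by simp

text \<open>Block upper triangular in the order Y, T, C, with a diagonal middle block.\<close>

definition chain :: "nat set \<Rightarrow> nat set \<Rightarrow> nat set \<Rightarrow> (nat \<times> nat) set" where
  "chain Y T C = Y \<times> Y \<union> Id_on T \<union> C \<times> C \<union> Y \<times> T \<union> Y \<times> C \<union> T \<times> C"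

text \<open>Two unrelated blocks, \<open>U\<close> diagonal and \<open>Y\<close> full, both leading
  into \<open>C\<close>: the intermediate shape between chains.\<close>

definition fork :: "nat set \<Rightarrow> nat set \<Rightarrow> nat set \<Rightarrow> (nat \<times> nat) set" where
  "fork U Y C = Id_on U \<union> Y \<times> Y \<union> C \<times> C \<union> U \<times> C \<union> Y \<times> C"

text \<open>Block upper triangular in the order U, Y, P: the shape on the n by n part of the seaweed
  once the block of size r is diagonal. \<open>P\<close>, \<open>Y\<close>, \<open>U\<close> will
  have sizes a, b, r.\<close>

definition flag :: "nat set \<Rightarrow> nat set \<Rightarrow> nat set \<Rightarrow> (nat \<times> nat) set" where
  "flag P Y U = P \<times> P \<union> Y \<times> Y \<union> Id_on U \<union> Y \<times> P \<union> U \<times> P \<union> U \<times> Y"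

definition disjoint3 :: "nat set \<Rightarrow> nat set \<Rightarrow> nat set \<Rightarrow> bool" where
  "disjoint3 A B C \<longleftrightarrow> A \<inter> B = {} \<and> A \<inter> C = {} \<and> B \<inter> C = {}"

text \<open>The ideal is \<open>Inc (U \<times> C)\<close>. Its matched copy of \<open>U\<close>
  becomes the diagonal middle block; the rows of \<open>Y\<close> lie outside \<open>W'\<close> and
  keep their entries there. The lemma is used in both directions.\<close>

lemma fork_to_chain:
  assumes "disjoint3 U Y C" "U \<union> Y \<union> C \<subseteq> {..<N}" "inj_on \<iota> U" "\<iota> ` U \<subseteq> C"
  shows "lieind N (Inc (fork U Y C) :: 'a::field_char_0 fm set)
    = lieind N (Inc (chain Y (\<iota> ` U) (C - \<iota> ` U)) :: 'a fm set)"
proof (rule lieind_reduction_eq)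
  show "reduction N U (Y \<union> C) C (Id_on U) (Y \<times> Y \<union> C \<times> C \<union> Y \<times> C) \<iota>"
    using assms unfolding disjoint3_def by unfold_locales (auto simp: trans_def)
  show "fork U Y C = Id_on U \<union> (Y \<times> Y \<union> C \<times> C \<union> Y \<times> C) \<union> U \<times> C"
    by (auto simp: fork_def)
  show "chain Y (\<iota> ` U) (C - \<iota> ` U) =
      {(w, v) \<in> Y \<times> Y \<union> C \<times> C \<union> Y \<times> C. v \<notin> \<iota> ` U \<or> w \<notin> C} \<union> (\<lambda>(z, y). (\<iota> z, \<iota> y)) ` Id_on U"
    (is "?l = ?r")
  proof -
    have "(\<lambda>(z, y). (\<iota> z, \<iota> y)) ` Id_on U = Id_on (\<iota> ` U)" by (auto simp: image_iff Id_on_iff)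
    moreover have "Y \<inter> C = {}" using assms by (auto simp: disjoint3_def)
    ultimately show ?thesis using assms(4) unfolding chain_def by auto
  qed
qed

text \<open>Here \<open>U\<close> and \<open>Y\<close> are matched into \<open>C\<close> together,
  and \<open>C\<close> is all of \<open>W\<close>.\<close>

lemma fork_to_fork:
  assumes "disjoint3 U Y C" "U \<union> Y \<union> C \<subseteq> {..<N}" "inj_on \<iota> (U \<union> Y)" "\<iota> ` (U \<union> Y) \<subseteq> C"
  shows "lieind N (Inc (fork U Y C) :: 'a::field_char_0 fm set)
    = lieind N (Inc (fork (\<iota> ` U) (\<iota> ` Y) (C - \<iota> ` (U \<union> Y))) :: 'a fm set)"
proof (rule lieind_reduction_eq)
  show "reduction N (U \<union> Y) C C (Id_on U \<union> Y \<times> Y) (C \<times> C) \<iota>"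
    using assms unfolding disjoint3_def by unfold_locales (auto simp: trans_def)
  show "fork U Y C = (Id_on U \<union> Y \<times> Y) \<union> C \<times> C \<union> (U \<union> Y) \<times> C"
    by (auto simp: fork_def)
  have "(\<lambda>(z, y). (\<iota> z, \<iota> y)) ` (Id_on U \<union> Y \<times> Y) = Id_on (\<iota> ` U) \<union> \<iota> ` Y \<times> \<iota> ` Y"
    by (auto simp: image_iff Id_on_iff)
  then show "fork (\<iota> ` U) (\<iota> ` Y) (C - \<iota> ` (U \<union> Y)) =
      {(w, v) \<in> C \<times> C. v \<notin> \<iota> ` (U \<union> Y) \<or> w \<notin> C} \<union> (\<lambda>(z, y). (\<iota> z, \<iota> y)) ` (Id_on U \<union> Y \<times> Y)"
    using assms(4) unfolding fork_def by auto
qed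

text \<open>The subtraction step of the Euclidean algorithm: \<open>C\<close> loses |Y| + |T|
  positions, while the other two blocks are only moved.\<close>

lemma chain_to_chain:
  assumes "disjoint3 Y T C" "Y \<union> T \<union> C \<subseteq> {..<N}" "inj_on \<iota> (Y \<union> T)" "\<iota> ` (Y \<union> T) \<subseteq> C"
  shows "lieind N (Inc (chain Y T C) :: 'a::field_char_0 fm set)
    = lieind N (Inc (chain (\<iota> ` Y) (\<iota> ` T) (C - \<iota> ` (Y \<union> T))) :: 'a fm set)"
proof (rule lieind_reduction_eq)
  show "reduction N (Y \<union> T) C C (Y \<times> Y \<union> Id_on T \<union> Y \<times> T) (C \<times> C) \<iota>"
    using assms unfolding disjoint3_def by unfold_locales (auto simp: trans_def)
  show "chain Y T C = (Y \<times> Y \<union> Id_on T \<union> Y \<times> T) \<union> C \<times> C \<union> (Y \<union> T) \<times> C"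
    by (auto simp: chain_def)
  have "(\<lambda>(z, y). (\<iota> z, \<iota> y)) ` (Y \<times> Y \<union> Id_on T \<union> Y \<times> T) = \<iota> ` Y \<times> \<iota> ` Y \<union> Id_on (\<iota> ` T) \<union> \<iota> ` Y \<times> \<iota> ` T"
    by (auto simp: image_iff Id_on_iff)
  then show "chain (\<iota> ` Y) (\<iota> ` T) (C - \<iota> ` (Y \<union> T)) =
      {(w, v) \<in> C \<times> C. v \<notin> \<iota> ` (Y \<union> T) \<or> w \<notin> C} \<union> (\<lambda>(z, y). (\<iota> z, \<iota> y)) ` (Y \<times> Y \<union> Id_on T \<union> Y \<times> T)"
    using assms(4) unfolding chain_def by auto
qed

lemma chain_converse:
  assumes "disjoint3 Y T C"
  shows "lieind N (Inc (chain Y T C) :: 'a::field fm set) = lieind N (Inc (chain C T Y) :: 'a fm set)"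
proof -
  have "chain C T Y = (chain Y T C)\<inverse>" by (auto simp: chain_def)
  moreover have "trans (chain Y T C)" using assms by (auto simp: chain_def trans_def disjoint3_def)
  ultimately show ?thesis using lieind_converse by metis
qed

text \<open>A single position \<open>c\<close> cannot take in a larger diagonal block, so one
  element \<open>u\<close> is matched with it; the diagonal entry at \<open>c\<close> survives as
  the copy of the one at \<open>u\<close>.\<close>

lemma fork_drop:
  assumes "disjoint3 (insert u U) Y {c}" "insert u U \<union> Y \<union> {c} \<subseteq> {..<N}" "u \<notin> U"
  shows "lieind N (Inc (fork (insert u U) Y {c}) :: 'a::field_char_0 fm set)
    = lieind N (Inc (fork U Y {c}) :: 'a fm set)"
proof (rule lieind_reduction_eq)
  show "reduction N {u} (U \<union> Y \<union> {c}) {c} {(u, u)} (Id_on U \<union> Y \<times> Y \<union> {(c, c)} \<union> U \<times> {c} \<union> Y \<times> {c}) (\<lambda>_. c)"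
    using assms unfolding disjoint3_def by unfold_locales (auto simp: trans_def)
  show "fork (insert u U) Y {c} = {(u, u)} \<union> (Id_on U \<union> Y \<times> Y \<union> {(c, c)} \<union> U \<times> {c} \<union> Y \<times> {c}) \<union> {u} \<times> {c}"
    by (auto simp: fork_def)
  show "fork U Y {c} = {(w, v) \<in> Id_on U \<union> Y \<times> Y \<union> {(c, c)} \<union> U \<times> {c} \<union> Y \<times> {c}.
      v \<notin> (\<lambda>_. c) ` {u} \<or> w \<notin> {c}} \<union> (\<lambda>(z, y). (c, c)) ` {(u, u)}"
    using assms by (auto simp: fork_def disjoint3_def)
qed

text \<open>The ideal consists of all entries from \<open>U\<close> to \<open>P\<close> and
  \<open>Y\<close>. Matching \<open>U\<close> inside \<open>P\<close> clears the matched columns in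
  the rows of \<open>P\<close> and \<open>Y\<close> except for the diagonal, so that the copy of
  \<open>U\<close> becomes unrelated to \<open>Y\<close>.\<close>

lemma flag_to_fork:
  assumes "disjoint3 P Y U" "P \<union> Y \<union> U \<subseteq> {..<N}" "inj_on \<iota> U" "\<iota> ` U \<subseteq> P"
  shows "lieind N (Inc (flag P Y U) :: 'a::field_char_0 fm set)
    = lieind N (Inc (fork (\<iota> ` U) Y (P - \<iota> ` U)) :: 'a fm set)"
proof (rule lieind_reduction_eq)
  show "reduction N U (P \<union> Y) (P \<union> Y) (Id_on U) (P \<times> P \<union> Y \<times> Y \<union> Y \<times> P) \<iota>"
    using assms unfolding disjoint3_def by unfold_locales (auto simp: trans_def)
  show "flag P Y U = Id_on U \<union> (P \<times> P \<union> Y \<times> Y \<union> Y \<times> P) \<union> U \<times> (P \<union> Y)"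
    by (auto simp: flag_def)
  have "(\<lambda>(z, y). (\<iota> z, \<iota> y)) ` Id_on U = Id_on (\<iota> ` U)" by (auto simp: image_iff Id_on_iff)
  moreover have "Y \<inter> P = {}" using assms by (auto simp: disjoint3_def)
  ultimately show "fork (\<iota> ` U) Y (P - \<iota> ` U) =
      {(w, v) \<in> P \<times> P \<union> Y \<times> Y \<union> Y \<times> P. v \<notin> \<iota> ` U \<or> w \<notin> P \<union> Y} \<union> (\<lambda>(z, y). (\<iota> z, \<iota> y)) ` Id_on U"
    using assms(4) unfolding fork_def by auto
qed

text \<open>Two elements do not fit into the single position \<open>p\<close>, so only
  \<open>v\<close> is matched. The relation that remains points the other way, hence the
  converse.\<close>

lemma flag_drop:
  assumes "disjoint3 {p} Y {u, v}" "{p} \<union> Y \<union> {u, v} \<subseteq> {..<N}" "u \<noteq> v"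
  shows "lieind N (Inc (flag {p} Y {u, v}) :: 'a::field_char_0 fm set)
    = lieind N (Inc (fork {p} Y {u}) :: 'a fm set)"
proof -
  let ?\<omega> = "{(u, u), (u, p), (p, p)} \<union> {u} \<times> Y \<union> Y \<times> Y \<union> Y \<times> {p}"
  have "lieind N (Inc (flag {p} Y {u, v}) :: 'a fm set) = lieind N (Inc ((fork {p} Y {u})\<inverse>) :: 'a fm set)"
  proof (rule lieind_reduction_eq)
    show "reduction N {v} ({u, p} \<union> Y) ({p} \<union> Y) {(v, v)} ?\<omega> (\<lambda>_. p)"
      using assms unfolding disjoint3_def by unfold_locales (auto simp: trans_def)
    show "flag {p} Y {u, v} = {(v, v)} \<union> ?\<omega> \<union> {v} \<times> ({p} \<union> Y)"
      by (auto simp: flag_def)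
    show "(fork {p} Y {u})\<inverse> = {(w, x) \<in> ?\<omega>. x \<notin> (\<lambda>_. p) ` {v} \<or> w \<notin> {p} \<union> Y} \<union> (\<lambda>(z, y). (p, p)) ` {(v, v)}"
      using assms by (auto simp: fork_def disjoint3_def)
  qed
  also have "\<dots> = lieind N (Inc (fork {p} Y {u}) :: 'a fm set)"
    using assms by (intro lieind_converse) (auto simp: trans_def fork_def disjoint3_def)
  finally show ?thesis .
qed

section \<open>Index of a full block beside a diagonal block\<close>

lemma finite_Id_on: "finite A \<Longrightarrow> finite (Id_on A)"
  by (rule finite_subset[of _ "A \<times> A"]) auto

lemma card_Id_on: "card (Id_on A) = card A"
proof -
  have "Id_on A = (\<lambda>x. (x, x)) ` A" by (auto simp: Id_on_def)
  then show ?thesis by (simp add: card_image inj_on_def)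
qed

text \<open>The determinant of the matrix \<open>q\<close> is a polynomial with value 1 at 0, so it
  has finitely many roots. The columns will be Krylov vectors, the powers of a matrix applied to one
  vector.\<close>

lemma krylov_generic:
  fixes p :: "nat \<Rightarrow> nat \<Rightarrow> 'a::field poly" and q :: "nat \<Rightarrow> nat \<Rightarrow> 'a poly"
  assumes "\<And>i k. i < b \<Longrightarrow> k < b \<Longrightarrow> poly (q k i) 0 = (if i = k then 1 else 0)"
  shows "finite {u. \<exists>c. (\<forall>i<b. (\<Sum>k<b. poly (q k i) u * c k) = 0) \<and> (\<exists>k<b. c k \<noteq> 0)}"
proof -
  define K where "K = mat b b (\<lambda>(i, k). q k i)"
  have ev: "poly (det K) u = det (mat b b (\<lambda>(i, k). poly (q k i) u))" for u
  proof -
    interpret ph: comm_ring_hom "\<lambda>p. poly p u" by unfold_locales auto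
    have "map_mat (\<lambda>p. poly p u) K = mat b b (\<lambda>(i, k). poly (q k i) u)"
      by (rule eq_matI) (auto simp: K_def)
    then show ?thesis using ph.hom_det[of K] by simp
  qed
  have "mat b b (\<lambda>(i, k). poly (q k i) 0) = 1\<^sub>m b"
    by (rule eq_matI) (auto simp: assms)
  then have "poly (det K) 0 = 1" using ev[of 0] by simp
  then have "det K \<noteq> 0" by auto
  then have "finite {u. poly (det K) u = 0}" by (rule poly_roots_finite)
  moreover have "poly (det K) u = 0"
    if c: "\<And>i. i < b \<Longrightarrow> (\<Sum>k<b. poly (q k i) u * c k) = 0" "k < b" "c k \<noteq> 0" for u c k
  proof -
    let ?A = "mat b b (\<lambda>(i, k). poly (q k i) u)"
    have "vec b c \<in> carrier_vec b" by simp
    moreover have "vec b c \<noteq> 0\<^sub>v b"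
    proof
      assume "vec b c = 0\<^sub>v b"
      then have "vec b c $ k = 0\<^sub>v b $ k" by simp
      then show False using c by simp
    qed
    moreover have "?A *\<^sub>v vec b c = 0\<^sub>v b"
      using c(1) by (intro eq_vecI) (auto simp: scalar_prod_def lessThan_atLeast0)
    moreover have "?A \<in> carrier_mat b b" by simp
    ultimately have "det ?A = 0" using det_0_iff_vec_prod_zero[of ?A b] by blast
    then show ?thesis using ev by simp
  qed
  ultimately show ?thesis
    by (rule_tac finite_subset[of _ "{u. poly (det K) u = 0}"]) blast+
qed

text \<open>The powers start from the unit of the block \<open>Y\<close> rather than the ambient
  unit, so that all of them lie in \<open>Inc (Y \<times> Y)\<close>.\<close>

primrec fpow :: "nat \<Rightarrow> nat set \<Rightarrow> 'a::field fm \<Rightarrow> nat \<Rightarrow> 'a fm" where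
  "fpow N Y F 0 = mask (Y \<times> Y) (one_fm N)"
| "fpow N Y F (Suc k) = mm N F (fpow N Y F k)"

lemma mm_Inc_square:
  "A \<in> Inc (Y \<times> Y) \<Longrightarrow> B \<in> Inc (Y \<times> Y) \<Longrightarrow> mm N A B \<in> Inc (Y \<times> Y)"
  using Inc_mm[of A "Y \<times> Y" B "Y \<times> Y" N] Inc_mono[of "(Y \<times> Y) O (Y \<times> Y)" "Y \<times> Y"] by blast

lemma fpow_Inc: "F \<in> Inc (Y \<times> Y) \<Longrightarrow> fpow N Y F k \<in> Inc (Y \<times> Y)"
  by (induction k) (auto intro: mm_Inc_square mask_Inc)

lemma mm_mask_one:
  assumes "F \<in> Inc (Y \<times> Y)" "Y \<subseteq> {..<N}"
  shows "mm N F (mask (Y \<times> Y) (one_fm N)) = F" "mm N (mask (Y \<times> Y) (one_fm N)) F = F"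
proof -
  have z: "ent F i j = 0" if "i \<notin> Y \<or> j \<notin> Y" for i j using IncD[OF assms(1), of i j] that by auto
  have 1: "ent (mm N F (mask (Y \<times> Y) (one_fm N))) i j = (\<Sum>k<N. if k = j then ent F i j else 0)" for i j
    unfolding ent_mm using z[of i j] by (intro sum.cong) (auto simp: ent_mask ent_one_fm)
  have 2: "ent (mm N (mask (Y \<times> Y) (one_fm N)) F) i j = (\<Sum>k<N. if k = i then ent F i j else 0)" for i j
    unfolding ent_mm using z[of i j] by (intro sum.cong) (auto simp: ent_mask ent_one_fm)
  have "ent F i j = 0" if "\<not> i < N \<or> \<not> j < N" for i j using z[of i j] that assms(2) by blast
  then show "mm N F (mask (Y \<times> Y) (one_fm N)) = F" "mm N (mask (Y \<times> Y) (one_fm N)) F = F"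
    by (auto simp: fm_eq_iff 1 2 sum.delta')
qed

lemma fpow_commute:
  assumes "F \<in> Inc (Y \<times> Y)" "Y \<subseteq> {..<N}"
  shows "mm N (fpow N Y F k) F = mm N F (fpow N Y F k)"
  by (induction k) (simp_all add: mm_mask_one[OF assms] mm_assoc)

lemma mm_sum_right: "mm N A (sum f S) = (\<Sum>s\<in>S. mm N A (f s))"
  by (induction S rule: infinite_finite_induct) (auto simp: mm_0 mm_add)

lemma mm_sum_left: "mm N (sum f S) A = (\<Sum>s\<in>S. mm N (f s) A)"
  by (induction S rule: infinite_finite_induct) (auto simp: mm_0 mm_add)

text \<open>\<open>F\<close> represents \<open>\<phi>\<close> through the trace form, so its centralizer consists of elements of the
  radical.\<close>

lemma commute_rad:
  fixes \<phi> :: "'a::field fm \<Rightarrow> 'a"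
  assumes \<phi>: "linf \<phi>" and UY: "U \<inter> Y = {}" "U \<union> Y \<subseteq> {..<N}"
    and F: "F \<in> Inc (Y \<times> Y)" "\<And>i j. i \<in> Y \<Longrightarrow> j \<in> Y \<Longrightarrow> ent F i j = \<phi> (munit j i)"
    and x: "x \<in> Inc (Id_on U)" and y: "y \<in> Inc (Y \<times> Y)" "mm N y F = mm N F y"
  shows "x + y \<in> rad (Inc (Id_on U \<union> Y \<times> Y)) (kform N \<phi>)"
proof -
  let ?L = "Id_on U \<union> Y \<times> Y"
  have fin: "finite U" "finite Y" using UY(2) finite_subset[of _ "{..<N}"] by auto
  then have finL: "finite ?L" by (simp add: finite_Id_on)
  have B: "bilin (kform N \<phi>)" by (rule bilin_kform[OF \<phi>])
  have "kform N \<phi> (x + y) v = 0" if v: "v \<in> Inc ?L" for v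
  proof (rule bilin_Inc_0[OF B finL _ v])
    fix i j assume ij: "(i, j) \<in> ?L"
    have ijN: "i < N" "j < N" using ij UY(2) by auto
    have x0: "br N x (munit i j) = 0"
    proof (rule fm_eqI)
      fix p q
      have "ent x p i = 0" if "p \<noteq> i" for p using IncD[OF x, of p i] that by auto
      moreover have "ent x j q = 0" if "j \<noteq> q" using IncD[OF x, of j q] that by auto
      moreover have "ent x i i = ent x j j"
      proof (cases "i \<in> U")
        case True
        then have "i = j" using ij UY(1) by auto
        then show ?thesis by simp
      next
        case False
        then have "i \<in> Y" "j \<in> Y" using ij by auto
        then have "j \<notin> U" using UY(1) by auto
        then show ?thesis using False IncD[OF x, of i i] IncD[OF x, of j j] by (simp add: Id_on_iff)
      qed
      ultimately show "ent (br N x (munit i j)) p q = ent 0 p q"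
        using ijN by (simp add: br_def mm_munit)
    qed
    have "\<phi> (br N y (munit i j)) = 0"
    proof (cases "i \<in> Y \<and> j \<in> Y")
      case True
      have yz: "ent y p q = 0" if "p \<notin> Y \<or> q \<notin> Y" for p q using IncD[OF y(1), of p q] that by auto
      have 1: "mm N y (munit i j) = (\<Sum>p\<in>Y. mscale (ent y p i) (munit p j))"
      proof (rule fm_eqI)
        fix p q
        have "(\<Sum>s\<in>Y. ent (mscale (ent y s i) (munit s j)) p q) = (\<Sum>s\<in>Y. if s = p then if q = j then ent y p i else 0 else 0)"
          by (intro sum.cong) (auto simp: ent_munit)
        then show "ent (mm N y (munit i j)) p q = ent (\<Sum>p\<in>Y. mscale (ent y p i) (munit p j)) p q"
          using fin yz[of p i] ijN by (simp add: mm_munit sum.delta' ent_sum)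
      qed
      have 2: "mm N (munit i j) y = (\<Sum>q\<in>Y. mscale (ent y j q) (munit i q))"
      proof (rule fm_eqI)
        fix p q
        have "(\<Sum>s\<in>Y. ent (mscale (ent y j s) (munit i s)) p q) = (\<Sum>s\<in>Y. if s = q then if p = i then ent y j q else 0 else 0)"
          by (intro sum.cong) (auto simp: ent_munit)
        then show "ent (mm N (munit i j) y) p q = ent (\<Sum>q\<in>Y. mscale (ent y j q) (munit i q)) p q"
          using fin yz[of j q] ijN by (simp add: mm_munit sum.delta' ent_sum)
      qed
      have sub: "(\<Sum>p\<in>Y. f p) = (\<Sum>p<N. f p)" if "\<And>p. p \<notin> Y \<Longrightarrow> f p = 0" for f :: "nat \<Rightarrow> 'a"
        using UY(2) that by (intro sum.mono_neutral_left) auto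
      have "\<phi> (mm N y (munit i j)) = (\<Sum>p\<in>Y. ent F j p * ent y p i)"
        unfolding 1 using True by (simp add: fmf.linear_sum[OF \<phi>] fmf.linear_scale[OF \<phi>] F(2) mult.commute)
      also have "\<dots> = ent (mm N F y) j i" unfolding ent_mm using yz by (intro sub) auto
      also have "\<dots> = ent (mm N y F) j i" using y(2) by simp
      also have "\<dots> = (\<Sum>q\<in>Y. ent y j q * ent F q i)"
        unfolding ent_mm using yz by (intro sub[symmetric]) auto
      also have "\<dots> = \<phi> (mm N (munit i j) y)"
        unfolding 2 using True by (simp add: fmf.linear_sum[OF \<phi>] fmf.linear_scale[OF \<phi>] F(2))
      finally show ?thesis by (simp add: br_def fmf.linear_diff[OF \<phi>])
    next
      case False
      then have "i \<notin> Y" "j \<notin> Y" using ij UY(1) by auto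
      then have "ent y p i = 0" "ent y j p = 0" for p using IncD[OF y(1), of p i] IncD[OF y(1), of j p] by auto
      then have "br N y (munit i j) = 0" by (simp add: fm_eq_iff br_def mm_munit)
      then show ?thesis using fmf.linear_0[OF \<phi>] by simp
    qed
    then show "kform N \<phi> (x + y) (munit i j) = 0"
      using x0 fmf.linear_0[OF \<phi>] by (simp add: bilin_simps[OF B]) (simp add: kform_def)
  qed
  moreover have "x + y \<in> Inc ?L"
    using x y Inc_mono[of "Id_on U" ?L] Inc_mono[of "Y \<times> Y" ?L]
    by (intro fm.subspace_add subspace_Inc) auto
  ultimately show ?thesis by (simp add: rad_def)
qed

text \<open>If the matrix \<open>F\<close> of the functional has a cyclic vector, its powers below
  |Y| are independent elements of the centralizer, and the diagonal part on \<open>U\<close> is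
  central; this gives |U| + |Y| dimensions in the radical. All but finitely many points of a line
  through one cyclic matrix are cyclic, and semicontinuity covers the others.\<close>

lemma lieind_diag_full_lower:
  fixes \<phi> :: "'a::field_char_0 fm \<Rightarrow> 'a"
  assumes \<phi>: "linf \<phi>" and UY: "U \<inter> Y = {}" "U \<union> Y \<subseteq> {..<N}"
  shows "card U + card Y \<le> fm.dim (rad (Inc (Id_on U \<union> Y \<times> Y)) (kform N \<phi>))"
proof -
  let ?L = "Id_on U \<union> Y \<times> Y" and ?b = "card Y"
  have fin: "finite U" "finite Y" using UY(2) finite_subset[of _ "{..<N}"] by auto
  then have finL: "finite ?L" by (simp add: finite_Id_on)
  obtain e where e: "bij_betw e {0..<?b} Y" using ex_bij_betw_nat_finite[OF fin(2)] by blast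
  have eY: "e k \<in> Y" if "k < ?b" for k using bij_betwE[OF e] that by auto
  have einj: "e k = e l \<longleftrightarrow> k = l" if "k < ?b" "l < ?b" for k l
    using bij_betw_imp_inj_on[OF e] that by (auto simp: inj_on_eq_iff)
  have Ye: "Y = e ` {..<?b}" using bij_betw_imp_surj_on[OF e] by (simp add: lessThan_atLeast0)
  \<comment> \<open>The shift from \<open>e l\<close> to \<open>e (Suc l)\<close>: at u = 0 the
    Krylov matrix of the vector \<open>e 0\<close> is the identity.\<close>
  define F0 :: "'a fm" where
    "F0 = Fm (\<lambda>p q. if \<exists>l. Suc l < ?b \<and> p = e (Suc l) \<and> q = e l then 1 else 0)"
  have F0I: "F0 \<in> Inc (Y \<times> Y)" using eY by (auto simp: Inc_def F0_def)
  have F0e: "ent F0 (e i) (e l) = (if i = Suc l then 1 else 0)" if "i < ?b" "l < ?b" for i l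
  proof -
    have "(\<exists>m. Suc m < ?b \<and> e i = e (Suc m) \<and> e l = e m) \<longleftrightarrow> i = Suc l"
      using that einj by (metis Suc_lessD)
    then show ?thesis by (simp add: F0_def)
  qed
  define F1 :: "'a fm" where
    "F1 = Fm (\<lambda>i j. if i \<in> Y \<and> j \<in> Y then \<phi> (munit j i) - ent F0 i j else 0)"
  have F1I: "F1 \<in> Inc (Y \<times> Y)" by (auto simp: Inc_def F1_def)
  \<comment> \<open>The functional represented by \<open>F0\<close> through the trace form. Thus
    \<open>F u\<close> represents \<open>\<phi>u u\<close>, the point with parameter
    \<open>u\<close> on the line from \<open>\<phi>0\<close> to \<open>\<phi>\<close>.\<close>
  define \<phi>0 where "\<phi>0 A = (\<Sum>t\<in>Y \<times> Y. ent F0 (snd t) (fst t) * ent A (fst t) (snd t))" for A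
  have l0: "linf \<phi>0" unfolding \<phi>0_def by (rule linfI) (auto simp: algebra_simps sum.distrib sum_distrib_left)
  have \<phi>0m: "\<phi>0 (munit j i) = ent F0 i j" if "i \<in> Y" "j \<in> Y" for i j
  proof -
    have "\<phi>0 (munit j i) = (\<Sum>t\<in>Y \<times> Y. if t = (j, i) then ent F0 i j else 0)"
      unfolding \<phi>0_def by (intro sum.cong) (auto simp: ent_munit)
    then show ?thesis using that fin by (simp add: sum.delta')
  qed
  define F where "F u = F0 + mscale u F1" for u
  have FI: "F u \<in> Inc (Y \<times> Y)" for u
    unfolding F_def using F0I F1I by (intro fm.subspace_add fm.subspace_scale subspace_Inc)
  define \<phi>u where "\<phi>u u A = \<phi>0 A + u * (\<phi> A - \<phi>0 A)" for u A
  have lu: "linf (\<phi>u u)" for u unfolding \<phi>u_def by (intro linf_add linf_cmult linf_diff l0 \<phi>)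
  have Fm: "ent (F u) i j = \<phi>u u (munit j i)" if "i \<in> Y" "j \<in> Y" for i j u
    using that by (simp add: F_def F1_def \<phi>u_def \<phi>0m)
  \<comment> \<open>Coordinates of the k-th power of \<open>F u\<close> applied to
    \<open>e 0\<close>, as polynomials in \<open>u\<close>; the linear factors are the entries of F0
    + u F1.\<close>
  define q where "q = rec_nat (\<lambda>i. if i = 0 then 1 else 0)
    (\<lambda>k r i. \<Sum>l<?b. [:ent F0 (e i) (e l), ent F1 (e i) (e l):] * r l)"
  have q0: "q 0 i = (if i = 0 then 1 else 0)" for i by (simp add: q_def)
  have qS: "q (Suc k) i = (\<Sum>l<?b. [:ent F0 (e i) (e l), ent F1 (e i) (e l):] * q k l)" for k i
    by (simp add: q_def)
  have qpow: "poly (q k i) u = ent (fpow N Y (F u) k) (e i) (e 0)" if "i < ?b" for k i u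
    using that
  proof (induction k arbitrary: i)
    case 0
    then have "0 < ?b" by simp
    then show ?case using eY[OF 0] eY[of 0] einj[OF 0, of 0] UY(2)
      by (auto simp: q0 ent_mask ent_one_fm)
  next
    case (Suc k)
    have "poly (q (Suc k) i) u = (\<Sum>l<?b. ent (F u) (e i) (e l) * ent (fpow N Y (F u) k) (e l) (e 0))"
      unfolding qS poly_sum using Suc.IH by (intro sum.cong) (auto simp: F_def algebra_simps)
    also have "\<dots> = (\<Sum>m\<in>e ` {..<?b}. ent (F u) (e i) m * ent (fpow N Y (F u) k) m (e 0))"
      using bij_betw_imp_inj_on[OF e] by (simp add: sum.reindex lessThan_atLeast0)
    also have "\<dots> = (\<Sum>m<N. ent (F u) (e i) m * ent (fpow N Y (F u) k) m (e 0))"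
      using UY(2) IncD[OF FI] unfolding Ye[symmetric] by (intro sum.mono_neutral_left) auto
    finally show ?case by (simp add: ent_mm)
  qed
  have "poly (q k i) 0 = (if i = k then 1 else 0)" if "i < ?b" "k < ?b" for i k
    using that
  proof (induction k arbitrary: i)
    case (Suc k)
    have "poly (q (Suc k) i) 0 = (\<Sum>l<?b. if l = k then if i = Suc k then 1 else 0 else 0)"
      unfolding qS poly_sum using Suc by (intro sum.cong) (auto simp: F0e)
    then show ?case using Suc.prems by (simp add: sum.delta')
  qed (simp add: q0)
  then have bad: "finite {u. \<exists>c. (\<forall>i<?b. (\<Sum>k<?b. poly (q k i) u * c k) = 0) \<and> (\<exists>k<?b. c k \<noteq> 0)}" (is "finite ?bad")
    by (rule krylov_generic)
  have main: "card U + card Y \<le> fm.dim (rad (Inc ?L) (kform N (\<phi>u u)))" if u: "u \<notin> ?bad" for u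
  proof -
    \<comment> \<open>Diagonal matrices on \<open>U \<union> Y\<close> serve as coordinates: the
      entry at \<open>e k\<close> is the coefficient of the k-th power. The dimension of the domain
      is known from \<open>dim_Inc\<close>.\<close>
    define \<Theta> where "\<Theta> c = mask (Id_on U) c + (\<Sum>k<?b. mscale (ent c (e k) (e k)) (fpow N Y (F u) k))" for c
    have lin\<Theta>: "lin \<Theta>"
      unfolding \<Theta>_def
      by (rule linI) (simp_all add: fm_eq_iff ent_mask algebra_simps sum.distrib sum_distrib_left)
    let ?D = "Inc (Id_on (U \<union> Y)) :: 'a fm set"
    have "inj_on \<Theta> ?D"
      unfolding fmp.linear_inj_on_iff_eq_0[OF lin\<Theta> subspace_Inc]
    proof (intro ballI impI fm_eqI)
      fix c i j assume c: "c \<in> ?D" "\<Theta> c = 0"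
      have pz: "ent (fpow N Y (F u) k) p r = 0" if "p \<notin> Y" for k p r
        using IncD[OF fpow_Inc[OF FI], of p r] that by auto
      have cU: "ent c p p = 0" if "p \<in> U" for p
      proof -
        have "p \<notin> Y" using UY(1) that by auto
        have "ent (\<Theta> c) p p = 0" using c by simp
        then show ?thesis using pz[OF \<open>p \<notin> Y\<close>] that by (simp add: \<Theta>_def ent_mask Id_on_iff)
      qed
      have "(\<Sum>k<?b. poly (q k i) u * ent c (e k) (e k)) = 0" if "i < ?b" for i
      proof -
        have "e i \<notin> U" using eY[OF that] UY(1) by auto
        then have "ent (\<Theta> c) (e i) (e 0) = (\<Sum>k<?b. ent c (e k) (e k) * ent (fpow N Y (F u) k) (e i) (e 0))"
          by (simp add: \<Theta>_def ent_mask Id_on_iff)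
        then show ?thesis using c(2) qpow[OF that] by (simp add: mult.commute)
      qed
      moreover have "\<not> ((\<forall>i<?b. (\<Sum>k<?b. poly (q k i) u * ent c (e k) (e k)) = 0) \<and> (\<exists>k<?b. ent c (e k) (e k) \<noteq> 0))"
        using u unfolding mem_Collect_eq not_ex by (rule spec)
      ultimately have "\<forall>k<?b. ent c (e k) (e k) = 0" by blast
      then have "ent c p p = 0" if "p \<in> Y" for p
      proof -
        obtain l where "l < ?b" "p = e l" using \<open>p \<in> Y\<close> Ye by blast
        then show ?thesis using \<open>\<forall>k<?b. ent c (e k) (e k) = 0\<close> by simp
      qed
      then show "ent c i j = ent 0 i j" using cU IncD[OF c(1), of i j] by (auto simp: Id_on_iff)
    qed
    then have "fm.dim (\<Theta> ` ?D) = fm.dim ?D" by (rule dim_image_inj[OF lin\<Theta> subspace_Inc])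
    moreover have "card (Id_on (U \<union> Y)) = card U + card Y"
      using fin UY(1) by (simp add: card_Id_on card_Un_disjoint)
    moreover have "\<Theta> ` ?D \<subseteq> rad (Inc ?L) (kform N (\<phi>u u))"
    proof
      fix x assume "x \<in> \<Theta> ` ?D"
      then obtain c where c: "x = \<Theta> c" by blast
      show "x \<in> rad (Inc ?L) (kform N (\<phi>u u))"
        unfolding c \<Theta>_def
      proof (rule commute_rad[OF lu UY FI Fm mask_Inc])
        show "(\<Sum>k<?b. mscale (ent c (e k) (e k)) (fpow N Y (F u) k)) \<in> Inc (Y \<times> Y)"
          by (intro fm.subspace_sum fm.subspace_scale subspace_Inc fpow_Inc FI)
        show "mm N (\<Sum>k<?b. mscale (ent c (e k) (e k)) (fpow N Y (F u) k)) (F u)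
            = mm N (F u) (\<Sum>k<?b. mscale (ent c (e k) (e k)) (fpow N Y (F u) k))"
          using fpow_commute[OF FI, of N u] UY(2) by (simp add: mm_sum_left mm_sum_right mm_scale)
      qed
    qed
    moreover have "fd (rad (Inc ?L) (kform N (\<phi>u u)))"
      by (rule fd_subset[OF fd_Inc[OF finL]])
        (auto simp: rad_def intro: subspace_rad[OF bilin_kform[OF lu] subspace_Inc, unfolded rad_def])
    ultimately show ?thesis
      using fd_dim_mono dim_Inc[of "Id_on (U \<union> Y)"] fin by (metis finite_Id_on finite_UnI)
  qed
  have "card U + card Y \<le> fm.dim (rad (Inc ?L) (\<lambda>x y. kform N \<phi>0 x y + 1 * kform N (\<lambda>A. \<phi> A - \<phi>0 A) x y))"
  proof (rule rad_semicontinuous[OF fd_Inc[OF finL]])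
    show "finite {u. \<not> card U + card Y \<le> fm.dim (rad (Inc ?L) (\<lambda>x y. kform N \<phi>0 x y + u * kform N (\<lambda>A. \<phi> A - \<phi>0 A) x y))}"
      (is "finite ?X")
    proof (rule finite_subset[OF _ bad], rule subsetI, rule ccontr)
      fix u assume u: "u \<in> ?X" "u \<notin> ?bad"
      show False using main[OF u(2)] u(1) by (simp add: kform_def \<phi>u_def[abs_def])
    qed
  qed (intro bilin_kform linf_diff l0 \<phi>)+
  then show ?thesis by (simp add: kform_def)
qed

lemma lieind_diag_full:
  assumes UY: "U \<inter> Y = {}" "U \<union> Y \<subseteq> {..<N}"
  shows "lieind N (Inc (Id_on U \<union> Y \<times> Y) :: 'a::field_char_0 fm set) = card U + card Y"
proof (rule lieind_eqI[OF lieind_diag_full_lower[OF _ UY]])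
  let ?L = "Id_on U \<union> Y \<times> Y"
  have fin: "finite U" "finite Y" using UY(2) finite_subset[of _ "{..<N}"] by auto
  \<comment> \<open>The trace form with a diagonal matrix whose entries are distinct in
    characteristic zero; its centralizer in the full block is diagonal.\<close>
  define \<phi> :: "'a fm \<Rightarrow> 'a" where "\<phi> A = (\<Sum>i\<in>Y. of_nat i * ent A i i)" for A
  show l: "linf \<phi>" unfolding \<phi>_def by (rule linfI) (auto simp: algebra_simps sum.distrib sum_distrib_left)
  have "rad (Inc ?L) (kform N \<phi>) \<subseteq> Inc (Id_on (U \<union> Y))"
  proof (intro subsetI IncI)
    fix x i j assume x: "x \<in> rad (Inc ?L) (kform N \<phi>)" and ij: "(i, j) \<notin> Id_on (U \<union> Y)"
    have xI: "x \<in> Inc ?L" using x by (simp add: rad_def)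
    show "ent x i j = 0"
    proof (cases "i \<in> Y \<and> j \<in> Y")
      case True
      then have ne: "i \<noteq> j" using ij by (auto simp: Id_on_iff)
      have N: "i < N" "j < N" using True UY(2) by auto
      have "munit j i \<in> Inc ?L" using True by (simp add: munit_Inc)
      then have "\<phi> (br N x (munit j i)) = 0" using x unfolding rad_def kform_def by blast
      moreover have "\<phi> (br N x (munit j i)) =
          (\<Sum>p\<in>Y. if p = i then of_nat i * ent x i j else 0) - (\<Sum>p\<in>Y. if p = j then of_nat j * ent x i j else 0)"
        unfolding \<phi>_def sum_subtractf[symmetric] using N by (intro sum.cong) (auto simp: br_def mm_munit)
      ultimately have "(of_nat i - of_nat j) * ent x i j = 0"
        using True fin by (simp add: sum.delta' algebra_simps)
      then show ?thesis using ne by simp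
    next
      case False
      then show ?thesis using ij IncD[OF xI, of i j] by (auto simp: Id_on_iff)
    qed
  qed
  then have "fm.dim (rad (Inc ?L) (kform N \<phi>)) \<le> fm.dim (Inc (Id_on (U \<union> Y)) :: 'a fm set)"
    using fin by (intro fd_dim_mono fd_Inc finite_Id_on) auto
  also have "\<dots> = card U + card Y"
    using fin UY(1) by (simp add: dim_Inc finite_Id_on card_Id_on card_Un_disjoint)
  finally show "fm.dim (rad (Inc ?L) (kform N \<phi>)) \<le> card U + card Y" .
qed

section \<open>The Euclidean algorithm on block shapes\<close>

lemma card_embedding:
  assumes "finite A" "finite B" "card A \<le> card B"
  obtains \<iota> where "inj_on \<iota> A" "\<iota> ` A \<subseteq> B"
  using inj_on_iff_card_le[OF assms(1,2)] assms(3) by blast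

lemma disjoint3_images:
  assumes "inj_on \<iota> (A \<union> B)" "A \<inter> B = {}"
  shows "disjoint3 (\<iota> ` A) (\<iota> ` B) (C - \<iota> ` (A \<union> B))"
  using assms unfolding disjoint3_def inj_on_def by blast

text \<open>Induction on the total size, with |Y| \<le> |C| after passing to the converse if
  necessary. If |Y| + |T| \<le> |C|, subtract. Otherwise |C| - |Y| < |T| \<le> 2 and the chain
  cannot be reduced directly; but it is itself a reduction of a fork with a new copy
  \<open>U\<close> of \<open>T\<close>, whose lower block \<open>T \<union> C\<close> is large
  enough for another reduction. The new positions explain the ambient size \<open>M + M\<close> for
  blocks below \<open>M\<close>.\<close>

lemma chain_index:
  assumes "disjoint3 Y T C" "Y \<union> T \<union> C \<subseteq> {..<M}" "card T = 1 \<or> card T = 2"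
  shows "lieind (M + M) (Inc (chain Y T C) :: 'a::field_char_0 fm set) = gcd (card Y + card T) (card C + card T)"
  using assms
proof (induction "card Y + card C + card T" arbitrary: Y T C rule: less_induct)
  case less
  \<comment> \<open>The induction hypothesis is a premise, so that the same argument applies with
    \<open>Y\<close> and \<open>C\<close> exchanged.\<close>
  have main: "lieind (M + M) (Inc (chain Y T C) :: 'a fm set) = gcd (card Y + card T) (card C + card T)"
    if IH: "\<And>Y' T' C'. card Y' + card C' + card T' < card Y + card C + card T \<Longrightarrow> disjoint3 Y' T' C' \<Longrightarrow>
        Y' \<union> T' \<union> C' \<subseteq> {..<M} \<Longrightarrow> card T' = 1 \<or> card T' = 2 \<Longrightarrow>
        lieind (M + M) (Inc (chain Y' T' C') :: 'a fm set) = gcd (card Y' + card T') (card C' + card T')"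
      and d: "disjoint3 Y T C" "Y \<union> T \<union> C \<subseteq> {..<M}" "card T = 1 \<or> card T = 2" and le: "card Y \<le> card C"
    for Y T C :: "nat set"
  proof -
    have fin: "finite Y" "finite T" "finite C" using d(2) finite_subset[of _ "{..<M}"] by auto
    have YT: "card (Y \<union> T) = card Y + card T" using fin d(1) by (simp add: card_Un_disjoint disjoint3_def)
    show ?thesis
    proof (cases "card Y + card T \<le> card C")
      case True
      then obtain \<iota> where \<iota>: "inj_on \<iota> (Y \<union> T)" "\<iota> ` (Y \<union> T) \<subseteq> C"
        using card_embedding[of "Y \<union> T" C] fin YT by auto
      have c: "card (\<iota> ` Y) = card Y" "card (\<iota> ` T) = card T" "card (C - \<iota> ` (Y \<union> T)) = card C - (card Y + card T)"
        using \<iota> fin YT by (auto simp: card_image inj_on_Un card_Diff_subset)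
      have "lieind (M + M) (Inc (chain Y T C) :: 'a fm set)
          = lieind (M + M) (Inc (chain (\<iota> ` Y) (\<iota> ` T) (C - \<iota> ` (Y \<union> T))) :: 'a fm set)"
        using d by (intro chain_to_chain \<iota>) auto
      also have "\<dots> = gcd (card (\<iota> ` Y) + card (\<iota> ` T)) (card (C - \<iota> ` (Y \<union> T)) + card (\<iota> ` T))"
      proof (rule IH)
        show "card (\<iota> ` Y) + card (C - \<iota> ` (Y \<union> T)) + card (\<iota> ` T) < card Y + card C + card T"
          using c d(3) True by auto
        show "disjoint3 (\<iota> ` Y) (\<iota> ` T) (C - \<iota> ` (Y \<union> T))" using d(1) \<iota>(1) by (intro disjoint3_images) (auto simp: disjoint3_def)
      qed (use \<iota> d c in auto)
      also have "\<dots> = gcd (card Y + card T) (card C - card Y)" using c True by simp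
      also have "\<dots> = gcd (card Y + card T) ((card C - card Y) + (card Y + card T))" by (metis gcd_add2 add.commute)
      finally show ?thesis using le by simp
    next
      case False
      \<comment> \<open>A copy of \<open>T\<close> in positions from \<open>M\<close> on; shifting
        back by \<open>M\<close> is the matching that yields the given chain.\<close>
      define U where "U = (\<lambda>t. t + M) ` T"
      have cU: "card U = card T" unfolding U_def by (simp add: card_image inj_on_def)
      have U: "U \<inter> {..<M} = {}" "U \<subseteq> {..<M + M}" "finite U" using d(2) fin by (auto simp: U_def)
      have djU: "disjoint3 U Y (T \<union> C)" using U d(1,2) unfolding disjoint3_def by blast
      have bU: "U \<union> Y \<union> (T \<union> C) \<subseteq> {..<M + M}" using U d(2) by auto
      have UT: "(\<lambda>t. t - M) ` U = T" by (auto simp: U_def image_image)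
      have "lieind (M + M) (Inc (fork U Y (T \<union> C)) :: 'a fm set)
          = lieind (M + M) (Inc (chain Y ((\<lambda>t. t - M) ` U) (T \<union> C - (\<lambda>t. t - M) ` U)) :: 'a fm set)"
        using djU bU UT by (intro fork_to_chain) (auto simp: U_def inj_on_def)
      also have "T \<union> C - (\<lambda>t. t - M) ` U = C" using d(1) unfolding UT disjoint3_def by auto
      finally have eq1: "lieind (M + M) (Inc (chain Y T C) :: 'a fm set) = lieind (M + M) (Inc (fork U Y (T \<union> C)) :: 'a fm set)"
        unfolding UT by simp
      have UY: "card (U \<union> Y) = card T + card Y" "card (T \<union> C) = card T + card C"
        using cU fin d(1) U(3) djU by (auto simp: card_Un_disjoint disjoint3_def)
      then obtain \<iota> where \<iota>: "inj_on \<iota> (U \<union> Y)" "\<iota> ` (U \<union> Y) \<subseteq> T \<union> C"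
        using card_embedding[of "U \<union> Y" "T \<union> C"] fin U le by auto
      let ?U = "\<iota> ` U" and ?Y = "\<iota> ` Y" and ?C = "T \<union> C - \<iota> ` (U \<union> Y)"
      have c: "card ?U = card T" "card ?Y = card Y" "card ?C = card C - card Y"
        using \<iota> fin UY cU U by (auto simp: card_image inj_on_Un card_Diff_subset)
      have disjoint3: "disjoint3 ?U ?Y ?C" using djU \<iota>(1) by (intro disjoint3_images) (auto simp: disjoint3_def)
      have b: "?U \<union> ?Y \<union> ?C \<subseteq> {..<M}" using \<iota>(2) d(2) by auto
      have eq2: "lieind (M + M) (Inc (fork U Y (T \<union> C)) :: 'a fm set) = lieind (M + M) (Inc (fork ?U ?Y ?C) :: 'a fm set)"
        by (rule fork_to_fork[OF djU bU \<iota>])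
      \<comment> \<open>The lower block of the new fork has |C| - |Y| elements. If it is empty, a
        full block beside a diagonal one remains, of index |Y| + |T|. If it has one element, then
        |T| = 2 and the gcd is that of consecutive numbers.\<close>
      consider "card C = card Y" | "card C = Suc (card Y)" "card T = 2" using False le d(3) by linarith
      then show ?thesis
      proof cases
        case 1
        then have "card ?C = 0" using c by simp
        then have "?C = {}" using fin by (simp only: card_0_eq finite_Diff finite_UnI)
        from this have "fork ?U ?Y ?C = Id_on ?U \<union> ?Y \<times> ?Y" unfolding fork_def \<open>?C = {}\<close> by simp
        moreover have "?U \<inter> ?Y = {}" using disjoint3 unfolding disjoint3_def by blast
        moreover have "?U \<union> ?Y \<subseteq> {..<M + M}" using b by auto
        ultimately have "lieind (M + M) (Inc (fork ?U ?Y ?C) :: 'a fm set) = card ?U + card ?Y"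
          using lieind_diag_full[of ?U ?Y "M + M"] by simp
        then show ?thesis using eq1 eq2 1 c by (simp add: add.commute)
      next
        case 2
        then have "card ?C = 1" "card ?U = 2" using c by auto
        then obtain x u v where xuv: "?C = {x}" "?U = {u, v}" "u \<noteq> v" by (metis card_1_singletonE card_2_iff)
        have "lieind (M + M) (Inc (fork {u, v} ?Y {x}) :: 'a fm set) = lieind (M + M) (Inc (fork {v} ?Y {x}) :: 'a fm set)"
          using disjoint3 b \<open>u \<noteq> v\<close> unfolding xuv by (intro fork_drop[of u "{v}"]) auto
        also have "\<dots> = lieind (M + M) (Inc (chain ?Y ((\<lambda>_. x) ` {v}) ({x} - (\<lambda>_. x) ` {v})) :: 'a fm set)"
          using disjoint3 b unfolding xuv by (intro fork_to_chain) (auto simp: disjoint3_def)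
        also have "\<dots> = lieind (M + M) (Inc (chain ?Y {x} {}) :: 'a fm set)" by simp
        also have "\<dots> = gcd (card ?Y + card {x}) (card ({} :: nat set) + card {x})"
        proof (rule IH)
          show "card ?Y + card ({} :: nat set) + card {x} < card Y + card C + card T" using c 2 by simp
        qed (use disjoint3 b xuv in \<open>auto simp: disjoint3_def\<close>)
        finally have "lieind (M + M) (Inc (chain Y T C) :: 'a fm set) = 1" 
          unfolding eq1 eq2 xuv by simp
        moreover have "Suc (card Y) + 2 = (card Y + 2) + 1" by simp
        then have "gcd (card Y + 2) (Suc (card Y) + 2) = 1" unfolding gcd_add2 by simp
        ultimately show ?thesis unfolding 2 by simp
      qed
    qed
  qed
  show ?case
  proof (cases "card Y \<le> card C")
    case True
    show ?thesis by (rule main[OF less.hyps less.prems True])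
  next
    case False
    have "lieind (M + M) (Inc (chain C T Y) :: 'a fm set) = gcd (card C + card T) (card Y + card T)"
    proof (rule main)
      fix Y' T' C' :: "nat set"
      assume "card Y' + card C' + card T' < card C + card Y + card T" "disjoint3 Y' T' C'"
        "Y' \<union> T' \<union> C' \<subseteq> {..<M}" "card T' = 1 \<or> card T' = 2"
      then show "lieind (M + M) (Inc (chain Y' T' C') :: 'a fm set) = gcd (card Y' + card T') (card C' + card T')"
        by (intro less.hyps) auto
    qed (use less.prems False in \<open>auto simp: disjoint3_def\<close>)
    then show ?thesis
      unfolding chain_converse[OF less.prems(1), of "M + M", where 'a = 'a] by (simp add: gcd.commute)
  qed
qed

lemma fork_singleton_index:
  assumes "disjoint3 {u} Y {x}" "{u} \<union> Y \<union> {x} \<subseteq> {..<M}"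
  shows "lieind (M + M) (Inc (fork {u} Y {x}) :: 'a::field_char_0 fm set) = 1"
proof -
  have "lieind (M + M) (Inc (fork {u} Y {x}) :: 'a fm set)
      = lieind (M + M) (Inc (chain Y ((\<lambda>_. x) ` {u}) ({x} - (\<lambda>_. x) ` {u})) :: 'a fm set)"
    using assms by (intro fork_to_chain) auto
  also have "\<dots> = lieind (M + M) (Inc (chain Y {x} {}) :: 'a fm set)" by simp
  also have "\<dots> = 1" using assms by (subst chain_index) (auto simp: disjoint3_def)
  finally show ?thesis .
qed

text \<open>If \<open>U\<close> fits into \<open>P\<close>, a fork with lower block of size |P| -
  |U| remains. Matching \<open>U\<close> once more leads to a chain, unless that block is empty or
  is a single position with |U| = 2. If \<open>U\<close> does not fit, then |P| = 1 and |U| = 2, and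
  the gcd is that of consecutive numbers.\<close>

theorem flag_index:
  assumes d: "disjoint3 P Y U" "P \<union> Y \<union> U \<subseteq> {..<M}" and U: "card U = 1 \<or> card U = 2" and "P \<noteq> {}"
  shows "lieind (M + M) (Inc (flag P Y U) :: 'a::field_char_0 fm set) = gcd (card P + card Y) (card Y + card U)"
proof -
  have fin: "finite P" "finite Y" "finite U" using d(2) finite_subset[of _ "{..<M}"] by auto
  have P1: "1 \<le> card P" using assms(4) fin by (simp add: Suc_leI card_gt_0_iff)
  show ?thesis
  proof (cases "card U \<le> card P")
    case False
    then have "card P = 1" "card U = 2" using P1 U by auto
    then obtain p u v where puv: "P = {p}" "U = {u, v}" "u \<noteq> v" by (metis card_1_singletonE card_2_iff)
    have "lieind (M + M) (Inc (flag P Y U) :: 'a fm set) = lieind (M + M) (Inc (fork {p} Y {u}) :: 'a fm set)"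
      using d unfolding puv by (intro flag_drop puv) auto
    also have "\<dots> = 1" using d unfolding puv by (intro fork_singleton_index) (auto simp: disjoint3_def)
    also have "gcd (card P + card Y) (card Y + card U) = 1"
      using gcd_add2[of "card Y + 1" 1] \<open>card P = 1\<close> \<open>card U = 2\<close> by (simp add: eval_nat_numeral)
    finally show ?thesis using \<open>gcd (card P + card Y) (card Y + card U) = 1\<close> by simp
  next
    case True
    then obtain \<iota> where \<iota>: "inj_on \<iota> U" "\<iota> ` U \<subseteq> P" using card_embedding[of U P] fin by auto
    let ?T = "\<iota> ` U" and ?C = "P - \<iota> ` U"
    have cT: "card ?T = card U" "card ?C = card P - card U"
      using \<iota> fin by (auto simp: card_image card_Diff_subset)
    have disjoint3: "disjoint3 ?T Y ?C" using d(1) \<iota>(2) by (auto simp: disjoint3_def)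
    have b: "?T \<union> Y \<union> ?C \<subseteq> {..<M}" using d(2) \<iota>(2) by auto
    have eq1: "lieind (M + M) (Inc (flag P Y U) :: 'a fm set) = lieind (M + M) (Inc (fork ?T Y ?C) :: 'a fm set)"
      using d by (intro flag_to_fork \<iota>) auto
    have g: "gcd (card P + card Y) (card Y + card U) = gcd (card Y + card U) (card P - card U)"
      using True gcd_add2[of "card Y + card U" "card P - card U"] by (simp add: gcd.commute add.commute add.left_commute)
    consider "card U \<le> card ?C" | "?C = {}" | "card ?C = 1" "card U = 2"
      using U fin by (metis One_nat_def Suc_1 card_gt_0_iff finite_Diff le_simps(3) not_less_eq_eq less_one linorder_not_le nat_less_le)
    then show ?thesis
    proof cases
      case 1
      then obtain \<kappa> where \<kappa>: "inj_on \<kappa> ?T" "\<kappa> ` ?T \<subseteq> ?C" using card_embedding[of ?T ?C] fin cT by auto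
      have c: "card (\<kappa> ` ?T) = card U" "card (?C - \<kappa> ` ?T) = card ?C - card U"
        using \<kappa> fin cT by (auto simp: card_image card_Diff_subset)
      have "lieind (M + M) (Inc (fork ?T Y ?C) :: 'a fm set)
          = lieind (M + M) (Inc (chain Y (\<kappa> ` ?T) (?C - \<kappa> ` ?T)) :: 'a fm set)"
        using b by (intro fork_to_chain disjoint3 \<kappa>) auto
      also have "\<dots> = gcd (card Y + card (\<kappa> ` ?T)) (card (?C - \<kappa> ` ?T) + card (\<kappa> ` ?T))"
      proof (rule chain_index)
        show "disjoint3 Y (\<kappa> ` ?T) (?C - \<kappa> ` ?T)" using disjoint3 \<kappa>(2) unfolding disjoint3_def by blast
        show "Y \<union> \<kappa> ` ?T \<union> (?C - \<kappa> ` ?T) \<subseteq> {..<M}" using b \<kappa>(2) by blast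
      qed (use U c in simp)
      also have "\<dots> = gcd (card Y + card U) (card P - card U)" using c 1 cT by simp
      finally show ?thesis using eq1 g by simp
    next
      case 2
      have "fork ?T Y ?C = Id_on ?T \<union> Y \<times> Y" unfolding fork_def 2 by simp
      moreover have "?T \<inter> Y = {}" using disjoint3 unfolding disjoint3_def by blast
      moreover have "?T \<union> Y \<subseteq> {..<M + M}" using b by auto
      ultimately have "lieind (M + M) (Inc (fork ?T Y ?C) :: 'a fm set) = card ?T + card Y"
        using lieind_diag_full[of ?T Y "M + M"] by simp
      moreover have "card P - card U = 0" using cT(2) unfolding 2 by simp
      ultimately show ?thesis using eq1 g cT by simp
    next
      case 3
      then obtain x u v where xuv: "?C = {x}" "?T = {u, v}" "u \<noteq> v" using cT by (metis card_1_singletonE card_2_iff)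
      have disjoint3': "disjoint3 {u, v} Y {x}" using disjoint3 unfolding xuv(1) unfolding xuv(2) .
      have b': "{u, v} \<union> Y \<union> {x} \<subseteq> {..<M}" using b unfolding xuv(1) unfolding xuv(2) .
      have "lieind (M + M) (Inc (fork ?T Y ?C) :: 'a fm set) = lieind (M + M) (Inc (fork {u, v} Y {x}) :: 'a fm set)"
        unfolding xuv(1) unfolding xuv(2) ..
      also have "\<dots> = lieind (M + M) (Inc (fork {v} Y {x}) :: 'a fm set)"
        using disjoint3' b' \<open>u \<noteq> v\<close> by (intro fork_drop[of u "{v}"]) auto
      also have "\<dots> = 1" using disjoint3' b' by (intro fork_singleton_index) (auto simp: disjoint3_def)
      finally have "lieind (M + M) (Inc (flag P Y U) :: 'a fm set) = 1" unfolding eq1 .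
      moreover have "card P - card U = 1" using 3(1) cT(2) by simp
      ultimately show ?thesis unfolding g by simp
    qed
  qed
qed

subsection \<open>Central extensions and the seaweed in coordinates\<close>

text \<open>\<open>L\<close> is the direct sum of the kernel of \<open>\<tau>\<close> and the
  central line through \<open>z\<close>. A central element lies in the radical of every Kirillov
  form, so this line contributes exactly one dimension.\<close>

lemma dim_rad_central:
  fixes L :: "'a::field fm set"
  assumes L: "fd L" and \<phi>: "linf \<phi>" and \<tau>: "linf \<tau>" and z: "z \<in> L" "\<And>x. x \<in> L \<Longrightarrow> br N z x = 0" "\<tau> z \<noteq> 0"
  shows "fm.dim (rad L (kform N \<phi>)) = fm.dim (rad {x \<in> L. \<tau> x = 0} (kform N \<phi>)) + 1"
proof -
  let ?L0 = "{x \<in> L. \<tau> x = 0}" and ?B = "kform N \<phi>"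
  have B: "bilin ?B" by (rule bilin_kform[OF \<phi>])
  have subL: "fm.subspace L" by (rule fd_subspace[OF L])
  have sub0: "fm.subspace ?L0"
    using subL fmf.linear_add[OF \<tau>] fmf.linear_scale[OF \<tau>] fmf.linear_0[OF \<tau>]
    by (auto simp: fm.subspace_def)
  have fd0: "fd (rad ?L0 ?B)"
    by (rule fd_subset[OF L subspace_rad[OF B sub0]]) (auto simp: rad_def)
  obtain S where S: "S \<subseteq> rad ?L0 ?B" "finite S" "fm.independent S" "fm.span S = rad ?L0 ?B" "card S = fm.dim (rad ?L0 ?B)"
    using fd_basis[OF fd0] .
  have Bz: "?B x z = 0" if "x \<in> L" for x
    using kform_alt[OF \<phi>, of N x z] z(2)[OF that] fmf.linear_0[OF \<phi>] by (simp add: kform_def)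
  have zrad: "z \<in> rad L ?B"
    using z(1,2) fmf.linear_0[OF \<phi>] by (simp add: rad_def kform_def)
  have split: "x - mscale (\<tau> x / \<tau> z) z \<in> ?L0" if "x \<in> L" for x
    using that z subL fmf.linear_diff[OF \<tau>] fmf.linear_scale[OF \<tau>]
    by (simp add: fm.subspace_diff fm.subspace_scale)
  have sub: "rad ?L0 ?B \<subseteq> rad L ?B"
  proof
    fix x assume x: "x \<in> rad ?L0 ?B"
    then have xL: "x \<in> L" by (simp add: rad_def)
    have "?B x y = 0" if y: "y \<in> L" for y
    proof -
      have "?B x (y - mscale (\<tau> y / \<tau> z) z) = 0" using x split[OF y] unfolding rad_def by blast
      then show ?thesis using Bz[OF xL] by (simp add: bilin_simps[OF B])
    qed
    then show "x \<in> rad L ?B" using xL by (simp add: rad_def)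
  qed
  have subR: "fm.subspace (rad L ?B)" by (rule subspace_rad[OF B subL])
  have znot: "z \<notin> fm.span S" unfolding S(4) using z(3) by (simp add: rad_def)
  have "fm.span (insert z S) = rad L ?B"
  proof (intro equalityI subsetI)
    show "x \<in> rad L ?B" if "x \<in> fm.span (insert z S)" for x
      using fm.span_minimal[OF _ subR, of "insert z S"] zrad S(1) sub that by blast
    fix x assume x: "x \<in> rad L ?B"
    then have xL: "x \<in> L" by (simp add: rad_def)
    let ?y = "x - mscale (\<tau> x / \<tau> z) z"
    have "?y \<in> rad L ?B" using x zrad subR by (intro fm.subspace_diff fm.subspace_scale)
    then have "?y \<in> rad ?L0 ?B" using split[OF xL] by (simp add: rad_def)
    then have "?y \<in> fm.span (insert z S)" using S(4) fm.span_mono[of S "insert z S"] by blast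
    moreover have "mscale (\<tau> x / \<tau> z) z \<in> fm.span (insert z S)"
      by (intro fm.span_scale fm.span_base) simp
    ultimately have "?y + mscale (\<tau> x / \<tau> z) z \<in> fm.span (insert z S)" by (rule fm.span_add)
    then show "x \<in> fm.span (insert z S)" by simp
  qed
  moreover have "fm.independent (insert z S)" using znot S(3) by (rule fm.independent_insertI)
  ultimately have "fm.dim (rad L ?B) = card (insert z S)" by (metis fm.dim_span_eq_card_independent)
  also have "\<dots> = card S + 1"
  proof -
    have "z \<notin> S" using znot fm.span_base by blast
    then show ?thesis using S(2) by simp
  qed
  finally show ?thesis using S(5) by simp
qed

text \<open>The shift by one is the same for all functionals and so passes to the minimum; in
  particular the index of \<open>L\<close> is positive and the subtraction is exact.\<close>

lemma lieind_central:
  fixes L :: "'a::field fm set"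
  assumes L: "fd L" and \<tau>: "linf \<tau>" and z: "z \<in> L" "\<And>x. x \<in> L \<Longrightarrow> br N z x = 0" "\<tau> z \<noteq> 0"
  shows "lieind N {x \<in> L. \<tau> x = 0} = lieind N L - 1"
proof -
  note d = dim_rad_central[OF L _ \<tau> z]
  obtain \<phi> where \<phi>: "linf \<phi>" "fm.dim (rad L (kform N \<phi>)) = lieind N L" using lieind_attained .
  show ?thesis
  proof (rule lieind_eqI[OF _ \<phi>(1)])
    show "lieind N L - 1 \<le> fm.dim (rad {x \<in> L. \<tau> x = 0} (kform N \<psi>))" if "linf \<psi>" for \<psi>
      using d[OF that] lieind_le[OF that, of N L] by simp
    show "fm.dim (rad {x \<in> L. \<tau> x = 0} (kform N \<phi>)) \<le> lieind N L - 1"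
      using d[OF \<phi>(1)] \<phi>(2) by simp
  qed
qed

section \<open>The two-part seaweed as a semidirect product\<close>

locale two_part_seaweed =
  fixes a b r :: nat
  assumes a: "a > 0" and r: "r = 1 \<or> r = 2"
begin

definition "m = a + b"
definition "n = m + r"
definition "N = n + n"
definition "U = {m..<n}"
definition "fl0 = flag {..<a} {a..<m} U"
definition "fl = fl0 \<union> U \<times> U"
definition mir where "mir i = N - 1 - i"

text \<open>The seaweed in 0-based coordinates. Since the lower left block vanishes, the last two
  conditions, one for the diagonal blocks and one for the upper right block, are all the symplectic
  relations.\<close>

definition Q :: "'a::field fm set" where
  "Q = {X. X \<in> Inc ({..<N} \<times> {..<N}) \<and> (\<forall>i<n. \<forall>j<n. (i, j) \<notin> fl \<longrightarrow> ent X i j = 0) \<and>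
    (\<forall>i j. n \<le> i \<longrightarrow> j < n \<longrightarrow> ent X i j = 0) \<and>
    (\<forall>i j. i < n \<longrightarrow> n \<le> j \<longrightarrow> \<not> (i \<in> U \<and> mir j \<in> U) \<longrightarrow> ent X i j = 0) \<and>
    (\<forall>i<n. \<forall>j<n. ent X (mir j) (mir i) = - ent X i j) \<and>
    (\<forall>i<n. \<forall>j. n \<le> j \<longrightarrow> j < N \<longrightarrow> ent X (mir j) (mir i) = ent X i j)}"

definition V :: "'a::field fm set" where
  "V = {X \<in> Q. \<forall>i<n. \<forall>j<n. ent X i j = 0}"

text \<open>The embedding of gl(n) into sp(2n) that sends A to the block diagonal matrix of A and
  minus its antidiagonal transpose.\<close>

definition dbl :: "'a::field fm \<Rightarrow> 'a fm" where
  "dbl A = Fm (\<lambda>i j. if i < n \<and> j < n then ent A i j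
    else if n \<le> i \<and> n \<le> j \<and> i < N \<and> j < N then - ent A (mir j) (mir i) else 0)"

lemma ent_dbl: "ent (dbl A) i j = (if i < n \<and> j < n then ent A i j
    else if n \<le> i \<and> n \<le> j \<and> i < N \<and> j < N then - ent A (mir j) (mir i) else 0)"
  by (simp add: dbl_def)

lemma mir: "i < N \<Longrightarrow> mir i < N" "i < N \<Longrightarrow> mir (mir i) = i" "i < N \<Longrightarrow> mir i < n \<longleftrightarrow> n \<le> i"
  "i < N \<Longrightarrow> n \<le> mir i \<longleftrightarrow> i < n" "i < n \<Longrightarrow> n \<le> mir i"
  by (auto simp: mir_def N_def)

lemma fl_iff: "(i, j) \<in> fl \<longleftrightarrow> i < n \<and> j < n \<and> (i < a \<longrightarrow> j < a) \<and> (i < m \<longrightarrow> j < m)"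
proof -
  have "a \<le> m" "m \<le> n" by (auto simp: m_def n_def)
  then show ?thesis unfolding fl_def fl0_def flag_def U_def by (simp add: Id_on_iff) arith
qed

lemma fl_sub: "fl \<subseteq> {..<n} \<times> {..<n}" "fl0 \<subseteq> fl"
proof -
  show "fl \<subseteq> {..<n} \<times> {..<n}" by (auto simp: fl_iff)
  show "fl0 \<subseteq> fl" by (simp add: fl_def)
qed

lemma fl_U: "(i, j) \<in> fl \<Longrightarrow> j \<in> U \<Longrightarrow> i \<in> U"
  by (auto simp: fl_iff U_def)


lemma nN: "n \<le> N" "U \<subseteq> {..<n}" "finite U"
  by (auto simp: N_def U_def)

lemma lin_dbl: "lin dbl"
  by (rule linI) (auto simp: fm_eq_iff ent_dbl)

lemma sum_halves: "(\<Sum>k<N. f k) = (\<Sum>k<n. f k) + (\<Sum>k<n. f (mir k))"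
proof -
  have "{..<N} = {..<n} \<union> mir ` {..<n}"
  proof (intro equalityI subsetI)
    fix k assume "k \<in> {..<N}"
    then show "k \<in> {..<n} \<union> mir ` {..<n}"
      using mir[of k] by (cases "k < n") (auto intro!: image_eqI[of k mir "mir k"])
  qed (use mir nN(1) in auto)
  moreover have "{..<n} \<inter> mir ` {..<n} = {}" using mir(5) by fastforce
  moreover have "inj_on mir {..<n}" by (rule inj_onI) (auto simp: mir_def N_def)
  ultimately show ?thesis by (simp add: sum.union_disjoint sum.reindex)
qed

text \<open>\<open>dbl\<close> is not multiplicative: in the lower right block the two signs cancel
  and the factors change order. The commutator restores the sign, which gives
  \<open>dbl_br\<close>.\<close>

lemma dbl_mm:
  assumes A: "A \<in> Inc fl" "A' \<in> Inc fl"
  shows "mm N (dbl A) (dbl A') = (Fm (\<lambda>i j. if i < n \<and> j < n then ent (mm N A A') i j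
    else if n \<le> i \<and> n \<le> j \<and> i < N \<and> j < N then ent (mm N A' A) (mir j) (mir i) else 0))"
proof (rule fm_eqI)
  fix i j
  have z: "ent A p k = 0" "ent A' p k = 0" "ent A k p = 0" "ent A' k p = 0" if "\<not> k < n" for p k
  proof -
    have "(p, k) \<notin> fl" "(k, p) \<notin> fl" using fl_sub(1) that by auto
    then show "ent A p k = 0" "ent A' p k = 0" "ent A k p = 0" "ent A' k p = 0" using A by (simp_all add: IncD)
  qed
  have s: "(\<Sum>k<N. ent X i k * ent Y k j) = (\<Sum>k<n. ent X i k * ent Y k j)"
    if "\<And>k. \<not> k < n \<Longrightarrow> ent X i k = 0" for X Y :: "'a fm" and i j
    using nN(1) that by (intro sum.mono_neutral_right) auto
  consider "i < n" "j < n" | "n \<le> i" "n \<le> j" "i < N" "j < N" | "i < n" "n \<le> j" | "n \<le> i" "j < n" | "\<not> i < N \<or> \<not> j < N"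
    by linarith
  then show "ent (mm N (dbl A) (dbl A')) i j = ent (Fm (\<lambda>i j. if i < n \<and> j < n then ent (mm N A A') i j
    else if n \<le> i \<and> n \<le> j \<and> i < N \<and> j < N then ent (mm N A' A) (mir j) (mir i) else 0)) i j"
  proof cases
    case 1
    have "(\<Sum>k<N. ent (dbl A) i k * ent (dbl A') k j) = (\<Sum>k<n. ent (dbl A) i k * ent (dbl A') k j)"
      using 1 by (intro s) (auto simp: ent_dbl)
    also have "\<dots> = (\<Sum>k<n. ent A i k * ent A' k j)" using 1 by (intro sum.cong) (auto simp: ent_dbl)
    also have "\<dots> = (\<Sum>k<N. ent A i k * ent A' k j)" using z by (intro s[symmetric]) auto
    finally show ?thesis using 1 by (simp add: ent_mm)
  next
    case 2
    have "(\<Sum>k<N. ent (dbl A) i k * ent (dbl A') k j) = (\<Sum>k<n. ent (dbl A) i (mir k) * ent (dbl A') (mir k) j)"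
      unfolding sum_halves using 2 by (simp add: ent_dbl)
    also have "\<dots> = (\<Sum>k<n. ent A' (mir j) k * ent A k (mir i))"
      using 2 mir nN(1) by (intro sum.cong) (auto simp: ent_dbl)
    also have "\<dots> = (\<Sum>k<N. ent A' (mir j) k * ent A k (mir i))" using z by (intro s[symmetric]) auto
    finally show ?thesis using 2 by (simp add: ent_mm)
  next
    case 3
    then have "ent (dbl A) i k * ent (dbl A') k j = 0" for k by (auto simp: ent_dbl)
    then show ?thesis using 3 by (auto simp: ent_mm)
  next
    case 4
    then have "ent (dbl A) i k * ent (dbl A') k j = 0" for k by (auto simp: ent_dbl)
    then show ?thesis using 4 by (auto simp: ent_mm)
  next
    case 5
    then have "ent (dbl A) i k * ent (dbl A') k j = 0" for k using nN(1) by (auto simp: ent_dbl)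
    then show ?thesis using 5 nN(1) by (auto simp: ent_mm)
  qed
qed

lemma dbl_br:
  assumes A: "A \<in> Inc fl" "A' \<in> Inc fl"
  shows "br N (dbl A) (dbl A') = dbl (br N A A')"
  unfolding br_def dbl_mm[OF A] dbl_mm[OF A(2,1)] by (auto simp: fm_eq_iff ent_dbl)

lemma inj_dbl: "inj_on dbl (Inc fl)"
proof (rule inj_onI, rule fm_eqI)
  fix A A' i j assume A: "A \<in> Inc fl" "A' \<in> Inc fl" "dbl A = dbl A'"
  show "ent A i j = ent A' i j"
  proof (cases "(i, j) \<in> fl")
    case True
    then have "i < n" "j < n" using fl_sub(1) by auto
    then show ?thesis using arg_cong[OF A(3), of "\<lambda>X. ent X i j"] by (simp add: ent_dbl)
  next
    case False
    then show ?thesis using A(1,2) by (simp add: IncD)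
  qed
qed

lemma dbl_Q: "A \<in> Inc fl \<Longrightarrow> dbl A \<in> Q"
proof -
  assume A: "A \<in> Inc fl"
  have "ent (dbl A) (mir j) (mir i) = - ent (dbl A) i j" if "i < n" "j < n" for i j
    using that nN(1) mir[of i] mir[of j] by (simp add: ent_dbl)
  moreover have "ent (dbl A) (mir j) (mir i) = ent (dbl A) i j" if "i < n" "n \<le> j" "j < N" for i j
    using that nN(1) mir(1-5)[of i] mir(1-4)[of j] by (simp add: ent_dbl)
  moreover have "ent (dbl A) i j = 0" if "i < n" "j < n" "(i, j) \<notin> fl" for i j
    using that IncD[OF A] by (simp add: ent_dbl)
  moreover have "ent (dbl A) i j = 0" if "\<not> i < N \<or> \<not> j < N" for i j
    using that nN(1) by (auto simp: ent_dbl)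
  ultimately show "dbl A \<in> Q" unfolding Q_def Inc_def by (auto simp: ent_dbl)
qed

lemma Q_sym: "X \<in> Q \<Longrightarrow> i < n \<Longrightarrow> j < n \<Longrightarrow> ent X (mir j) (mir i) = - ent X i j"
  by (simp add: Q_def)

lemma Q_dbl:
  assumes X: "X \<in> Q" and 0: "\<And>i j. i < n \<Longrightarrow> n \<le> j \<Longrightarrow> ent X i j = 0"
  shows "X \<in> dbl ` Inc fl"
proof
  let ?A = "mask ({..<n} \<times> {..<n}) X"
  show "?A \<in> Inc fl" using X by (auto simp: Inc_def ent_mask Q_def)
  show "X = dbl ?A"
  proof (rule fm_eqI)
    fix i j
    have sq: "ent X i j = 0" if "\<not> i < N \<or> \<not> j < N" using X that by (auto simp: Q_def Inc_def)
    have sy: "ent X i j = - ent X (mir j) (mir i)" if "n \<le> i" "n \<le> j" "i < N" "j < N"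
      using Q_sym[OF X, of "mir j" "mir i"] that mir(1-4)[of i] mir(1-4)[of j] by simp
    have low: "ent X i j = 0" if "n \<le> i" "j < n" using X that by (auto simp: Q_def)
    show "ent X i j = ent (dbl ?A) i j"
      using sq sy low 0[of i j] mir nN(1) by (auto simp: ent_dbl ent_mask)
  qed
qed

lemma subspace_Q: "fm.subspace Q"
  unfolding fm.subspace_def Q_def Inc_def by simp

lemma fd_Q: "fd Q"
  by (rule fd_subset[OF fd_Inc[of "{..<N} \<times> {..<N}"] subspace_Q]) (auto simp: Q_def)

lemma V_ent: "v \<in> V \<Longrightarrow> ent v i j \<noteq> 0 \<Longrightarrow> i \<in> U \<and> n \<le> j \<and> j < N \<and> mir j \<in> U"
proof -
  assume v: "v \<in> V" and ne: "ent v i j \<noteq> 0"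
  have N: "i < N" "j < N" using v ne by (auto simp: V_def Q_def Inc_def)
  have "\<not> (n \<le> i \<and> j < n)" using v ne by (auto simp: V_def Q_def)
  moreover have "\<not> (i < n \<and> j < n)" using v ne by (auto simp: V_def)
  moreover have "\<not> (n \<le> i \<and> n \<le> j)"
  proof
    assume h: "n \<le> i \<and> n \<le> j"
    then have m: "mir i < n" "mir j < n" "mir (mir i) = i" "mir (mir j) = j" using mir N by auto
    have "v \<in> Q" using v by (simp add: V_def)
    then have "ent v i j = - ent v (mir j) (mir i)" using Q_sym[of v "mir j" "mir i"] m by simp
    also have "ent v (mir j) (mir i) = 0" using v m by (auto simp: V_def)
    finally show False using m ne by simp
  qed
  ultimately have "i < n" "n \<le> j" by auto
  moreover have "v \<in> Q" using v by (simp add: V_def)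
  ultimately show ?thesis using ne N unfolding Q_def by blast
qed

text \<open>Isotropic reduction with \<open>S\<close> the embedded copy of \<open>Inc fl\<close> and
  \<open>V\<close> the symmetric forms. Nondegeneracy on \<open>V\<close> stays an assumption, to be
  verified for r = 1 and r = 2 separately.\<close>

lemma dim_rad_Q:
  fixes \<phi> :: "'a::field fm \<Rightarrow> 'a"
  assumes \<phi>: "linf \<phi>"
    and nondeg: "\<And>v. v \<in> V \<Longrightarrow> (\<And>A. A \<in> Inc fl \<Longrightarrow> \<phi> (br N (dbl A) v) = 0) \<Longrightarrow> v = 0"
  shows "fm.dim (rad Q (kform N \<phi>))
    = fm.dim (rad {A \<in> Inc fl. \<forall>v\<in>V. \<phi> (br N (dbl A) v) = 0} (kform N (\<lambda>A. \<phi> (dbl A))))"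
proof -
  let ?D = "{..<n} \<times> {..<n} \<union> {n..} \<times> {n..}" and ?B = "kform N \<phi>"
  let ?A0 = "{A \<in> Inc fl. \<forall>v\<in>V. \<phi> (br N (dbl A) v) = 0}"
  have B: "bilin ?B" by (rule bilin_kform[OF \<phi>])
  have "fm.dim (rad Q ?B) = fm.dim (rad {x \<in> dbl ` Inc fl. \<forall>v\<in>V. ?B x v = 0} ?B)"
  proof (rule symplectic_reduction[where pr = "mask ?D", OF fd_Q B])
    show "?B y x = - ?B x y" for x y by (rule kform_alt[OF \<phi>])
    show "fm.subspace (dbl ` Inc fl :: 'a fm set)" by (rule fmp.linear_subspace_image[OF lin_dbl subspace_Inc])
    show "dbl ` Inc fl \<subseteq> Q" using dbl_Q by blast
    show "fm.subspace V" using subspace_Q unfolding V_def fm.subspace_def by auto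
    show "V \<subseteq> Q" by (auto simp: V_def)
    show "lin (mask ?D)" by (rule lin_mask)
    show "mask ?D x \<in> dbl ` Inc fl" if x: "x \<in> Q" for x :: "'a fm"
    proof (rule Q_dbl)
      show "mask ?D x \<in> Q" using x mir unfolding Q_def by (auto simp: Inc_def ent_mask)
    qed (auto simp: ent_mask)
    show "x - mask ?D x \<in> V" if x: "x \<in> Q" for x :: "'a fm"
      using x mir unfolding V_def Q_def by (auto simp: Inc_def ent_mask)
    show "mask ?D x = x" if "x \<in> dbl ` Inc fl" for x :: "'a fm"
      using that by (auto simp: fm_eq_iff ent_mask ent_dbl)
    show "mask ?D x = 0" if x: "x \<in> V" for x :: "'a fm"
    proof (rule fm_eqI)
      show "ent (mask ?D x) i j = ent 0 i j" for i j
      proof (cases "ent x i j = 0")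
        case False
        then have "i < n" "n \<le> j" using V_ent[OF x False] nN(2) by auto
        then show ?thesis by (simp add: ent_mask)
      qed (simp add: ent_mask)
    qed
    show "?B v w = 0" if v: "v \<in> V" and w: "w \<in> V" for v w :: "'a fm"
    proof -
      have "ent x i k * ent y k j = 0" if "x \<in> V" "y \<in> V" for x y :: "'a fm" and i j k
        using V_ent[OF that(1), of i k] V_ent[OF that(2), of k j] nN(2) by fastforce
      then have "mm N v w = 0" "mm N w v = 0" using v w by (simp_all add: fm_eq_iff ent_mm)
      then show ?thesis by (simp add: kform_def br_def fmf.linear_0[OF \<phi>])
    qed
    show "v = 0" if "v \<in> V" "\<And>x. x \<in> dbl ` Inc fl \<Longrightarrow> ?B x v = 0" for v :: "'a fm"
      using that by (intro nondeg) (auto simp: kform_def)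
  qed
  also have "{x \<in> dbl ` Inc fl. \<forall>v\<in>V. ?B x v = 0} = dbl ` ?A0" by (auto simp: kform_def)
  also have "fm.dim (rad (dbl ` ?A0) ?B) = fm.dim (rad ?A0 (kform N (\<lambda>A. \<phi> (dbl A))))"
  proof (rule rad_image[OF lin_dbl, where s = 1])
    have "bilin (\<lambda>A v. \<phi> (br N (dbl A) v))"
      unfolding bilin_def br_def
      by (intro conjI allI linfI) (simp_all add: fmp.linear_add[OF lin_dbl] fmp.linear_scale[OF lin_dbl]
          mm_add mm_scale fmf.linear_add[OF \<phi>] fmf.linear_diff[OF \<phi>] fmf.linear_scale[OF \<phi>] algebra_simps)
    from bilin_simps[OF this] show "fm.subspace ?A0"
      using subspace_Inc[of fl] unfolding fm.subspace_def by simp blast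
    show "inj_on dbl ?A0" by (rule inj_on_subset[OF inj_dbl]) auto
    show "bilin (kform N (\<lambda>A. \<phi> (dbl A)))" by (rule bilin_kform[OF linf_compose[OF lin_dbl \<phi>]])
    show "kform N (\<lambda>A. \<phi> (dbl A)) x y = 1 * ?B (dbl x) (dbl y)" if "x \<in> ?A0" "y \<in> ?A0" for x y
      using that by (simp add: kform_def dbl_br)
  qed simp
  finally show ?thesis .
qed

text \<open>The action of A on forms is A v plus v times the antidiagonal transpose of A. By
  \<open>fl_U\<close> the columns of \<open>A\<close> in \<open>U\<close> are supported in rows of
  \<open>U\<close>, so only the block of \<open>A\<close> on \<open>U\<close> acts.\<close>

lemma ent_br_dbl:
  assumes A: "A \<in> Inc fl" and v: "v \<in> V"
  shows "ent (br N (dbl A) v) i j = (if i \<in> U \<and> n \<le> j \<and> j < N \<and> mir j \<in> U then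
    (\<Sum>k\<in>U. ent A i k * ent v k j) + (\<Sum>k\<in>U. ent v i (mir k) * ent A (mir j) k) else 0)"
proof -
  have UN: "U \<subseteq> {..<N}" using nN by auto
  have 1: "ent (mm N (dbl A) v) i j = (\<Sum>k\<in>U. ent (dbl A) i k * ent v k j)"
    unfolding ent_mm using V_ent[OF v] UN by (intro sum.mono_neutral_right) auto
  have 2: "ent (mm N v (dbl A)) i j = (\<Sum>k\<in>U. ent v i (mir k) * ent (dbl A) (mir k) j)"
  proof -
    have "ent v i k = 0" if "k < n" for k using V_ent[OF v, of i k] that by auto
    then have "ent (mm N v (dbl A)) i j = (\<Sum>k<n. ent v i (mir k) * ent (dbl A) (mir k) j)"
      unfolding ent_mm sum_halves by simp
    also have "\<dots> = (\<Sum>k\<in>U. ent v i (mir k) * ent (dbl A) (mir k) j)"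
    proof (intro sum.mono_neutral_right ballI)
      fix k assume k: "k \<in> {..<n} - U"
      then have "mir (mir k) = k" using mir(2) nN(1) by auto
      then show "ent v i (mir k) * ent (dbl A) (mir k) j = 0" using V_ent[OF v, of i "mir k"] k by auto
    qed (use nN in auto)
    finally show ?thesis .
  qed
  have vz: "ent v p q = 0" if "\<not> (p \<in> U \<and> n \<le> q \<and> q < N \<and> mir q \<in> U)" for p q
    using V_ent[OF v, of p q] that by blast
  show ?thesis
  proof (cases "i \<in> U \<and> n \<le> j \<and> j < N \<and> mir j \<in> U")
    case True
    have "(\<Sum>k\<in>U. ent (dbl A) i k * ent v k j) = (\<Sum>k\<in>U. ent A i k * ent v k j)"
      using True nN(2) by (intro sum.cong) (auto simp: ent_dbl)
    moreover have "(\<Sum>k\<in>U. ent v i (mir k) * ent (dbl A) (mir k) j) = - (\<Sum>k\<in>U. ent v i (mir k) * ent A (mir j) k)"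
    proof -
      have "ent (dbl A) (mir k) j = - ent A (mir j) k" if "k \<in> U" for k
        using True that nN mir[of k] by (auto simp: ent_dbl)
      then show ?thesis by (simp add: sum_negf)
    qed
    ultimately show ?thesis using True by (simp add: br_def 1 2)
  next
    case False
    have "(\<Sum>k\<in>U. ent (dbl A) i k * ent v k j) = 0"
    proof (rule sum.neutral, rule ballI)
      fix k assume k: "k \<in> U"
      show "ent (dbl A) i k * ent v k j = 0"
      proof (cases "n \<le> j \<and> j < N \<and> mir j \<in> U")
        case True
        then have "(i, k) \<notin> fl" using False fl_U k by blast
        moreover have "k < n" using k nN(2) by auto
        ultimately show ?thesis using IncD[OF A] by (auto simp: ent_dbl)
      qed (use vz in auto)
    qed
    moreover have "(\<Sum>k\<in>U. ent v i (mir k) * ent (dbl A) (mir k) j) = 0"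
    proof (rule sum.neutral, rule ballI)
      fix k assume k: "k \<in> U"
      then have kN: "k < N" "k < n" using UN nN by auto
      show "ent v i (mir k) * ent (dbl A) (mir k) j = 0"
      proof (cases "i \<in> U")
        case True
        have "(mir j, k) \<notin> fl" if "n \<le> j" "j < N" using False True that fl_U k by blast
        then show ?thesis using IncD[OF A] mir(1-4)[OF kN(1)] mir(5)[OF kN(2)] kN(2) by (auto simp: ent_dbl)
      qed (use vz in auto)
    qed
    ultimately show ?thesis unfolding if_not_P[OF False] by (simp add: br_def 1 2)
  qed
qed

end

section \<open>Stabilizers of generic forms in one and two variables\<close>

context two_part_seaweed
begin

text \<open>One formula for both values of r: trace zero makes a diagonal block of size one vanish
  and one of size two equal to diag(t, -t). As the kernel of a functional it has the form required
  by \<open>lieind_central\<close>.\<close>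

definition S0 :: "'a::field fm set" where
  "S0 = {A \<in> Inc fl0. (\<Sum>u\<in>U. ent A u u) = 0}"

lemma fl0_finite: "finite fl0" "finite fl"
proof -
  show "finite fl" by (rule finite_subset[OF fl_sub(1)]) simp
  then show "finite fl0" by (rule finite_subset[OF fl_sub(2)])
qed

lemma fl0_iff: "(i, j) \<in> fl0 \<longleftrightarrow> (i, j) \<in> fl \<and> (m \<le> j \<longrightarrow> i = j)"
proof -
  have "a \<le> m" "m \<le> n" by (auto simp: m_def n_def)
  then show ?thesis unfolding fl_iff fl0_def flag_def U_def by (simp add: Id_on_iff) arith
qed

lemma V_I:
  assumes z: "\<And>i j. ent X i j \<noteq> 0 \<Longrightarrow> i \<in> U \<and> n \<le> j \<and> j < N \<and> mir j \<in> U"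
    and s: "\<And>i j. i \<in> U \<Longrightarrow> n \<le> j \<Longrightarrow> j < N \<Longrightarrow> mir j \<in> U \<Longrightarrow> ent X (mir j) (mir i) = ent X i j"
  shows "X \<in> V"
proof -
  have z': "ent X i j = 0" if "i \<notin> U \<or> j < n \<or> N \<le> j \<or> mir j \<notin> U" for i j
    using z[of i j] that by force
  have UN: "i \<in> U \<Longrightarrow> i < n" for i using nN(2) by auto
  have sq: "X \<in> Inc ({..<N} \<times> {..<N})"
  proof (rule IncI)
    fix i j assume "(i, j) \<notin> {..<N} \<times> {..<N}"
    then have "i \<notin> U \<or> N \<le> j" using UN[of i] nN(1) by auto
    then show "ent X i j = 0" using z' by blast
  qed
  have s': "ent X (mir j) (mir i) = ent X i j" if "i < n" "n \<le> j" "j < N" for i j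
  proof (cases "i \<in> U \<and> mir j \<in> U")
    case True
    then show ?thesis using s that by blast
  next
    case False
    have "mir (mir i) = i" using that nN(1) mir(2)[of i] by simp
    then have "ent X (mir j) (mir i) = 0" using False by (intro z') auto
    moreover have "ent X i j = 0" using False by (intro z') auto
    ultimately show ?thesis by simp
  qed
  have d: "ent X (mir j) (mir i) = 0" if "i < n" "j < n" for i j
    using UN[of "mir j"] mir(5)[OF that(2)] by (intro z') auto
  have t: "ent X i j = 0" if "j < n" for i j using that by (intro z') simp
  have l: "ent X i j = 0" if "\<not> (i \<in> U \<and> mir j \<in> U)" for i j using that by (intro z') blast
  show ?thesis unfolding V_def Q_def using sq s' d t l by simp
qed

lemma lieind_S0: "lieind N (S0 :: 'a::field_char_0 fm set) = gcd (a + b) (b + r) - 1"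
proof -
  have one: "one_fm n \<in> (Inc fl0 :: 'a fm set)"
    by (auto simp: Inc_def ent_one_fm fl0_iff fl_iff)
  have "lieind N (S0 :: 'a fm set) = lieind N (Inc fl0 :: 'a fm set) - 1"
    unfolding S0_def
  proof (rule lieind_central[OF fd_Inc[OF fl0_finite(1)] linf_sum_ent one])
    show "br N (one_fm n) x = 0" if x: "x \<in> Inc fl0" for x :: "'a fm"
    proof (rule fm_eqI)
      fix i j
      have z: "ent x i j = 0" if "\<not> i < n \<or> \<not> j < n"
        using IncD[OF x, of i j] that fl_sub by auto
      have "ent (mm N (one_fm n) x) i j = (\<Sum>k<N. if k = i then ent x i j else 0)"
        unfolding ent_mm using z nN(1) by (intro sum.cong) (auto simp: ent_one_fm)
      moreover have "ent (mm N x (one_fm n)) i j = (\<Sum>k<N. if k = j then ent x i j else 0)"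
        unfolding ent_mm using z nN(1) by (intro sum.cong) (auto simp: ent_one_fm)
      ultimately show "ent (br N (one_fm n) x) i j = ent 0 i j"
        using z nN(1) by (auto simp: br_def sum.delta')
    qed
    have "(\<Sum>u\<in>U. ent (one_fm n :: 'a fm) u u) = (\<Sum>u\<in>U. 1)"
      using nN(2) by (intro sum.cong) (auto simp: ent_one_fm)
    \<comment> \<open>The trace of the unit over \<open>U\<close> is r, nonzero in characteristic
      zero.\<close>
    then show "(\<Sum>u\<in>U. ent (one_fm n :: 'a fm) u u) \<noteq> 0" using r by (auto simp: U_def n_def)
  qed
  also have "lieind N (Inc fl0 :: 'a fm set) = gcd (card {..<a} + card {a..<m}) (card {a..<m} + card U)"
    unfolding fl0_def N_def using a r
    by (intro flag_index) (auto simp: disjoint3_def U_def n_def m_def)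
  also have "\<dots> = gcd (a + b) (b + r)" by (simp add: U_def n_def m_def)
  finally show ?thesis .
qed


text \<open>\<open>V\<close> is a line on which \<open>A\<close> acts by twice its entry at
  \<open>(m, m)\<close>, so a functional nonzero on the line is stabilized exactly when this entry
  is 0.\<close>

lemma reduction_1:
  fixes \<phi> :: "'a::field_char_0 fm \<Rightarrow> 'a"
  assumes r1: "r = 1" and \<phi>: "linf \<phi>" and p: "\<phi> (munit m n) \<noteq> 0"
  shows "fm.dim (rad Q (kform N \<phi>)) = fm.dim (rad S0 (kform N (\<lambda>A. \<phi> (dbl A))))"
proof -
  have idx: "n = Suc m" "N = 2 * m + 2" "U = {m}" "mir n = m" "mir m = n"
    unfolding mir_def N_def U_def n_def using r1 by auto
  have fl: "fl = fl0"
  proof (intro equalityI subrelI)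
    fix i j assume "(i, j) \<in> fl"
    then show "(i, j) \<in> fl0" unfolding fl0_iff fl_iff idx(1) by auto
  qed (simp add: fl0_iff)
  have rng: "i \<in> U \<and> n \<le> j \<and> j < N \<and> mir j \<in> U \<longleftrightarrow> i = m \<and> j = n" for i j
    unfolding idx(3) mir_def using idx(1,2) by auto
  have e1: "munit m n \<in> (V :: 'a fm set)"
  proof (rule V_I)
    show "i \<in> U \<and> n \<le> j \<and> j < N \<and> mir j \<in> U" if "ent (munit m n :: 'a fm) i j \<noteq> 0" for i j
      using that rng[of i j] by (simp add: ent_munit split: if_splits)
    show "ent (munit m n :: 'a fm) (mir j) (mir i) = ent (munit m n) i j"
      if "i \<in> U" "n \<le> j" "j < N" "mir j \<in> U" for i j
      using that rng[of i j] idx(4,5) by simp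
  qed
  have vform: "v = mscale (ent v m n) (munit m n)" if v: "v \<in> V" for v :: "'a fm"
  proof (rule fm_eqI)
    fix i j
    show "ent v i j = ent (mscale (ent v m n) (munit m n)) i j"
    proof (cases "i = m \<and> j = n")
      case False
      then have "ent v i j = 0" using V_ent[OF v, of i j] rng[of i j] by blast
      then show ?thesis using False by (auto simp: ent_munit)
    qed (simp add: ent_munit)
  qed
  have brv: "\<phi> (br N (dbl A) v) = 2 * ent A m m * ent v m n * \<phi> (munit m n)"
    if A: "A \<in> Inc fl" and v: "v \<in> V" for A v :: "'a fm"
  proof -
    have "br N (dbl A) v = mscale (2 * ent A m m * ent v m n) (munit m n)"
    proof (rule fm_eqI)
      fix i j
      show "ent (br N (dbl A) v) i j = ent (mscale (2 * ent A m m * ent v m n) (munit m n)) i j"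
        unfolding ent_br_dbl[OF A v] unfolding rng unfolding idx(3) using idx(4,5) by (simp add: ent_munit)
    qed
    then show ?thesis by (simp add: fmf.linear_scale[OF \<phi>])
  qed
  have "{A \<in> Inc fl. \<forall>v\<in>V. \<phi> (br N (dbl A) v) = 0} = (S0 :: 'a fm set)"
  proof (intro equalityI subsetI)
    fix A :: "'a fm" assume A: "A \<in> {A \<in> Inc fl. \<forall>v\<in>V. \<phi> (br N (dbl A) v) = 0}"
    then have "\<phi> (br N (dbl A) (munit m n)) = 0" using e1 by blast
    then show "A \<in> S0" using A brv[of A "munit m n"] e1 p by (simp add: S0_def idx fl ent_munit)
  next
    fix A :: "'a fm" assume "A \<in> S0"
    then show "A \<in> {A \<in> Inc fl. \<forall>v\<in>V. \<phi> (br N (dbl A) v) = 0}" using brv by (simp add: S0_def idx fl)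
  qed
  moreover have "fm.dim (rad Q (kform N \<phi>))
      = fm.dim (rad {A \<in> Inc fl. \<forall>v\<in>V. \<phi> (br N (dbl A) v) = 0} (kform N (\<lambda>A. \<phi> (dbl A))))"
  proof (rule dim_rad_Q[OF \<phi>])
    fix v :: "'a fm" assume v: "v \<in> V" and 0: "\<And>A. A \<in> Inc fl \<Longrightarrow> \<phi> (br N (dbl A) v) = 0"
    have m: "munit m m \<in> Inc fl" by (simp add: munit_Inc fl_def idx)
    have "ent v m n = 0" using brv[OF m v] 0[OF m] p by (simp add: ent_munit)
    then show "v = 0" using vform[OF v] by simp
  qed
  ultimately show ?thesis by simp
qed

text \<open>The block on \<open>U\<close> is a multiple of the traceless matrix with rows (1,
  \<sigma>) and (-\<tau>, -1): the orthogonal Lie algebra of a binary quadratic form, normalized by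
  its upper left entry.\<close>

definition SJ :: "'a::field \<Rightarrow> 'a \<Rightarrow> 'a fm set" where
  "SJ \<sigma> \<tau> = {A \<in> Inc fl. ent A m (Suc m) = \<sigma> * ent A m m \<and> ent A (Suc m) m = - \<tau> * ent A m m
    \<and> ent A (Suc m) (Suc m) = - ent A m m}"

text \<open>On \<open>V\<close> the functional is a binary quadratic form with middle coefficient
  \<open>p\<close> and outer coefficients \<open>q\<close> and \<open>s\<close>; its discriminant is
  p^2 - 4 q s. A nonzero discriminant gives nondegeneracy and trace zero, while \<open>p\<close>
  nonzero allows solving for the off-diagonal entries, which produces the parameters 2s/p and
  2q/p.\<close>

lemma reduction_2:
  fixes \<phi> :: "'a::field_char_0 fm \<Rightarrow> 'a"
  assumes r2: "r = 2" and \<phi>: "linf \<phi>"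
  defines "p \<equiv> \<phi> (munit m n + munit (Suc m) (Suc n))" and "q \<equiv> \<phi> (munit m (Suc n))" and "s \<equiv> \<phi> (munit (Suc m) n)"
  assumes p: "p \<noteq> 0" and pq: "p * p \<noteq> 4 * q * s"
  shows "fm.dim (rad Q (kform N \<phi>)) = fm.dim (rad (SJ (2 * s / p) (2 * q / p)) (kform N (\<lambda>A. \<phi> (dbl A))))"
proof -
  have idx: "n = Suc (Suc m)" "N = 2 * m + 4" "U = {m, Suc m}"
    unfolding N_def U_def n_def using r2 by auto
  have mirs: "mir n = Suc m" "mir (Suc n) = m" "mir m = Suc n" "mir (Suc m) = n"
    unfolding mir_def idx by auto
  \<comment> \<open>Reflection in the antidiagonal exchanges \<open>(m, n)\<close> with
    \<open>(Suc m, Suc n)\<close> and fixes the other two positions, so these three matrices span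
    \<open>V\<close>.\<close>
  let ?e1 = "munit m n + munit (Suc m) (Suc n) :: 'a fm" and ?e2 = "munit m (Suc n) :: 'a fm" and ?e3 = "munit (Suc m) n :: 'a fm"
  have rng: "i \<in> U \<and> n \<le> j \<and> j < N \<and> mir j \<in> U \<longleftrightarrow> (i = m \<or> i = Suc m) \<and> (j = n \<or> j = Suc n)" for i j
    unfolding mir_def idx by auto
  have VI: "X \<in> V" if X0: "\<And>i j. \<not> ((i = m \<or> i = Suc m) \<and> (j = n \<or> j = Suc n)) \<Longrightarrow> ent X i j = 0"
    and X1: "ent X m n = ent X (Suc m) (Suc n)" for X :: "'a fm"
  proof (rule V_I)
    fix i j assume "ent X i j \<noteq> 0"
    then have "(i = m \<or> i = Suc m) \<and> (j = n \<or> j = Suc n)" using X0 by blast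
    then show "i \<in> U \<and> n \<le> j \<and> j < N \<and> mir j \<in> U" using rng by blast
  next
    fix i j assume "i \<in> U" "n \<le> j" "j < N" "mir j \<in> U"
    then have "(i = m \<or> i = Suc m) \<and> (j = n \<or> j = Suc n)" using rng[of i j] by blast
    then show "ent X (mir j) (mir i) = ent X i j" by (elim conjE disjE) (simp_all add: mirs X1)
  qed
  have eV: "?e1 \<in> V" "?e2 \<in> V" "?e3 \<in> V"
    by (rule VI; auto simp: ent_munit)+
  have vform: "v = mscale (ent v m n) ?e1 + mscale (ent v m (Suc n)) ?e2 + mscale (ent v (Suc m) n) ?e3"
    and vsym: "ent v (Suc m) (Suc n) = ent v m n" if v: "v \<in> V" for v :: "'a fm"
  proof -
    have "ent v (mir n) (mir m) = ent v m n" 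
    proof -
      have "v \<in> Q" using v by (simp add: V_def)
      moreover have "m < n" "n \<le> n" "n < N" using idx(1,2) by auto
      ultimately show ?thesis unfolding Q_def by blast
    qed
    then show 1: "ent v (Suc m) (Suc n) = ent v m n" by (simp add: mirs)
    show "v = mscale (ent v m n) ?e1 + mscale (ent v m (Suc n)) ?e2 + mscale (ent v (Suc m) n) ?e3"
    proof (rule fm_eqI)
      fix i j
      show "ent v i j = ent (mscale (ent v m n) ?e1 + mscale (ent v m (Suc n)) ?e2 + mscale (ent v (Suc m) n) ?e3) i j"
      proof (cases "(i = m \<or> i = Suc m) \<and> (j = n \<or> j = Suc n)")
        case True
        then show ?thesis using 1 by (auto simp: ent_munit)
      next
        case False
        then have "ent v i j = 0" using V_ent[OF v, of i j] rng by blast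
        then show ?thesis using False by (auto simp: ent_munit)
      qed
    qed
  qed
  have brv: "\<phi> (br N (dbl A) v) =
      (ent v m n * (ent A m m + ent A (Suc m) (Suc m)) + ent A m (Suc m) * ent v (Suc m) n + ent A (Suc m) m * ent v m (Suc n)) * p
      + 2 * (ent A m m * ent v m (Suc n) + ent A m (Suc m) * ent v m n) * q
      + 2 * (ent A (Suc m) (Suc m) * ent v (Suc m) n + ent A (Suc m) m * ent v m n) * s"
    if A: "A \<in> Inc fl" and v: "v \<in> V" for A v :: "'a fm"
  proof -
    have "br N (dbl A) v = mscale (ent v m n * (ent A m m + ent A (Suc m) (Suc m)) + ent A m (Suc m) * ent v (Suc m) n + ent A (Suc m) m * ent v m (Suc n)) ?e1
      + mscale (2 * (ent A m m * ent v m (Suc n) + ent A m (Suc m) * ent v m n)) ?e2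
      + mscale (2 * (ent A (Suc m) (Suc m) * ent v (Suc m) n + ent A (Suc m) m * ent v m n)) ?e3" (is "_ = ?rhs")
    proof (rule fm_eqI)
      fix i j
      show "ent (br N (dbl A) v) i j = ent ?rhs i j"
      proof (cases "(i = m \<or> i = Suc m) \<and> (j = n \<or> j = Suc n)")
        case True
        then show ?thesis
          unfolding ent_br_dbl[OF A v] unfolding rng unfolding idx(3) using vsym[OF v] mirs
          by (auto simp: ent_munit algebra_simps)
      next
        case False
        then show ?thesis unfolding ent_br_dbl[OF A v] rng by (auto simp: ent_munit)
      qed
    qed
    then show ?thesis
      by (simp add: fmf.linear_add[OF \<phi>] fmf.linear_scale[OF \<phi>] p_def q_def s_def)
  qed
  have eqs: "(\<forall>v\<in>V. \<phi> (br N (dbl A) v) = 0) \<longleftrightarrow> A \<in> SJ (2 * s / p) (2 * q / p)" if A: "A \<in> Inc fl" for A :: "'a fm"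
  proof -
    let ?x = "ent A m m" and ?y = "ent A m (Suc m)" and ?z = "ent A (Suc m) m" and ?w = "ent A (Suc m) (Suc m)"
    have en: "ent ?e1 m n = 1" "ent ?e1 m (Suc n) = 0" "ent ?e1 (Suc m) n = 0"
      "ent ?e2 m n = 0" "ent ?e2 m (Suc n) = 1" "ent ?e2 (Suc m) n = 0"
      "ent ?e3 m n = 0" "ent ?e3 m (Suc n) = 0" "ent ?e3 (Suc m) n = 1"
      by (auto simp: ent_munit)
    have "(\<forall>v\<in>V. \<phi> (br N (dbl A) v) = 0) \<longleftrightarrow>
      (?x + ?w) * p + 2 * ?y * q + 2 * ?z * s = 0 \<and> ?z * p + 2 * ?x * q = 0 \<and> ?y * p + 2 * ?w * s = 0" (is "?l \<longleftrightarrow> ?c1 \<and> ?c2 \<and> ?c3")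
    proof
      assume l: ?l
      then show "?c1 \<and> ?c2 \<and> ?c3"
        using brv[OF A eV(1)] brv[OF A eV(2)] brv[OF A eV(3)] eV unfolding en by simp
    next
      assume c: "?c1 \<and> ?c2 \<and> ?c3"
      show ?l
      proof
        fix v :: "'a fm" assume v: "v \<in> V"
        have "\<phi> (br N (dbl A) v) = ent v m n * ((?x + ?w) * p + 2 * ?y * q + 2 * ?z * s)
          + ent v m (Suc n) * (?z * p + 2 * ?x * q) + ent v (Suc m) n * (?y * p + 2 * ?w * s)"
          unfolding brv[OF A v] by (simp add: algebra_simps)
        then show "\<phi> (br N (dbl A) v) = 0" using c by simp
      qed
    qed
    also have "\<dots> \<longleftrightarrow> ?y = 2 * s / p * ?x \<and> ?z = - (2 * q / p) * ?x \<and> ?w = - ?x" (is "?L \<longleftrightarrow> ?R")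
    proof
      assume c: ?L
      have z: "?z * p = - 2 * ?x * q" and y: "?y * p = - 2 * ?w * s" using c by (auto simp: eq_neg_iff_add_eq_0)
      \<comment> \<open>Multiplying by \<open>p\<close> lets both off-diagonal entries be
        eliminated; what remains is the trace times the discriminant.\<close>
      have "p * ((?x + ?w) * p + 2 * ?y * q + 2 * ?z * s) = 0" using c by simp
      then have "(?x + ?w) * (p * p) + 2 * (?y * p) * q + 2 * (?z * p) * s = 0" by (simp add: algebra_simps)
      then have "(?x + ?w) * (p * p - 4 * q * s) = 0" unfolding y z by (simp add: algebra_simps)
      then have "?x + ?w = 0" using pq by simp
      then have w: "?w = - ?x" by (simp add: eq_neg_iff_add_eq_0 add.commute)
      show ?R using p y z w by (simp add: field_simps)
    next
      assume R: ?R
      then have y: "?y * p = 2 * s * ?x" and z: "?z * p = - 2 * q * ?x" and w: "?w = - ?x" using p by simp_all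
      have "p * (2 * ?y * q + 2 * ?z * s) = 2 * (?y * p) * q + 2 * (?z * p) * s" by (simp add: algebra_simps)
      also have "\<dots> = 0" unfolding y z by (simp add: algebra_simps)
      finally have "2 * ?y * q + 2 * ?z * s = 0" using p by simp
      then show ?L unfolding y z w by (simp add: algebra_simps)
    qed
    finally show ?thesis using A by (simp add: SJ_def)
  qed
  have "fm.dim (rad Q (kform N \<phi>))
      = fm.dim (rad {A \<in> Inc fl. \<forall>v\<in>V. \<phi> (br N (dbl A) v) = 0} (kform N (\<lambda>A. \<phi> (dbl A))))"
  proof (rule dim_rad_Q[OF \<phi>])
    fix v :: "'a fm" assume v: "v \<in> V" and 0: "\<And>A. A \<in> Inc fl \<Longrightarrow> \<phi> (br N (dbl A) v) = 0"
    have mu: "munit i j \<in> (Inc fl :: 'a fm set)" if "i \<in> U" "j \<in> U" for i j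
      using that by (auto simp: munit_Inc fl_def)
    let ?s1 = "ent v m n" and ?s2 = "ent v m (Suc n)" and ?s3 = "ent v (Suc m) n"
    have "?s1 * p + 2 * ?s2 * q = 0" using brv[OF mu v, of m m] 0[OF mu, of m m] idx by (simp add: ent_munit)
    moreover have "?s3 * p + 2 * ?s1 * q = 0" using brv[OF mu v, of m "Suc m"] 0[OF mu, of m "Suc m"] idx by (simp add: ent_munit)
    moreover have "?s2 * p + 2 * ?s1 * s = 0" using brv[OF mu v, of "Suc m" m] 0[OF mu, of "Suc m" m] idx by (simp add: ent_munit)
    ultimately have c: "?s1 * p = - 2 * ?s2 * q" "?s3 * p = - 2 * ?s1 * q" "?s2 * p = - 2 * ?s1 * s"
      by (auto simp: eq_neg_iff_add_eq_0)
    have "?s1 * p * p = - 2 * (?s2 * p) * q" unfolding c(1) by simp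
    also have "\<dots> = ?s1 * (4 * q * s)" unfolding c(3) by simp
    finally have "?s1 * (p * p - 4 * q * s) = 0" by (simp add: algebra_simps)
    then have s1: "?s1 = 0" using pq by simp
    then have "?s2 = 0" "?s3 = 0" using c p by auto
    then show "v = 0" using vform[OF v] s1 by simp
  qed
  also have "{A \<in> Inc fl. \<forall>v\<in>V. \<phi> (br N (dbl A) v) = 0} = SJ (2 * s / p) (2 * q / p)"
    using eqs by (auto simp: SJ_def)
  finally show ?thesis .
qed

end

section \<open>Conjugation to the diagonal stabilizer\<close>

context two_part_seaweed
begin

text \<open>The unit matrix of size N with a 2 by 2 block inserted at the positions \<open>m\<close>
  and \<open>Suc m\<close>, which form \<open>U\<close> when r = 2.\<close>

definition gm :: "'a::field \<Rightarrow> 'a \<Rightarrow> 'a \<Rightarrow> 'a \<Rightarrow> 'a fm" where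
  "gm \<alpha> \<beta> \<gamma> \<delta> = Fm (\<lambda>i j. if i = m \<and> j = m then \<alpha> else if i = m \<and> j = Suc m then \<beta>
    else if i = Suc m \<and> j = m then \<gamma> else if i = Suc m \<and> j = Suc m then \<delta>
    else if i = j \<and> i < N then 1 else 0)"

lemma ent_gm: "ent (gm \<alpha> \<beta> \<gamma> \<delta>) i j = (if i = m \<and> j = m then \<alpha> else if i = m \<and> j = Suc m then \<beta>
    else if i = Suc m \<and> j = m then \<gamma> else if i = Suc m \<and> j = Suc m then \<delta>
    else if i = j \<and> i < N then 1 else 0)"
  by (simp add: gm_def)

lemma sum_two:
  fixes x y :: "'a::field"
  assumes "r = 2"
  shows "(\<Sum>k<N. if k = m then x else if k = Suc m then y else 0) = x + y"
proof -
  have "m < N" "Suc m < N" unfolding N_def n_def using assms by auto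
  have "(\<Sum>k<N. if k = m then x else if k = Suc m then y else 0)
      = (\<Sum>k<N. (if k = m then x else 0) + (if k = Suc m then y else 0))"
    by (rule sum.cong) auto
  then show ?thesis using \<open>m < N\<close> \<open>Suc m < N\<close> by (simp add: sum.distrib sum.delta')
qed

lemma mm_gm:
  assumes "r = 2"
  shows "ent (mm N (gm \<alpha> \<beta> \<gamma> \<delta>) X) i j = (if i = m then \<alpha> * ent X m j + \<beta> * ent X (Suc m) j
      else if i = Suc m then \<gamma> * ent X m j + \<delta> * ent X (Suc m) j else if i < N then ent X i j else 0)" (is ?l)
    and "ent (mm N X (gm \<alpha> \<beta> \<gamma> \<delta>)) i j = (if j = m then ent X i m * \<alpha> + ent X i (Suc m) * \<gamma>
      else if j = Suc m then ent X i m * \<beta> + ent X i (Suc m) * \<delta> else if j < N then ent X i j else 0)" (is ?r)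
proof -
  consider "i = m" | "i = Suc m" | "i \<noteq> m" "i \<noteq> Suc m" by blast
  then show ?l
  proof cases
    case 1
    have "ent (mm N (gm \<alpha> \<beta> \<gamma> \<delta>) X) i j
      = (\<Sum>k<N. if k = m then \<alpha> * ent X m j else if k = Suc m then \<beta> * ent X (Suc m) j else 0)"
      unfolding ent_mm 1 by (rule sum.cong) (auto simp: ent_gm)
    then show ?thesis unfolding sum_two[OF assms] using 1 by simp
  next
    case 2
    have "ent (mm N (gm \<alpha> \<beta> \<gamma> \<delta>) X) i j
      = (\<Sum>k<N. if k = m then \<gamma> * ent X m j else if k = Suc m then \<delta> * ent X (Suc m) j else 0)"
      unfolding ent_mm 2 by (rule sum.cong) (auto simp: ent_gm)
    then show ?thesis unfolding sum_two[OF assms] using 2 by simp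
  next
    case 3
    have "ent (mm N (gm \<alpha> \<beta> \<gamma> \<delta>) X) i j = (\<Sum>k<N. if k = i then ent X i j else 0)"
      unfolding ent_mm using 3 by (intro sum.cong) (auto simp: ent_gm)
    then show ?thesis using 3 by (simp add: sum.delta')
  qed
next
  consider "j = m" | "j = Suc m" | "j \<noteq> m" "j \<noteq> Suc m" by blast
  then show ?r
  proof cases
    case 1
    have "ent (mm N X (gm \<alpha> \<beta> \<gamma> \<delta>)) i j
      = (\<Sum>k<N. if k = m then ent X i m * \<alpha> else if k = Suc m then ent X i (Suc m) * \<gamma> else 0)"
      unfolding ent_mm 1 by (rule sum.cong) (auto simp: ent_gm)
    then show ?thesis unfolding sum_two[OF assms] using 1 by simp
  next
    case 2
    have "ent (mm N X (gm \<alpha> \<beta> \<gamma> \<delta>)) i j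
      = (\<Sum>k<N. if k = m then ent X i m * \<beta> else if k = Suc m then ent X i (Suc m) * \<delta> else 0)"
      unfolding ent_mm 2 by (rule sum.cong) (auto simp: ent_gm)
    then show ?thesis unfolding sum_two[OF assms] using 2 by simp
  next
    case 3
    have "ent (mm N X (gm \<alpha> \<beta> \<gamma> \<delta>)) i j = (\<Sum>k<N. if k = j then ent X i j else 0)"
      unfolding ent_mm using 3 by (intro sum.cong) (auto simp: ent_gm)
    then show ?thesis using 3 by (simp add: sum.delta')
  qed
qed

lemma gm_one:
  assumes "r = 2"
  shows "gm 1 0 0 1 = (one_fm N :: 'a::field fm)"
proof -
  have b: "m < N" "Suc m < N" unfolding N_def n_def using assms by auto
  show ?thesis
  proof (rule fm_eqI)
    fix i j
    consider "i = m" | "i = Suc m" | "i \<noteq> m" "i \<noteq> Suc m" by blast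
    then show "ent (gm 1 0 0 1) i j = ent (one_fm N :: 'a fm) i j"
      unfolding ent_gm ent_one_fm using b by cases simp_all
  qed
qed

lemma gm_mult:
  assumes "r = 2"
  shows "mm N (gm \<alpha> \<beta> \<gamma> \<delta>) (gm \<alpha>' \<beta>' \<gamma>' \<delta>')
    = gm (\<alpha> * \<alpha>' + \<beta> * \<gamma>') (\<alpha> * \<beta>' + \<beta> * \<delta>') (\<gamma> * \<alpha>' + \<delta> * \<gamma>') (\<gamma> * \<beta>' + \<delta> * \<delta>')"
  by (rule fm_eqI) (auto simp: mm_gm[OF assms] ent_gm)

text \<open>The rows \<open>m\<close> and \<open>Suc m\<close> have the same support in
  \<open>fl\<close>, and so have these two columns; mixing them preserves the shape.\<close>

lemma gm_fl:
  assumes r2: "r = 2" and X: "X \<in> Inc fl"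
  shows "mm N (gm \<alpha> \<beta> \<gamma> \<delta>) X \<in> Inc fl" "mm N X (gm \<alpha> \<beta> \<gamma> \<delta>) \<in> Inc fl"
proof -
  have idx: "n = Suc (Suc m)" "a \<le> m" unfolding n_def m_def using r2 by auto
  have 1: "(m, j) \<in> fl \<longleftrightarrow> (Suc m, j) \<in> fl" for j unfolding fl_iff idx(1) using idx(2) by auto
  have 2: "(i, m) \<in> fl \<longleftrightarrow> (i, Suc m) \<in> fl" for i unfolding fl_iff idx(1) using idx(2) by auto
  show "mm N (gm \<alpha> \<beta> \<gamma> \<delta>) X \<in> Inc fl"
  proof (rule IncI)
    fix i j assume ij: "(i, j) \<notin> fl"
    then have "i = m \<or> i = Suc m \<Longrightarrow> ent X m j = 0 \<and> ent X (Suc m) j = 0" "ent X i j = 0"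
      using IncD[OF X] 1 by blast+
    then show "ent (mm N (gm \<alpha> \<beta> \<gamma> \<delta>) X) i j = 0" by (simp add: mm_gm[OF r2])
  qed
  show "mm N X (gm \<alpha> \<beta> \<gamma> \<delta>) \<in> Inc fl"
  proof (rule IncI)
    fix i j assume ij: "(i, j) \<notin> fl"
    then have "j = m \<or> j = Suc m \<Longrightarrow> ent X i m = 0 \<and> ent X i (Suc m) = 0" "ent X i j = 0"
      using IncD[OF X] 2 by blast+
    then show "ent (mm N X (gm \<alpha> \<beta> \<gamma> \<delta>)) i j = 0" by (simp add: mm_gm[OF r2])
  qed
qed

text \<open>The matrix \<open>J = [[1, \<sigma>], [-\<tau>, -1]]\<close> has eigenvalues \<open>\<plusminus>\<mu>\<close>; the columns of
  \<open>[[1 + \<mu>, -\<sigma>], [-\<tau>, 1 + \<mu>]]\<close> are eigenvectors.\<close>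

lemma SJ_conjugate:
  fixes \<chi> :: "'a::field_char_0 fm \<Rightarrow> 'a"
  assumes r2: "r = 2" and \<chi>: "linf \<chi>" and \<mu>: "\<mu> * \<mu> = 1 - \<sigma> * \<tau>" "\<mu> \<noteq> 0" "1 + \<mu> \<noteq> 0"
  shows "lieind N (S0 :: 'a fm set) \<le> fm.dim (rad (SJ \<sigma> \<tau>) (kform N \<chi>))"
proof -
  \<comment> \<open>The inverse determinant of \<open>g\<close>: (1 + \<mu>)^2 - \<sigma> \<tau> = 2
    \<mu> (1 + \<mu>), because \<sigma> \<tau> = 1 - \<mu>^2. \<open>h\<close> is the adjugate block
    times \<open>c\<close>.\<close>
  define c where "c = 1 / (2 * \<mu> * (1 + \<mu>))"
  have c: "c * (2 * \<mu> * (1 + \<mu>)) = 1" unfolding c_def using \<mu> by simp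
  have st: "\<sigma> * \<tau> = 1 - \<mu> * \<mu>" using \<mu>(1) by simp
  define g where "g = gm (1 + \<mu>) (- \<sigma>) (- \<tau>) (1 + \<mu>)"
  define h where "h = gm (c * (1 + \<mu>)) (c * \<sigma>) (c * \<tau>) (c * (1 + \<mu>))"
  have one: "(1 + \<mu>) * (c * (1 + \<mu>)) + - \<sigma> * (c * \<tau>) = 1"
  proof -
    have "(1 + \<mu>) * (c * (1 + \<mu>)) + - \<sigma> * (c * \<tau>) = c * ((1 + \<mu>) * (1 + \<mu>) - \<sigma> * \<tau>)"
      by (simp add: algebra_simps)
    also have "\<dots> = c * (2 * \<mu> * (1 + \<mu>))" unfolding st by (simp add: algebra_simps)
    finally show ?thesis using c by simp
  qed
  have gh: "mm N g h = one_fm N" and hg: "mm N h g = one_fm N"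
  proof -
    have "(1 + \<mu>) * (c * \<sigma>) + - \<sigma> * (c * (1 + \<mu>)) = 0" "- \<tau> * (c * (1 + \<mu>)) + (1 + \<mu>) * (c * \<tau>) = 0"
      "- \<tau> * (c * \<sigma>) + (1 + \<mu>) * (c * (1 + \<mu>)) = 1" using one by (simp_all add: algebra_simps)
    then show "mm N g h = one_fm N" unfolding g_def h_def gm_mult[OF r2] gm_one[OF r2, symmetric] using one by simp
    have "c * (1 + \<mu>) * - \<sigma> + c * \<sigma> * (1 + \<mu>) = 0" "c * \<tau> * (1 + \<mu>) + c * (1 + \<mu>) * - \<tau> = 0"
      "c * \<tau> * - \<sigma> + c * (1 + \<mu>) * (1 + \<mu>) = 1" "c * (1 + \<mu>) * (1 + \<mu>) + c * \<sigma> * - \<tau> = 1"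
      using one by (simp_all add: algebra_simps)
    then show "mm N h g = one_fm N" unfolding g_def h_def gm_mult[OF r2] gm_one[OF r2, symmetric] by simp
  qed
  define \<theta> where "\<theta> A = mm N g (mm N A h)" for A
  define \<theta>' where "\<theta>' A = mm N h (mm N A g)" for A
  have sq: "Inc fl \<subseteq> Inc ({..<N} \<times> {..<N})" using fl_sub(1) nN(1) by (intro Inc_mono) auto
  have flcl: "\<theta> A \<in> Inc fl" "\<theta>' A \<in> Inc fl" if "A \<in> Inc fl" for A :: "'a fm"
    unfolding \<theta>_def \<theta>'_def g_def h_def
    by (rule gm_fl(1)[OF r2 gm_fl(2)[OF r2 that]])+
  have inv: "\<theta>' (\<theta> A) = A" "\<theta> (\<theta>' A) = A" if "A \<in> Inc fl" for A
  proof -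
    have A: "A \<in> Inc ({..<N} \<times> {..<N})" using that sq by blast
    have "\<theta>' (\<theta> A) = mm N (mm N h g) (mm N A (mm N h g))" by (simp add: \<theta>_def \<theta>'_def mm_assoc)
    then show "\<theta>' (\<theta> A) = A" by (simp add: hg mm_one[OF A])
    have "\<theta> (\<theta>' A) = mm N (mm N g h) (mm N A (mm N g h))" by (simp add: \<theta>_def \<theta>'_def mm_assoc)
    then show "\<theta> (\<theta>' A) = A" by (simp add: gh mm_one[OF A])
  qed
  have \<theta>mm: "\<theta> (mm N A B) = mm N (\<theta> A) (\<theta> B)" if "A \<in> Inc fl" "B \<in> Inc fl" for A B
  proof -
    have "mm N B h \<in> Inc ({..<N} \<times> {..<N})" using gm_fl(2)[OF r2 that(2)] sq unfolding h_def by blast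
    moreover have "mm N (\<theta> A) (\<theta> B) = mm N g (mm N A (mm N (mm N h g) (mm N B h)))"
      by (simp add: \<theta>_def mm_assoc)
    ultimately show ?thesis by (simp add: hg mm_one \<theta>_def mm_assoc)
  qed
  have lin\<theta>: "lin \<theta>" unfolding \<theta>_def by (rule linI) (simp_all add: mm_add mm_scale)
  have fl0I: "A \<in> Inc fl0 \<longleftrightarrow> A \<in> Inc fl \<and> ent A m (Suc m) = 0 \<and> ent A (Suc m) m = 0" for A :: "'a fm"
  proof -
    have "(i, j) \<in> fl0 \<longleftrightarrow> (i, j) \<in> fl \<and> (i, j) \<noteq> (m, Suc m) \<and> (i, j) \<noteq> (Suc m, m)" for i j
    proof -
      have idx: "n = Suc (Suc m)" "a \<le> m" unfolding n_def m_def using r2 by auto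
      show ?thesis unfolding fl0_iff fl_iff idx(1) using idx(2) by auto
    qed
    then show ?thesis unfolding Inc_def by blast
  qed
  have U: "U = {m, Suc m}" unfolding U_def n_def using r2 by auto
  have S0I: "A \<in> S0 \<longleftrightarrow> A \<in> Inc fl \<and> ent A m (Suc m) = 0 \<and> ent A (Suc m) m = 0 \<and> ent A (Suc m) (Suc m) = - ent A m m" for A :: "'a fm"
    unfolding S0_def fl0I by (auto simp: U eq_neg_iff_add_eq_0 add.commute)
  have sub1: "\<theta> A \<in> SJ \<sigma> \<tau>" if A: "A \<in> S0" for A :: "'a fm"
  proof -
    define x where "x = ent A m m"
    have e: "ent A m m = x" "ent A m (Suc m) = 0" "ent A (Suc m) m = 0" "ent A (Suc m) (Suc m) = - x" "A \<in> Inc fl"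
      using A unfolding S0I x_def by auto
    have "ent (\<theta> A) m m = x * c * ((1 + \<mu>) * (1 + \<mu>) + \<sigma> * \<tau>)"
      unfolding \<theta>_def g_def h_def mm_gm[OF r2] e by (simp add: algebra_simps)
    then have 1: "ent (\<theta> A) m m = 2 * x * c * (1 + \<mu>)"
      unfolding st by (simp add: algebra_simps)
    have 2: "ent (\<theta> A) m (Suc m) = \<sigma> * (2 * x * c * (1 + \<mu>))"
      unfolding \<theta>_def g_def h_def mm_gm[OF r2] e by (simp add: algebra_simps)
    have 3: "ent (\<theta> A) (Suc m) m = - \<tau> * (2 * x * c * (1 + \<mu>))"
      unfolding \<theta>_def g_def h_def mm_gm[OF r2] e by (simp add: algebra_simps)
    have "ent (\<theta> A) (Suc m) (Suc m) = - (x * c * ((1 + \<mu>) * (1 + \<mu>) + \<sigma> * \<tau>))"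
      unfolding \<theta>_def g_def h_def mm_gm[OF r2] e by (simp add: algebra_simps)
    then have 4: "ent (\<theta> A) (Suc m) (Suc m) = - (2 * x * c * (1 + \<mu>))"
      unfolding st by (simp add: algebra_simps)
    show ?thesis using flcl(1)[OF e(5)] 1 2 3 4 by (simp add: SJ_def)
  qed
  have sub2: "\<theta>' A \<in> S0" if A: "A \<in> SJ \<sigma> \<tau>" for A :: "'a fm"
  proof -
    define x where "x = ent A m m"
    have e: "ent A m m = x" "ent A m (Suc m) = \<sigma> * x" "ent A (Suc m) m = - \<tau> * x" "ent A (Suc m) (Suc m) = - x" "A \<in> Inc fl"
      using A unfolding SJ_def x_def by auto
    have "ent (\<theta>' A) m (Suc m) = c * \<sigma> * x * ((1 + \<mu>) * \<mu> + \<sigma> * \<tau> - (1 + \<mu>))"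
      unfolding \<theta>'_def g_def h_def mm_gm[OF r2] e by (simp add: algebra_simps)
    then have 2: "ent (\<theta>' A) m (Suc m) = 0" unfolding st by (simp add: algebra_simps)
    have "ent (\<theta>' A) (Suc m) m = c * \<tau> * x * ((1 + \<mu>) - (1 + \<mu>) * \<mu> - \<sigma> * \<tau>)"
      unfolding \<theta>'_def g_def h_def mm_gm[OF r2] e by (simp add: algebra_simps)
    then have 3: "ent (\<theta>' A) (Suc m) m = 0" unfolding st by (simp add: algebra_simps)
    have 4: "ent (\<theta>' A) (Suc m) (Suc m) = - ent (\<theta>' A) m m"
      unfolding \<theta>'_def g_def h_def mm_gm[OF r2] e by (simp add: algebra_simps)
    show ?thesis unfolding S0I using flcl(2)[OF e(5)] 2 3 4 by simp
  qed
  have S0fl: "A \<in> S0 \<Longrightarrow> A \<in> Inc fl" for A :: "'a fm" by (simp add: S0I)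
  have SJfl: "A \<in> SJ \<sigma> \<tau> \<Longrightarrow> A \<in> Inc fl" for A :: "'a fm" by (simp add: SJ_def)
  have img: "\<theta> ` S0 = SJ \<sigma> \<tau>"
  proof (intro equalityI subsetI)
    fix A assume A: "A \<in> SJ \<sigma> \<tau>"
    have "A = \<theta> (\<theta>' A)" using inv(2)[OF SJfl[OF A]] ..
    then show "A \<in> \<theta> ` S0" using sub2[OF A] by (rule image_eqI)
  qed (use sub1 in auto)
  have subS0: "fm.subspace (S0 :: 'a fm set)"
    using subspace_Inc[of fl] unfolding fm.subspace_def by (auto simp: S0I)
  have l: "linf (\<lambda>A. \<chi> (\<theta> A))" by (rule linf_compose[OF lin\<theta> \<chi>])
  have "fm.dim (rad (\<theta> ` S0) (kform N \<chi>)) = fm.dim (rad S0 (kform N (\<lambda>A. \<chi> (\<theta> A))))"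
  proof (rule rad_image[OF lin\<theta> subS0 _ bilin_kform[OF l], where s = 1])
    show "inj_on \<theta> S0" by (rule inj_on_inverseI[of _ \<theta>']) (use inv(1) S0fl in blast)
    show "kform N (\<lambda>A. \<chi> (\<theta> A)) x y = 1 * kform N \<chi> (\<theta> x) (\<theta> y)" if "x \<in> S0" "y \<in> S0" for x y
      using \<theta>mm[OF S0fl[OF that(1)] S0fl[OF that(2)]] \<theta>mm[OF S0fl[OF that(2)] S0fl[OF that(1)]]
      by (simp add: kform_def br_def fmp.linear_diff[OF lin\<theta>])
  qed simp
  then show ?thesis unfolding img using lieind_le[OF l, of N S0] by simp
qed

text \<open>\<open>\<phi>s\<close> reads the entry \<open>(m, n)\<close>; as a form it is
  nondegenerate, for r = 2 with p = 1 and q = s = 0. So on every line through it the conditions for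
  the reduction amount to a polynomial in \<open>u\<close> being nonzero, with value 1 at u =
  0.\<close>

lemma generic_Q:
  fixes \<phi> \<phi>s :: "'a::{alg_closed_field, field_char_0} fm \<Rightarrow> 'a"
  assumes \<phi>: "linf \<phi>" and \<phi>s: "linf \<phi>s" "\<And>X. \<phi>s X = ent X m n"
  shows "finite {u. \<not> lieind N (S0 :: 'a fm set) \<le> fm.dim (rad Q (kform N (\<lambda>X. \<phi>s X + u * (\<phi> X - \<phi>s X))))}"
proof -
  let ?\<psi> = "\<lambda>u X. \<phi>s X + u * (\<phi> X - \<phi>s X)"
  have l: "linf (?\<psi> u)" for u by (intro linf_add linf_cmult linf_diff \<phi> \<phi>s(1))
  from r show ?thesis
  proof
    assume r1: "r = 1"
    let ?f = "[:1, \<phi> (munit m n) - 1:] :: 'a poly"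
    have ev: "poly ?f u = ?\<psi> u (munit m n)" for u by (simp add: \<phi>s(2) ent_munit)
    have "lieind N (S0 :: 'a fm set) \<le> fm.dim (rad Q (kform N (?\<psi> u)))" if "poly ?f u \<noteq> 0" for u
      using reduction_1[OF r1 l, of u] that lieind_le[OF linf_compose[OF lin_dbl l], of N S0 u] unfolding ev by simp
    then have "{u. \<not> lieind N (S0 :: 'a fm set) \<le> fm.dim (rad Q (kform N (?\<psi> u)))} \<subseteq> {u. poly ?f u = 0}" by blast
    moreover have "finite {u. poly ?f u = 0}" by (rule poly_roots_finite) simp
    ultimately show ?thesis by (rule finite_subset)
  next
    assume r2: "r = 2"
    let ?e1 = "munit m n + munit (Suc m) (Suc n) :: 'a fm" and ?e2 = "munit m (Suc n) :: 'a fm" and ?e3 = "munit (Suc m) n :: 'a fm"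
    let ?f = "[:1, \<phi> ?e1 - 1:]" and ?g = "[:0, \<phi> ?e2:]" and ?h = "[:0, \<phi> ?e3:]"
    let ?F = "?f * (?f * ?f - 4 * ?g * ?h)"
    have ev: "poly ?f u = ?\<psi> u ?e1" "poly ?g u = ?\<psi> u ?e2" "poly ?h u = ?\<psi> u ?e3" for u
      by (simp_all add: \<phi>s(2) ent_munit)
    have four: "poly 4 u = 4" for u :: 'a by (metis of_nat_numeral poly_of_nat)
    have "lieind N (S0 :: 'a fm set) \<le> fm.dim (rad Q (kform N (?\<psi> u)))" if u: "poly ?F u \<noteq> 0" for u
    proof -
      define p where "p = ?\<psi> u ?e1"
      define q where "q = ?\<psi> u ?e2"
      define s where "s = ?\<psi> u ?e3"
      have "poly ?F u = p * (p * p - 4 * q * s)"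
        unfolding poly_mult poly_diff four ev p_def q_def s_def ..
      then have p: "p \<noteq> 0" and pq: "p * p \<noteq> 4 * q * s" using u by auto
      define \<sigma> where "\<sigma> = 2 * s / p"
      define \<tau> where "\<tau> = 2 * q / p"
      have ne: "1 - \<sigma> * \<tau> \<noteq> 0" unfolding \<sigma>_def \<tau>_def using p pq by (simp add: field_simps)
      \<comment> \<open>The square root that diagonalizes the stabilizer. Should it be -1, then 1 is
        a root as well, and 1 + 1 is nonzero.\<close>
      obtain \<mu>0 where "\<mu>0 ^ 2 = 1 - \<sigma> * \<tau>" using nth_root_exists[of 2 "1 - \<sigma> * \<tau>"] by auto
      then have \<mu>0: "\<mu>0 * \<mu>0 = 1 - \<sigma> * \<tau>" by (simp add: power2_eq_square)
      have "\<exists>\<mu>. \<mu> * \<mu> = 1 - \<sigma> * \<tau> \<and> 1 + \<mu> \<noteq> 0"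
      proof (cases "1 + \<mu>0 = 0")
        case True
        then have "\<mu>0 = - 1" by (simp add: eq_neg_iff_add_eq_0 add.commute)
        then have "1 * 1 = 1 - \<sigma> * \<tau>" using \<mu>0 by simp
        moreover have "1 + 1 \<noteq> (0 :: 'a)" by simp
        ultimately show ?thesis by blast
      qed (use \<mu>0 in blast)
      then obtain \<mu> where \<mu>: "\<mu> * \<mu> = 1 - \<sigma> * \<tau>" "1 + \<mu> \<noteq> 0" by blast
      then have "\<mu> \<noteq> 0" using ne by auto
      have "fm.dim (rad Q (kform N (?\<psi> u))) = fm.dim (rad (SJ \<sigma> \<tau>) (kform N (\<lambda>A. ?\<psi> u (dbl A))))"
        unfolding \<sigma>_def \<tau>_def p_def q_def s_def
        by (rule reduction_2[OF r2 l p[unfolded p_def] pq[unfolded p_def q_def s_def]])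
      then show ?thesis
        using SJ_conjugate[OF r2 linf_compose[OF lin_dbl l] \<mu>(1) \<open>\<mu> \<noteq> 0\<close> \<mu>(2), of u] by simp
    qed
    then have "{u. \<not> lieind N (S0 :: 'a fm set) \<le> fm.dim (rad Q (kform N (?\<psi> u)))} \<subseteq> {u. poly ?F u = 0}" by blast
    moreover have "finite {u. poly ?F u = 0}"
    proof (rule poly_roots_finite)
      have "poly ?F 0 = 1" unfolding poly_mult poly_diff four by simp
      then show "?F \<noteq> 0" by auto
    qed
    ultimately show ?thesis by (rule finite_subset)
  qed
qed

theorem lieind_Q: "lieind N (Q :: 'a::{alg_closed_field, field_char_0} fm set) = gcd (a + b) (b + r) - 1"
proof -
  define \<phi>s :: "'a fm \<Rightarrow> 'a" where "\<phi>s X = ent X m n" for X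
  have ls: "linf \<phi>s" unfolding \<phi>s_def by (rule linf_ent)
  obtain \<psi> :: "'a fm \<Rightarrow> 'a" where \<psi>: "linf \<psi>" "fm.dim (rad S0 (kform N \<psi>)) = lieind N (S0 :: 'a fm set)"
    using lieind_attained .
  \<comment> \<open>For the upper bound: on forms this is \<open>\<phi>s\<close>, whose stabilizer
    is \<open>S0\<close> without conjugation (\<sigma> = \<tau> = 0), and through \<open>dbl\<close>
    it agrees with the minimizing \<open>\<psi>\<close> on brackets of \<open>S0\<close>.\<close>
  define \<phi> where "\<phi> X = \<psi> (mask ({..<n} \<times> {..<n}) X) + \<phi>s X" for X
  have l\<phi>: "linf \<phi>" unfolding \<phi>_def by (intro linf_add linf_compose[OF lin_mask \<psi>(1)] ls)
  have "lieind N (Q :: 'a fm set) = lieind N (S0 :: 'a fm set)"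
  proof (rule lieind_eqI[OF _ l\<phi>])
    fix \<chi> :: "'a fm \<Rightarrow> 'a" assume \<chi>: "linf \<chi>"
    have "lieind N (S0 :: 'a fm set) \<le> fm.dim (rad Q (\<lambda>x y. kform N \<phi>s x y + 1 * kform N (\<lambda>X. \<chi> X - \<phi>s X) x y))"
    proof (rule rad_semicontinuous[OF fd_Q])
      show "finite {u. \<not> lieind N (S0 :: 'a fm set) \<le> fm.dim (rad Q (\<lambda>x y. kform N \<phi>s x y + u * kform N (\<lambda>X. \<chi> X - \<phi>s X) x y))}"
        using generic_Q[OF \<chi> ls \<phi>s_def] unfolding kform_def .
    qed (intro bilin_kform ls linf_diff \<chi>)+
    then show "lieind N (S0 :: 'a fm set) \<le> fm.dim (rad Q (kform N \<chi>))" by (simp add: kform_def)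
  next
    have m0: "mask ({..<n} \<times> {..<n}) (munit i j) = (0 :: 'a fm)" if "n \<le> j" for i j
      using that by (auto simp: fm_eq_iff ent_mask ent_munit)
    have \<phi>m: "\<phi> (munit i j) = (if i = m \<and> j = n then 1 else 0)" if "n \<le> j" for i j
      using fmf.linear_0[OF \<psi>(1)] by (simp add: \<phi>_def \<phi>s_def m0[OF that] ent_munit)
    have eq: "fm.dim (rad Q (kform N \<phi>)) = fm.dim (rad S0 (kform N (\<lambda>A. \<phi> (dbl A))))"
      using r
    proof
      assume "r = 1"
      then show ?thesis by (rule reduction_1[OF _ l\<phi>]) (simp add: \<phi>m)
    next
      assume r2: "r = 2"
      have p: "\<phi> (munit m n + munit (Suc m) (Suc n)) = 1" "\<phi> (munit m (Suc n)) = 0" "\<phi> (munit (Suc m) n) = 0"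
        by (simp_all add: fmf.linear_add[OF l\<phi>] \<phi>m)
      have idx: "n = Suc (Suc m)" "a \<le> m" "U = {m, Suc m}" unfolding U_def n_def m_def using r2 by auto
      have "(i, j) \<in> fl0 \<longleftrightarrow> (i, j) \<in> fl \<and> (i, j) \<noteq> (m, Suc m) \<and> (i, j) \<noteq> (Suc m, m)" for i j
        unfolding fl0_iff fl_iff idx(1) using idx(2) by auto
      then have "A \<in> Inc fl0 \<longleftrightarrow> A \<in> Inc fl \<and> ent A m (Suc m) = 0 \<and> ent A (Suc m) m = 0" for A :: "'a fm"
        unfolding Inc_def by blast
      then have "SJ 0 0 = (S0 :: 'a fm set)"
        unfolding SJ_def S0_def by (auto simp: idx(3) eq_neg_iff_add_eq_0 add.commute)
      then show ?thesis using reduction_2[OF r2 l\<phi>] unfolding p by simp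
    qed
    have "\<phi> (dbl (br N x y)) = \<psi> (br N x y)" if "x \<in> S0" "y \<in> S0" for x y
    proof -
      have "x \<in> Inc ({..<n} \<times> {..<n})" "y \<in> Inc ({..<n} \<times> {..<n})"
        using that Inc_mono[of fl0 "{..<n} \<times> {..<n}"] fl_sub unfolding S0_def by blast+
      then have b: "br N x y \<in> Inc ({..<n} \<times> {..<n})" by (intro br_Inc) (auto simp: trans_def)
      have "mask ({..<n} \<times> {..<n}) (dbl (br N x y)) = br N x y"
        using IncD[OF b] by (auto simp: fm_eq_iff ent_mask ent_dbl)
      moreover have "ent (dbl (br N x y)) m n = 0" using r by (auto simp: ent_dbl n_def)
      ultimately show ?thesis by (simp add: \<phi>_def \<phi>s_def)
    qed
    then have "rad S0 (kform N (\<lambda>A. \<phi> (dbl A))) = rad S0 (kform N \<psi>)"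
      by (auto simp: rad_def kform_def)
    then show "fm.dim (rad Q (kform N \<phi>)) \<le> lieind N (S0 :: 'a fm set)" using eq \<psi>(2) by simp
  qed
  then show ?thesis by (simp add: lieind_S0)
qed

end

lemma subspace_mat_iff:
  "VectorSpace.subspace class_ring \<pp> (module_mat TYPE('a::field) N N) \<longleftrightarrow>
    \<pp> \<subseteq> carrier_mat N N \<and> 0\<^sub>m N N \<in> \<pp> \<and> (\<forall>X\<in>\<pp>. \<forall>Y\<in>\<pp>. X + Y \<in> \<pp>) \<and> (\<forall>c. \<forall>X\<in>\<pp>. c \<cdot>\<^sub>m X \<in> \<pp>)"
proof -
  interpret v: vectorspace class_ring "module_mat TYPE('a) N N" by (rule matrix_vs)
  show ?thesis
    unfolding VectorSpace.subspace_def submodule_def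
    using v.vectorspace_axioms v.module_axioms by (auto simp: module_mat_simps)
qed

subsection \<open>Root vectors and parabolic subalgebras of the symplectic Lie algebra\<close>

definition opp :: "nat \<Rightarrow> nat \<Rightarrow> nat" where
  "opp n i = 2 * n - 1 - i"

text \<open>The signs of the antidiagonal Gram matrix of the symplectic form.\<close>

definition eta :: "nat \<Rightarrow> nat \<Rightarrow> 'a::field" where
  "eta n i = (if i < n then 1 else - 1)"

lemma opp_eq_iff: "i < 2 * n \<Longrightarrow> j < 2 * n \<Longrightarrow> opp n i = j \<longleftrightarrow> i = opp n j"
  by (auto simp: opp_def)

lemma eq_opp_iff: "i < 2 * n \<Longrightarrow> j < 2 * n \<Longrightarrow> j = opp n i \<longleftrightarrow> i = opp n j"
  by (auto simp: opp_def)

lemma opp: "i < 2 * n \<Longrightarrow> opp n i < 2 * n" "i < 2 * n \<Longrightarrow> opp n (opp n i) = i"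
  "i < 2 * n \<Longrightarrow> opp n i \<noteq> i" "i < 2 * n \<Longrightarrow> j < 2 * n \<Longrightarrow> opp n i = opp n j \<longleftrightarrow> i = j"
  "i < 2 * n \<Longrightarrow> opp n i < n \<longleftrightarrow> n \<le> i"
  by (simp_all add: opp_def; presburger)+

lemma eta_simps [simp]: "eta n i * eta n i = (1 :: 'a::field)" "eta n i * (eta n i * x) = (x :: 'a)"
  by (auto simp: eta_def)

lemma eta_opp: "i < 2 * n \<Longrightarrow> eta n (opp n i) = - (eta n i :: 'a::field)"
  by (auto simp: eta_def opp_def)

lemma antitranspose_carrier: "A \<in> carrier_mat n n \<Longrightarrow> antitranspose A \<in> carrier_mat n n"
  by (simp add: antitranspose_def)

text \<open>The conditions on the four blocks are one relation, skewness for the symplectic form.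
  Closure under the bracket and under sums then needs no case distinction on blocks.\<close>

lemma sp_iff:
  "X \<in> (sp n :: 'a::field mat set) \<longleftrightarrow> X \<in> carrier_mat (2 * n) (2 * n) \<and>
    (\<forall>i<2*n. \<forall>j<2*n. X $$ (opp n j, opp n i) = - eta n i * eta n j * X $$ (i, j))" (is "?l \<longleftrightarrow> ?r")
proof
  assume ?l
  then obtain A B C where X: "X = four_block_mat A B C (- antitranspose A)"
    and c: "A \<in> carrier_mat n n" "B \<in> carrier_mat n n" "C \<in> carrier_mat n n"
    and BC: "B = antitranspose B" "C = antitranspose C" by (auto simp: sp_def)
  have at: "antitranspose Y $$ (i, j) = Y $$ (n - 1 - j, n - 1 - i)" if "Y \<in> carrier_mat n n" "i < n" "j < n" for Y :: "'a mat" and i j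
    using that by (simp add: antitranspose_def)
  have Xc: "X \<in> carrier_mat (2 * n) (2 * n)"
    using four_block_carrier_mat[OF c(1), of "- antitranspose A" n n B C] antitranspose_carrier[OF c(1)]
    unfolding X mult_2 by simp
  have "X $$ (opp n j, opp n i) = - eta n i * eta n j * X $$ (i, j)" if ij: "i < 2 * n" "j < 2 * n" for i j
  proof -
    have ent: "X $$ (p, q) = (if p < n then if q < n then A $$ (p, q) else B $$ (p, q - n)
      else if q < n then C $$ (p - n, q) else - A $$ (n - 1 - (q - n), n - 1 - (p - n)))" if "p < 2 * n" "q < 2 * n" for p q
    proof -
      have ac: "antitranspose A \<in> carrier_mat n n" using c(1) by (rule antitranspose_carrier)
      have "X $$ (p, q) = (if p < n then if q < n then A $$ (p, q) else B $$ (p, q - n)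
        else if q < n then C $$ (p - n, q) else (- antitranspose A) $$ (p - n, q - n))"
        unfolding X using c ac that by (simp add: index_mat_four_block(1))
      then show ?thesis using c(1) ac that at[OF c(1)] by auto
    qed
    have B: "B $$ (p, q) = B $$ (n - 1 - q, n - 1 - p)" if "p < n" "q < n" for p q
      using arg_cong[OF BC(1), of "\<lambda>Y. Y $$ (p, q)"] at[OF c(2) that] by simp
    have C: "C $$ (p, q) = C $$ (n - 1 - q, n - 1 - p)" if "p < n" "q < n" for p q
      using arg_cong[OF BC(2), of "\<lambda>Y. Y $$ (p, q)"] at[OF c(3) that] by simp
    note o = opp(1)[OF ij(1)] opp(1)[OF ij(2)]
    consider "i < n" "j < n" | "i < n" "n \<le> j" | "n \<le> i" "j < n" | "n \<le> i" "n \<le> j" by linarith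
    then show ?thesis
    proof cases
      case 1
      then have "n - 1 - (opp n i - n) = i" "n - 1 - (opp n j - n) = j" "\<not> opp n i < n" "\<not> opp n j < n"
        by (auto simp: opp_def)
      then show ?thesis using 1 ij o by (simp add: ent eta_def)
    next
      case 2
      then have "opp n i - n = n - 1 - i" "opp n j = n - 1 - (j - n)" "\<not> opp n i < n" "opp n j < n" "j - n < n"
        using ij by (auto simp: opp_def)
      then show ?thesis using 2 ij o B[of i "j - n"] by (simp add: ent eta_def)
    next
      case 3
      then have "opp n j - n = n - 1 - j" "opp n i = n - 1 - (i - n)" "\<not> opp n j < n" "opp n i < n" "i - n < n"
        using ij by (auto simp: opp_def)
      then show ?thesis using 3 ij o C[of "i - n" j] by (simp add: ent eta_def)
    next
      case 4
      then have "opp n j = n - 1 - (j - n)" "opp n i = n - 1 - (i - n)" "opp n j < n" "opp n i < n"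
        using ij by (auto simp: opp_def)
      then show ?thesis using 4 ij o by (simp add: ent eta_def)
    qed
  qed
  then show ?r using Xc by blast
next
  assume r: ?r
  define A where "A = mat n n (\<lambda>(i, j). X $$ (i, j))"
  define B where "B = mat n n (\<lambda>(i, j). X $$ (i, j + n))"
  define C where "C = mat n n (\<lambda>(i, j). X $$ (i + n, j))"
  have c: "A \<in> carrier_mat n n" "B \<in> carrier_mat n n" "C \<in> carrier_mat n n"
    by (auto simp: A_def B_def C_def)
  have s: "X $$ (opp n j, opp n i) = - eta n i * eta n j * X $$ (i, j)" if "i < 2 * n" "j < 2 * n" for i j
    using r that by blast
  have "B = antitranspose B"
  proof (rule eq_matI)
    fix i j assume "i < dim_row (antitranspose B)" "j < dim_col (antitranspose B)"
    then have ij: "i < n" "j < n" by (auto simp: antitranspose_def B_def)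
    have "opp n (j + n) = n - 1 - j" "opp n i = n - 1 - i + n" using ij by (auto simp: opp_def)
    then show "B $$ (i, j) = antitranspose B $$ (i, j)"
      using ij s[of i "j + n"] by (simp add: antitranspose_def B_def eta_def)
  qed (auto simp: antitranspose_def B_def)
  moreover have "C = antitranspose C"
  proof (rule eq_matI)
    fix i j assume "i < dim_row (antitranspose C)" "j < dim_col (antitranspose C)"
    then have ij: "i < n" "j < n" by (auto simp: antitranspose_def C_def)
    have "opp n j = n - 1 - j + n" "opp n (i + n) = n - 1 - i" using ij by (auto simp: opp_def)
    then show "C $$ (i, j) = antitranspose C $$ (i, j)"
      using ij s[of "i + n" j] by (simp add: antitranspose_def C_def eta_def)
  qed (auto simp: antitranspose_def C_def)
  moreover have "X = four_block_mat A B C (- antitranspose A)"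
  proof (rule eq_matI)
    fix i j assume "i < dim_row (four_block_mat A B C (- antitranspose A))" "j < dim_col (four_block_mat A B C (- antitranspose A))"
    then have ij: "i < 2 * n" "j < 2 * n" by (auto simp: antitranspose_def A_def)
    have "X $$ (i, j) = - X $$ (n - 1 - (j - n), n - 1 - (i - n))" if "n \<le> i" "n \<le> j"
    proof -
      have "n - 1 - (j - n) = opp n j" "n - 1 - (i - n) = opp n i" using that ij by (auto simp: opp_def)
      then show ?thesis using s[OF ij] that by (simp add: eta_def)
    qed
    then show "X $$ (i, j) = four_block_mat A B C (- antitranspose A) $$ (i, j)"
      using ij by (auto simp: index_mat_four_block(1) A_def B_def C_def antitranspose_def)
  qed (use r in \<open>auto simp: antitranspose_def A_def\<close>)
  ultimately show ?l using c unfolding sp_def by blast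
qed

lemma sp_carrier: "X \<in> sp n \<Longrightarrow> X \<in> carrier_mat (2 * n) (2 * n)"
  by (simp add: sp_iff)

lemma sp_entry: "X \<in> sp n \<Longrightarrow> i < 2 * n \<Longrightarrow> j < 2 * n \<Longrightarrow> X $$ (opp n j, opp n i) = - eta n i * eta n j * X $$ (i, j)"
  by (simp add: sp_iff)

lemma index_bracket:
  assumes "X \<in> carrier_mat N N" "Y \<in> carrier_mat N N" "i < N" "j < N"
  shows "lie_bracket X Y $$ (i, j) = (\<Sum>k<N. X $$ (i, k) * Y $$ (k, j)) - (\<Sum>k<N. Y $$ (i, k) * X $$ (k, j))"
  using assms unfolding lie_bracket_def by (simp add: scalar_prod_def lessThan_atLeast0)

lemma bracket_carrier: "X \<in> carrier_mat N N \<Longrightarrow> Y \<in> carrier_mat N N \<Longrightarrow> lie_bracket X Y \<in> carrier_mat N N"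
  unfolding lie_bracket_def by (rule minus_carrier_mat, rule mult_carrier_mat)

lemma sum_opp: "(\<Sum>k<2 * n. f (opp n k)) = (\<Sum>k<2 * n. f k)"
  by (rule sum.reindex_bij_witness[of _ "opp n" "opp n"]) (auto simp: opp)

lemma bracket_sp:
  assumes X: "X \<in> (sp n :: 'a::field mat set)" and Y: "Y \<in> sp n"
  shows "lie_bracket X Y \<in> sp n"
  unfolding sp_iff
proof (intro conjI allI impI)
  show "lie_bracket X Y \<in> carrier_mat (2 * n) (2 * n)" by (rule bracket_carrier[OF sp_carrier[OF X] sp_carrier[OF Y]])
  fix i j assume ij: "i < 2 * n" "j < 2 * n"
  have p: "(\<Sum>k<2 * n. X $$ (opp n j, k) * Y $$ (k, opp n i)) = eta n i * eta n j * (\<Sum>k<2 * n. Y $$ (i, k) * X $$ (k, j))"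
    if "X \<in> sp n" "Y \<in> sp n" for X Y :: "'a mat"
  proof -
    have "(\<Sum>k<2 * n. X $$ (opp n j, k) * Y $$ (k, opp n i)) = (\<Sum>k<2 * n. X $$ (opp n j, opp n k) * Y $$ (opp n k, opp n i))"
      by (rule sum_opp[symmetric])
    also have "\<dots> = (\<Sum>k<2 * n. eta n i * eta n j * (Y $$ (i, k) * X $$ (k, j)))"
    proof (rule sum.cong)
      fix k assume "k \<in> {..<2 * n}"
      then have k: "k < 2 * n" by simp
      show "X $$ (opp n j, opp n k) * Y $$ (opp n k, opp n i) = eta n i * eta n j * (Y $$ (i, k) * X $$ (k, j))"
        unfolding sp_entry[OF that(1) k ij(2)] sp_entry[OF that(2) ij(1) k]
        by (simp add: eta_def)
    qed simp
    finally show ?thesis by (simp add: sum_distrib_left)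
  qed
  show "lie_bracket X Y $$ (opp n j, opp n i) = - eta n i * eta n j * lie_bracket X Y $$ (i, j)"
    unfolding index_bracket[OF sp_carrier[OF X] sp_carrier[OF Y] ij]
      index_bracket[OF sp_carrier[OF X] sp_carrier[OF Y] opp(1)[OF ij(2)] opp(1)[OF ij(1)]]
      p[OF X Y] p[OF Y X] by (simp add: algebra_simps)
qed

lemma sp_add:
  assumes "X \<in> sp n" "Y \<in> (sp n :: 'a::field mat set)"
  shows "X + Y \<in> sp n"
proof -
  have d: "dim_row Y = 2 * n" "dim_col Y = 2 * n" "X + Y \<in> carrier_mat (2 * n) (2 * n)"
    using sp_carrier[OF assms(1)] sp_carrier[OF assms(2)] by auto
  show ?thesis unfolding sp_iff
    using d sp_entry[OF assms(1)] sp_entry[OF assms(2)] by (simp add: opp distrib_left)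
qed

lemma sp_smult:
  assumes "X \<in> (sp n :: 'a::field mat set)"
  shows "c \<cdot>\<^sub>m X \<in> sp n"
proof -
  have d: "dim_row X = 2 * n" "dim_col X = 2 * n" "c \<cdot>\<^sub>m X \<in> carrier_mat (2 * n) (2 * n)"
    using sp_carrier[OF assms] by auto
  show ?thesis unfolding sp_iff using d sp_entry[OF assms] by (simp add: opp mult.left_commute)
qed

lemma sp_zero: "0\<^sub>m (2 * n) (2 * n) \<in> (sp n :: 'a::field mat set)"
  unfolding sp_iff by (auto simp: opp)

text \<open>A root vector when \<open>i\<close> and \<open>j\<close> differ. For
  \<open>j = opp n i\<close> the two positions coincide and the terms add up to 2: this is a long
  root.\<close>

definition rv :: "nat \<Rightarrow> nat \<Rightarrow> nat \<Rightarrow> 'a::field mat" where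
  "rv n i j = mat (2 * n) (2 * n) (\<lambda>(p, q). (if p = i \<and> q = j then 1 else 0)
     - eta n i * eta n j * (if p = opp n j \<and> q = opp n i then 1 else 0))"

lemma index_rv: "p < 2 * n \<Longrightarrow> q < 2 * n \<Longrightarrow> rv n i j $$ (p, q) =
    (if p = i \<and> q = j then 1 else 0) - eta n i * eta n j * (if p = opp n j \<and> q = opp n i then 1 else 0)"
  by (simp add: rv_def)

lemma index_rv_0:
  assumes "p < 2 * n" "q < 2 * n" "\<not> (p = i \<and> q = j)" "\<not> (p = opp n j \<and> q = opp n i)"
  shows "rv n i j $$ (p, q) = 0"
  unfolding index_rv[OF assms(1,2)] if_not_P[OF assms(3)] if_not_P[OF assms(4)] by simp

lemma rv_carrier: "rv n i j \<in> carrier_mat (2 * n) (2 * n)"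
  by (simp add: rv_def)

lemma rv_sp:
  assumes ij: "i < 2 * n" "j < 2 * n"
  shows "rv n i j \<in> (sp n :: 'a::field mat set)"
  unfolding sp_iff
proof (intro conjI allI impI)
  fix p q assume pq: "p < 2 * n" "q < 2 * n"
  have 1: "opp n q = i \<and> opp n p = j \<longleftrightarrow> p = opp n j \<and> q = opp n i"
    using opp_eq_iff[OF pq(2) ij(1)] opp_eq_iff[OF pq(1) ij(2)] by blast
  have 2: "opp n q = opp n j \<and> opp n p = opp n i \<longleftrightarrow> p = i \<and> q = j"
    using opp(4)[OF pq(2) ij(2)] opp(4)[OF pq(1) ij(1)] by blast
  have e: "p = opp n j \<and> q = opp n i \<Longrightarrow> eta n p * eta n q = eta n i * (eta n j :: 'a)"
    using eta_opp[OF ij(1), where 'a = 'a] eta_opp[OF ij(2), where 'a = 'a] by (auto simp: mult.commute)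
  show "rv n i j $$ (opp n q, opp n p) = - eta n p * eta n q * (rv n i j $$ (p, q) :: 'a)"
  proof (cases "p = opp n j \<and> q = opp n i")
    case True
    then show ?thesis unfolding index_rv[OF pq] index_rv[OF opp(1)[OF pq(2)] opp(1)[OF pq(1)]] 1 2
      using e by (auto simp: algebra_simps)
  next
    case False
    then have f: "(if p = opp n j \<and> q = opp n i then 1 else 0) = (0 :: 'a)" by (rule if_not_P)
    show ?thesis unfolding index_rv[OF pq] index_rv[OF opp(1)[OF pq(2)] opp(1)[OF pq(1)]] 1 2 f
      by (cases "p = i \<and> q = j") auto
  qed
qed (simp add: rv_def)

lemma rv_opp:
  assumes ij: "i < 2 * n" "j < 2 * n"
  shows "rv n (opp n j) (opp n i) = (- eta n i * eta n j) \<cdot>\<^sub>m (rv n i j :: 'a::field mat)"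
proof -
  have "eta n i * eta n j * (eta n i * eta n j) = (1 :: 'a)" by (simp add: eta_def)
  then show ?thesis by (intro eq_matI) (use ij in \<open>auto simp: rv_def opp eta_opp\<close>)
qed

text \<open>Integral entries, so that eigenvalues are compared in the integers; characteristic zero
  carries the comparison to the field.\<close>

definition cartan_elt :: "nat \<Rightarrow> (nat \<Rightarrow> int) \<Rightarrow> 'a::field mat" where
  "cartan_elt n h = mat (2 * n) (2 * n) (\<lambda>(p, q). if p = q then of_int (h p) else 0)"

lemma cartan_elt:
  assumes "\<And>k. k < 2 * n \<Longrightarrow> h (opp n k) = - h k"
  shows "cartan_elt n h \<in> (sp_cartan n :: 'a::field mat set)"
proof -
  have "cartan_elt n h $$ (opp n j, opp n i) = - eta n i * eta n j * (cartan_elt n h $$ (i, j) :: 'a)"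
    if "i < 2 * n" "j < 2 * n" for i j
    using that assms[OF that(1)] by (auto simp: cartan_elt_def opp)
  moreover have "cartan_elt n h \<in> carrier_mat (2 * n) (2 * n)" by (simp add: cartan_elt_def)
  ultimately have "cartan_elt n h \<in> (sp n :: 'a mat set)" by (simp add: sp_iff)
  then show ?thesis by (auto simp: sp_cartan_def diagonal_mat_def cartan_elt_def)
qed

lemma bracket_cartan:
  assumes H: "H \<in> sp_cartan n" and X: "X \<in> carrier_mat (2 * n) (2 * n)" and pq: "p < 2 * n" "q < 2 * n"
  shows "lie_bracket H X $$ (p, q) = (H $$ (p, p) - H $$ (q, q)) * (X $$ (p, q) :: 'a::field)"
proof -
  have Hc: "H \<in> carrier_mat (2 * n) (2 * n)" and d: "\<And>i j. i < 2 * n \<Longrightarrow> j < 2 * n \<Longrightarrow> i \<noteq> j \<Longrightarrow> H $$ (i, j) = 0"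
    using H sp_carrier unfolding sp_cartan_def diagonal_mat_def by force+
  have "(\<Sum>k<2 * n. H $$ (p, k) * X $$ (k, q)) = (\<Sum>k<2 * n. if k = p then H $$ (p, p) * X $$ (p, q) else 0)"
    using d pq by (intro sum.cong) auto
  moreover have "(\<Sum>k<2 * n. X $$ (p, k) * H $$ (k, q)) = (\<Sum>k<2 * n. if k = q then X $$ (p, q) * H $$ (q, q) else 0)"
    using d pq by (intro sum.cong) auto
  ultimately show ?thesis
    unfolding index_bracket[OF Hc X pq] using pq by (simp add: sum.delta' algebra_simps)
qed

text \<open>The values 1 and -3, with -1 and 3 at the mirror positions, have difference 4 only for
  \<open>(i, j)\<close> and its mirror image. For \<open>j = opp n i\<close> they add up to 4 and
  -4, and the difference 8 occurs once.\<close>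

definition wt :: "nat \<Rightarrow> nat \<Rightarrow> nat \<Rightarrow> nat \<Rightarrow> int" where
  "wt n i j k = (if k = i then 1 else 0) - 3 * (if k = j then 1 else 0)
    - (if k = opp n i then 1 else 0) + 3 * (if k = opp n j then 1 else 0)"

lemma wt_opp:
  assumes "i < 2 * n" "j < 2 * n" "k < 2 * n"
  shows "wt n i j (opp n k) = - wt n i j k"
proof -
  have "opp n k = i \<longleftrightarrow> k = opp n i" "opp n k = j \<longleftrightarrow> k = opp n j" using opp_eq_iff[OF assms(3,1)] opp_eq_iff[OF assms(3,2)] by blast+
  then show ?thesis using assms opp(4)[of k n i] opp(4)[of k n j] by (simp add: wt_def)
qed

text \<open>The element of the Cartan subalgebra given by \<open>wt\<close> separates the root of the position \<open>(i, j)\<close>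
  from all other roots.\<close>

lemma wt_unique:
  assumes ij: "i < 2 * n" "j < 2 * n" "i \<noteq> j" and pq: "p < 2 * n" "q < 2 * n"
    and eq: "wt n i j p - wt n i j q = wt n i j i - wt n i j j"
  shows "p = i \<and> q = j \<or> p = opp n j \<and> q = opp n i"
proof -
  have ne: "opp n i \<noteq> i" "opp n j \<noteq> j" "opp n i \<noteq> opp n j" using opp ij by auto
  show ?thesis
  proof (cases "j = opp n i")
    case True
    then have "opp n j = i" using opp ij by simp
    then show ?thesis using eq True ne unfolding wt_def by (auto split: if_splits)
  next
    case False
    then have "i \<noteq> opp n j" using opp ij by auto
    then have v: "wt n i j i = 1" "wt n i j j = - 3" "wt n i j (opp n i) = - 1" "wt n i j (opp n j) = 3"
      using False ne ij(3) unfolding wt_def by simp_all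
    have c: "(k = i \<and> wt n i j k = 1) \<or> (k = j \<and> wt n i j k = - 3) \<or> (k = opp n i \<and> wt n i j k = - 1)
      \<or> (k = opp n j \<and> wt n i j k = 3) \<or> wt n i j k = 0" for k
    proof -
      have "wt n i j k = 0" if "k \<noteq> i" "k \<noteq> j" "k \<noteq> opp n i" "k \<noteq> opp n j"
        using that by (simp add: wt_def)
      then show ?thesis using v by blast
    qed
    have "wt n i j p - wt n i j q = 4" using eq v by simp
    with c[of p] c[of q] show ?thesis by (elim disjE conjE) simp_all
  qed
qed

lemma lie_subalgebraD:
  assumes "lie_subalgebra (2 * n) (sp n) \<pp>"
  shows "X \<in> \<pp> \<Longrightarrow> X \<in> sp n" "0\<^sub>m (2 * n) (2 * n) \<in> \<pp>" "X \<in> \<pp> \<Longrightarrow> Y \<in> \<pp> \<Longrightarrow> X + Y \<in> \<pp>"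
    "X \<in> \<pp> \<Longrightarrow> c \<cdot>\<^sub>m X \<in> \<pp>" "X \<in> \<pp> \<Longrightarrow> Y \<in> \<pp> \<Longrightarrow> lie_bracket X Y \<in> \<pp>"
  using assms unfolding lie_subalgebra_def subspace_mat_iff by blast+

text \<open>Projection to a weight space by a polynomial in ad H: the product of ad H - \<mu> over
  all other weights \<mu> of the separating element \<open>H\<close> stays in the subalgebra,
  annihilates every entry except \<open>(i, j)\<close> and its mirror image, and multiplies these by
  a common nonzero constant.\<close>

lemma rv_in_subalgebra:
  fixes \<pp> :: "'a::field_char_0 mat set"
  assumes \<pp>: "lie_subalgebra (2 * n) (sp n) \<pp>" and h\<pp>: "sp_cartan n \<subseteq> \<pp>" and X: "X \<in> \<pp>"
    and ij: "i < 2 * n" "j < 2 * n" "i \<noteq> j" and ne: "X $$ (i, j) \<noteq> 0"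
  shows "rv n i j \<in> \<pp>"
proof -
  note D = lie_subalgebraD[OF \<pp>]
  let ?w = "wt n i j"
  define H :: "'a mat" where "H = cartan_elt n ?w"
  have H: "H \<in> sp_cartan n" unfolding H_def by (rule cartan_elt) (simp add: wt_opp ij)
  have Hd: "H $$ (k, k) = of_int (?w k)" if "k < 2 * n" for k using that by (simp add: H_def cartan_elt_def)
  have pow: "\<exists>Y\<in>\<pp>. \<forall>p<2 * n. \<forall>q<2 * n. Y $$ (p, q) = (\<Prod>\<mu>\<in>M. of_int (?w p - ?w q) - of_int \<mu>) * X $$ (p, q)"
    if "finite M" for M :: "int set"
    using that
  proof (induction M rule: finite_induct)
    case empty
    then show ?case using X by auto
  next
    case (insert \<mu> M)
    then obtain Y where Y: "Y \<in> \<pp>"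
      "\<And>p q. p < 2 * n \<Longrightarrow> q < 2 * n \<Longrightarrow> Y $$ (p, q) = (\<Prod>\<mu>\<in>M. of_int (?w p - ?w q) - of_int \<mu>) * X $$ (p, q)" by blast
    let ?Z = "lie_bracket H Y + (- of_int \<mu>) \<cdot>\<^sub>m Y"
    have Yc: "Y \<in> carrier_mat (2 * n) (2 * n)" by (rule sp_carrier[OF D(1)[OF Y(1)]])
    have "?Z \<in> \<pp>" using H h\<pp> by (intro D(3,4,5) Y(1)) auto
    moreover have "?Z $$ (p, q) = (\<Prod>\<mu>\<in>insert \<mu> M. of_int (?w p - ?w q) - of_int \<mu>) * X $$ (p, q)"
      if pq: "p < 2 * n" "q < 2 * n" for p q
    proof -
      have "?Z $$ (p, q) = (of_int (?w p - ?w q) - of_int \<mu>) * Y $$ (p, q)"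
        using pq Yc bracket_cartan[OF H Yc pq] by (simp add: Hd algebra_simps)
      then show ?thesis using insert.hyps unfolding Y(2)[OF pq] by simp
    qed
    ultimately show ?case by blast
  qed
  define l where "l = ?w i - ?w j"
  define M where "M = (\<lambda>(p, q). ?w p - ?w q) ` ({..<2 * n} \<times> {..<2 * n}) - {l}"
  have finM: "finite M" by (simp add: M_def)
  obtain Y where Y: "Y \<in> \<pp>"
    "\<And>p q. p < 2 * n \<Longrightarrow> q < 2 * n \<Longrightarrow> Y $$ (p, q) = (\<Prod>\<mu>\<in>M. of_int (?w p - ?w q) - of_int \<mu>) * X $$ (p, q)"
    using pow[OF finM] by blast
  define c :: 'a where "c = (\<Prod>\<mu>\<in>M. of_int l - of_int \<mu>)"
  have "c \<noteq> 0" using finM by (simp add: c_def M_def)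
  have Y0: "Y $$ (p, q) = 0" if pq: "p < 2 * n" "q < 2 * n" "?w p - ?w q \<noteq> l" for p q
  proof -
    have "?w p - ?w q \<in> M" using pq by (force simp: M_def)
    then have "(\<Prod>\<mu>\<in>M. of_int (?w p - ?w q) - (of_int \<mu> :: 'a)) = 0"
      using finM by (intro prod_zero bexI[of _ "?w p - ?w q"]) auto
    then show ?thesis using Y(2)[OF pq(1,2)] by simp
  qed
  have Yl: "Y $$ (p, q) = c * X $$ (p, q)" if "p < 2 * n" "q < 2 * n" "?w p - ?w q = l" for p q
    using Y(2)[OF that(1,2)] unfolding that(3) c_def .
  have Xs: "X \<in> sp n" by (rule D(1)[OF X])
  have o: "opp n i < 2 * n" "opp n j < 2 * n" using opp(1) ij by auto
  have lo: "?w (opp n j) - ?w (opp n i) = l" using ij by (simp add: wt_opp l_def)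
  \<comment> \<open>The entry of the root vector at its own position: 2 for a long root, 1
    otherwise.\<close>
  define t :: 'a where "t = (if j = opp n i then 2 else 1)"
  have "t \<noteq> 0" by (simp add: t_def)
  have jo: "j = opp n i \<longleftrightarrow> i = opp n j" by (rule eq_opp_iff[OF ij(1,2)])
  have rvij: "rv n i j $$ (i, j) = t"
    unfolding index_rv[OF ij(1,2)] t_def using jo eta_opp[OF ij(1), where 'a = 'a] by auto
  have "Y = (c * X $$ (i, j) / t) \<cdot>\<^sub>m rv n i j"
  proof (rule eq_matI)
    fix p q assume "p < dim_row ((c * X $$ (i, j) / t) \<cdot>\<^sub>m rv n i j)" "q < dim_col ((c * X $$ (i, j) / t) \<cdot>\<^sub>m rv n i j)"
    then have pq: "p < 2 * n" "q < 2 * n" by (auto simp: rv_def)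
    have r: "((c * X $$ (i, j) / t) \<cdot>\<^sub>m rv n i j) $$ (p, q) = (c * X $$ (i, j) / t) * rv n i j $$ (p, q)"
      using pq by (simp add: rv_def)
    consider "p = i" "q = j" | "p = opp n j" "q = opp n i" "\<not> (p = i \<and> q = j)"
      | "\<not> (p = i \<and> q = j)" "\<not> (p = opp n j \<and> q = opp n i)" by blast
    then show "Y $$ (p, q) = ((c * X $$ (i, j) / t) \<cdot>\<^sub>m rv n i j) $$ (p, q)"
    proof cases
      case 1
      then show ?thesis unfolding r using rvij Yl[OF pq] \<open>t \<noteq> 0\<close> by (simp add: l_def)
    next
      case 2
      then have "t = 1" using jo by (auto simp: t_def)
      moreover have "rv n i j $$ (p, q) = (- eta n i * eta n j :: 'a)" unfolding index_rv[OF pq] using 2 by simp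
      moreover have "Y $$ (p, q) = c * (- eta n i * eta n j * X $$ (i, j))"
        using Yl[OF pq] lo 2 sp_entry[OF Xs ij(1,2)] by simp
      ultimately show ?thesis unfolding r by simp
    next
      case 3
      then have "?w p - ?w q \<noteq> l" using wt_unique[OF ij pq] unfolding l_def by blast
      then show ?thesis unfolding r index_rv_0[OF pq 3] using Y0[OF pq] by simp
    qed
  qed (use sp_carrier[OF D(1)[OF Y(1)]] in \<open>auto simp: rv_def\<close>)
  moreover have "c * X $$ (i, j) / t \<noteq> 0" using \<open>c \<noteq> 0\<close> \<open>t \<noteq> 0\<close> ne by simp
  ultimately have "rv n i j = (1 / (c * X $$ (i, j) / t)) \<cdot>\<^sub>m Y"
    by (intro eq_matI) (simp_all add: rv_def)
  then show ?thesis using D(4)[OF Y(1), of "1 / (c * X $$ (i, j) / t)"] by simp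
qed

text \<open>Subtracting a multiple of a root vector clears an off-diagonal entry together with its
  mirror image and creates no other, so the induction ends in the Cartan subalgebra.\<close>

lemma subalgebra_by_support:
  fixes \<pp> :: "'a::field_char_0 mat set"
  assumes \<pp>: "lie_subalgebra (2 * n) (sp n) \<pp>" and h\<pp>: "sp_cartan n \<subseteq> \<pp>" and X: "X \<in> sp n"
    and sup: "\<And>i j. i < 2 * n \<Longrightarrow> j < 2 * n \<Longrightarrow> i \<noteq> j \<Longrightarrow> X $$ (i, j) \<noteq> 0 \<Longrightarrow> rv n i j \<in> \<pp>"
  shows "X \<in> \<pp>"
proof -
  note D = lie_subalgebraD[OF \<pp>]
  let ?N = "\<lambda>X :: 'a mat. {(p, q). p < 2 * n \<and> q < 2 * n \<and> p \<noteq> q \<and> X $$ (p, q) \<noteq> 0}"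
  have fin: "finite (?N X)" for X by (rule finite_subset[of _ "{..<2 * n} \<times> {..<2 * n}"]) auto
  show ?thesis using X sup
  proof (induction "card (?N X)" arbitrary: X rule: less_induct)
    case less
    show ?case
    proof (cases "?N X = {}")
      case True
      then have "X \<in> sp_cartan n"
        using less.prems(1) sp_carrier[OF less.prems(1)] unfolding sp_cartan_def diagonal_mat_def by auto
      then show ?thesis using h\<pp> by blast
    next
      case False
      then obtain i j where ij: "i < 2 * n" "j < 2 * n" "i \<noteq> j" "X $$ (i, j) \<noteq> 0" by blast
      have o: "opp n i < 2 * n" "opp n j < 2 * n" using opp(1) ij by auto
      define t :: 'a where "t = (if j = opp n i then 2 else 1)"
      have "t \<noteq> 0" by (simp add: t_def)
      have jo: "j = opp n i \<longleftrightarrow> i = opp n j" by (rule eq_opp_iff[OF ij(1,2)])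
      define k where "k = X $$ (i, j) / t"
      define Z where "Z = X + (- k) \<cdot>\<^sub>m rv n i j"
      have r: "rv n i j \<in> \<pp>" by (rule less.prems(2)[OF ij])
      have Zs: "Z \<in> sp n" unfolding Z_def by (intro sp_add sp_smult rv_sp less.prems(1) ij)
      have Zent: "Z $$ (p, q) = X $$ (p, q) - k * rv n i j $$ (p, q)" if "p < 2 * n" "q < 2 * n" for p q
        using that sp_carrier[OF less.prems(1)] by (simp add: Z_def rv_def)
      have rvij: "rv n i j $$ (i, j) = t"
        unfolding index_rv[OF ij(1,2)] t_def using jo eta_opp[OF ij(1), where 'a = 'a] by auto
      have z1: "Z $$ (i, j) = 0" using \<open>t \<noteq> 0\<close> by (simp add: Zent[OF ij(1,2)] rvij k_def)
      have sub: "?N Z \<subseteq> ?N X - {(i, j)}"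
      proof (rule subsetI, clarify)
        fix p q assume pq: "p < 2 * n" "q < 2 * n" "p \<noteq> q" "Z $$ (p, q) \<noteq> 0"
        have 1: "\<not> (p = i \<and> q = j)" using z1 pq by auto
        have "\<not> (p = opp n j \<and> q = opp n i)" using sp_entry[OF Zs ij(1,2)] z1 pq by auto
        then have "rv n i j $$ (p, q) = (0 :: 'a)" by (rule index_rv_0[OF pq(1,2) 1])
        then have "X $$ (p, q) \<noteq> 0" using pq Zent[OF pq(1,2)] by simp
        then show "(p, q) \<in> ?N X - {(i, j)}" using pq 1 by auto
      qed
      have "card (?N Z) < card (?N X)"
      proof (rule psubset_card_mono[OF fin])
        have "(i, j) \<in> ?N X" using ij by simp
        then show "?N Z \<subset> ?N X" using sub by blast
      qed
      moreover have "rv n p q \<in> \<pp>" if "p < 2 * n" "q < 2 * n" "p \<noteq> q" "Z $$ (p, q) \<noteq> 0" for p q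
        using that sub by (intro less.prems(2)) blast+
      ultimately have "Z \<in> \<pp>" using less.hyps[OF _ Zs] by blast
      moreover have "X = Z + k \<cdot>\<^sub>m rv n i j"
        using sp_carrier[OF less.prems(1)] by (intro eq_matI) (auto simp: Z_def rv_def)
      ultimately show ?thesis using D(3)[OF _ D(4)[OF r]] by metis
    qed
  qed
qed

text \<open>The entry of the bracket at \<open>(i, k)\<close> is (1 + u)(1 + v) + w, where u, v, w
  in {0, 1} record coincidences with mirror positions. It is a positive integer, hence nonzero in
  characteristic zero, and \<open>rv_in_subalgebra\<close> applies.\<close>

lemma rv_trans:
  fixes \<pp> :: "'a::field_char_0 mat set"
  assumes \<pp>: "lie_subalgebra (2 * n) (sp n) \<pp>" and h\<pp>: "sp_cartan n \<subseteq> \<pp>"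
    and ijk: "i < 2 * n" "j < 2 * n" "k < 2 * n" "i \<noteq> j" "j \<noteq> k" "i \<noteq> k"
    and r: "rv n i j \<in> \<pp>" "rv n j k \<in> \<pp>"
  shows "rv n i k \<in> \<pp>"
proof (rule rv_in_subalgebra[OF \<pp> h\<pp> lie_subalgebraD(5)[OF \<pp> r] ijk(1,3,6)])
  have o: "opp n i < 2 * n" "opp n j < 2 * n" "opp n k < 2 * n" using opp(1) ijk by auto
  define u v w :: 'a where "u = (if i = opp n j then 1 else 0)" and "v = (if j = opp n k then 1 else 0)" and "w = (if i = opp n k then 1 else 0)"
  have jo: "i = opp n j \<longleftrightarrow> j = opp n i" "j = opp n k \<longleftrightarrow> k = opp n j" "i = opp n k \<longleftrightarrow> k = opp n i"
    using eq_opp_iff ijk by blast+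
  have e: "i = opp n j \<Longrightarrow> eta n i * eta n j = (- 1 :: 'a)" "j = opp n k \<Longrightarrow> eta n j * eta n k = (- 1 :: 'a)"
    "i = opp n k \<Longrightarrow> eta n i * eta n k = (- 1 :: 'a)"
    using eta_opp[OF ijk(2), where 'a = 'a] eta_opp[OF ijk(3), where 'a = 'a] by auto
  have ij: "rv n i j $$ (i, q) = (if q = j then 1 + u else 0 :: 'a)" if "q < 2 * n" for q
    unfolding index_rv[OF ijk(1) that] u_def using jo(1) e(1) by auto
  have jk: "rv n j k $$ (j, k) = (1 + v :: 'a)"
    unfolding index_rv[OF ijk(2,3)] v_def using jo(2) e(2) by auto
  have ik: "rv n j k $$ (i, q) = (if q = opp n j then - eta n j * eta n k * w else 0 :: 'a)" if "q < 2 * n" for q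
    unfolding index_rv[OF ijk(1) that] w_def using ijk(4) by auto
  have jj: "rv n i j $$ (opp n j, k) = (- eta n i * eta n j * w :: 'a)"
    unfolding index_rv[OF o(2) ijk(3)] w_def using ijk(5) jo(3) by auto
  have "(\<Sum>q<2 * n. rv n i j $$ (i, q) * rv n j k $$ (q, k)) = (\<Sum>q<2 * n. if q = j then (1 + u) * (1 + v) else 0)"
    by (intro sum.cong) (auto simp: ij jk)
  moreover have "(\<Sum>q<2 * n. rv n j k $$ (i, q) * rv n i j $$ (q, k)) = (\<Sum>q<2 * n. if q = opp n j then (eta n i * eta n k) * w * w else 0)"
    by (intro sum.cong) (auto simp: ik jj eta_def)
  ultimately have "lie_bracket (rv n i j) (rv n j k) $$ (i, k) = (1 + u) * (1 + v) - eta n i * eta n k * w * w"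
    unfolding index_bracket[OF rv_carrier rv_carrier ijk(1,3)] using ijk o by (simp add: sum.delta')
  also have "\<dots> = (1 + u) * (1 + v) + w" using e(3) by (auto simp: w_def)
  also have "\<dots> \<noteq> 0"
  proof -
    have "(1 + u) * (1 + v) + w = of_nat ((1 + (if i = opp n j then 1 else 0)) * (1 + (if j = opp n k then 1 else 0)) + (if i = opp n k then 1 else 0))"
      by (simp add: u_def v_def w_def)
    then show ?thesis by (simp only: of_nat_eq_0_iff) simp
  qed
  finally show "lie_bracket (rv n i j) (rv n j k) $$ (i, k) \<noteq> (0 :: 'a)" .
qed

section \<open>Subalgebras containing the Cartan subalgebra\<close>

definition supp_sp :: "nat \<Rightarrow> (nat \<times> nat) set \<Rightarrow> 'a::field mat set" where
  "supp_sp n R = {X \<in> sp n. \<forall>i<2 * n. \<forall>j<2 * n. X $$ (i, j) \<noteq> 0 \<longrightarrow> (i, j) \<in> R}"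

lemma subalgebra_eq_supp_sp:
  fixes \<pp> :: "'a::field_char_0 mat set"
  assumes \<pp>: "lie_subalgebra (2 * n) (sp n) \<pp>" "sp_cartan n \<subseteq> \<pp>"
    and R: "\<And>i. (i, i) \<in> R" "\<And>i j. i < 2 * n \<Longrightarrow> j < 2 * n \<Longrightarrow> i \<noteq> j \<Longrightarrow> rv n i j \<in> \<pp> \<longleftrightarrow> (i, j) \<in> R"
  shows "\<pp> = supp_sp n R"
proof (intro equalityI subsetI)
  fix X :: "'a mat" assume X: "X \<in> \<pp>"
  have "(i, j) \<in> R" if "i < 2 * n" "j < 2 * n" "X $$ (i, j) \<noteq> 0" for i j
    using rv_in_subalgebra[OF \<pp> X that(1,2) _ that(3)] R that by (cases "i = j") auto
  then show "X \<in> supp_sp n R" using lie_subalgebraD(1)[OF \<pp>(1) X] by (simp add: supp_sp_def)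
next
  fix X :: "'a mat" assume X: "X \<in> supp_sp n R"
  show "X \<in> \<pp>"
  proof (rule subalgebra_by_support[OF \<pp>])
    show "X \<in> sp n" using X by (simp add: supp_sp_def)
    show "rv n i j \<in> \<pp>" if "i < 2 * n" "j < 2 * n" "i \<noteq> j" "X $$ (i, j) \<noteq> 0" for i j
      using X R(2)[OF that(1-3)] that unfolding supp_sp_def by blast
  qed
qed

lemma supp_sp_subalgebra:
  assumes R: "\<And>i. (i, i) \<in> R" "\<And>i j k. (i, j) \<in> R \<Longrightarrow> (j, k) \<in> R \<Longrightarrow> (i, k) \<in> R"
  shows "lie_subalgebra (2 * n) (sp n) (supp_sp n R :: 'a::field mat set)" "sp_cartan n \<subseteq> (supp_sp n R :: 'a mat set)"
proof -
  have c: "X \<in> carrier_mat (2 * n) (2 * n)" if "X \<in> supp_sp n R" for X :: "'a mat"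
    using that sp_carrier by (auto simp: supp_sp_def)
  show "sp_cartan n \<subseteq> (supp_sp n R :: 'a mat set)"
  proof
    fix X :: "'a mat" assume X: "X \<in> sp_cartan n"
    then have "X \<in> sp n" "diagonal_mat X" by (auto simp: sp_cartan_def)
    then have "X $$ (i, j) = 0" if "i < 2 * n" "j < 2 * n" "i \<noteq> j" for i j
      using that sp_carrier[of X n] unfolding diagonal_mat_def by auto
    then have "(i, j) \<in> R" if "i < 2 * n" "j < 2 * n" "X $$ (i, j) \<noteq> 0" for i j
      using that R(1) by (cases "i = j") auto
    then show "X \<in> supp_sp n R" using \<open>X \<in> sp n\<close> unfolding supp_sp_def by blast
  qed
  show "lie_subalgebra (2 * n) (sp n) (supp_sp n R :: 'a mat set)"
    unfolding lie_subalgebra_def subspace_mat_iff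
  proof (intro conjI ballI allI subsetI)
    fix X Y :: "'a mat" and a assume X: "X \<in> supp_sp n R" and Y: "Y \<in> supp_sp n R"
    have Xs: "X \<in> sp n" "Y \<in> sp n" using X Y by (auto simp: supp_sp_def)
    have z: "X $$ (i, j) = 0" "Y $$ (i, j) = 0" if "i < 2 * n" "j < 2 * n" "(i, j) \<notin> R" for i j
      using X Y that unfolding supp_sp_def by blast+
    have "(X + Y) $$ (i, j) = 0" if "i < 2 * n" "j < 2 * n" "(i, j) \<notin> R" for i j
      using z[OF that] that c[OF X] c[OF Y] by simp
    then show "X + Y \<in> supp_sp n R" using sp_add[OF Xs] unfolding supp_sp_def by blast
    have "(a \<cdot>\<^sub>m X) $$ (i, j) = 0" if "i < 2 * n" "j < 2 * n" "(i, j) \<notin> R" for i j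
      using z[OF that] that c[OF X] by simp
    then show "a \<cdot>\<^sub>m X \<in> supp_sp n R" using sp_smult[OF Xs(1)] unfolding supp_sp_def by blast
    have "lie_bracket X Y $$ (i, j) = 0" if ij: "i < 2 * n" "j < 2 * n" "(i, j) \<notin> R" for i j
    proof -
      have "X $$ (i, k) * Y $$ (k, j) = 0 \<and> Y $$ (i, k) * X $$ (k, j) = 0" if k: "k < 2 * n" for k
      proof (cases "(i, k) \<in> R")
        case True
        then have "(k, j) \<notin> R" using R(2) ij(3) by blast
        then show ?thesis using z[OF k ij(2)] by simp
      qed (use z[OF ij(1) k] in simp)
      then have "(\<Sum>k<2 * n. X $$ (i, k) * Y $$ (k, j)) = 0" "(\<Sum>k<2 * n. Y $$ (i, k) * X $$ (k, j)) = 0"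
        by (intro sum.neutral ballI; simp)+
      then show ?thesis unfolding index_bracket[OF c[OF X] c[OF Y] ij(1,2)] by simp
    qed
    then show "lie_bracket X Y \<in> supp_sp n R" using bracket_sp[OF Xs] unfolding supp_sp_def by blast
  next
    show "0\<^sub>m (2 * n) (2 * n) \<in> (supp_sp n R :: 'a mat set)" using sp_zero by (simp add: supp_sp_def)
  qed (use c in \<open>auto simp: supp_sp_def\<close>)
qed

lemma rv_supp_sp:
  assumes R: "\<And>i j. i < 2 * n \<Longrightarrow> j < 2 * n \<Longrightarrow> (i, j) \<in> R \<Longrightarrow> (opp n j, opp n i) \<in> R"
    and ij: "i < 2 * n" "j < 2 * n" "i \<noteq> j"
  shows "rv n i j \<in> (supp_sp n R :: 'a::field_char_0 mat set) \<longleftrightarrow> (i, j) \<in> R"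
proof
  assume "rv n i j \<in> (supp_sp n R :: 'a mat set)"
  moreover have "rv n i j $$ (i, j) \<noteq> (0 :: 'a)"
    unfolding index_rv[OF ij(1,2)] using eq_opp_iff[OF ij(1,2)] eta_opp[OF ij(1), where 'a = 'a] by auto
  ultimately show "(i, j) \<in> R" using ij unfolding supp_sp_def by blast
next
  assume r: "(i, j) \<in> R"
  have "(p, q) \<in> R" if "p < 2 * n" "q < 2 * n" "rv n i j $$ (p, q) \<noteq> (0 :: 'a)" for p q
    using index_rv_0[OF that(1,2), of i j, where 'a = 'a] that(3) r R[OF ij(1,2) r] by blast
  then show "rv n i j \<in> (supp_sp n R :: 'a mat set)" using rv_sp[OF ij(1,2)] by (simp add: supp_sp_def)
qed

text \<open>An eigenvector of the separating Cartan element with this eigenvalue is supported at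
  \<open>(i, j)\<close> and its mirror position, so the root space is the line of
  \<open>rv n i j\<close>. This turns the sets of simple roots that define parabolics into
  statements on root vectors.\<close>

lemma root_space_subset_iff:
  fixes \<pp> :: "'a::field_char_0 mat set"
  assumes \<pp>: "lie_subalgebra (2 * n) (sp n) \<pp>" "sp_cartan n \<subseteq> \<pp>"
    and ij: "i < 2 * n" "j < 2 * n" "i \<noteq> j"
    and \<alpha>: "\<And>H. H \<in> sp_cartan n \<Longrightarrow> \<alpha> H = H $$ (i, i) - H $$ (j, j)"
  shows "root_space n \<alpha> \<subseteq> \<pp> \<longleftrightarrow> rv n i j \<in> \<pp>"
proof
  assume "root_space n \<alpha> \<subseteq> \<pp>"
  moreover have "rv n i j \<in> root_space n \<alpha>"
    unfolding root_space_def
  proof (intro CollectI conjI ballI)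
    fix H :: "'a mat" assume H: "H \<in> sp_cartan n"
    have Hs: "H \<in> sp n" using H by (simp add: sp_cartan_def)
    have Ho: "H $$ (opp n k, opp n k) = - H $$ (k, k)" if "k < 2 * n" for k
      using sp_entry[OF Hs that that] by simp
    show "lie_bracket H (rv n i j) = \<alpha> H \<cdot>\<^sub>m rv n i j"
    proof (rule eq_matI)
      fix p q assume "p < dim_row (\<alpha> H \<cdot>\<^sub>m rv n i j)" "q < dim_col (\<alpha> H \<cdot>\<^sub>m rv n i j)"
      then have pq: "p < 2 * n" "q < 2 * n" by (auto simp: rv_def)
      have r: "(\<alpha> H \<cdot>\<^sub>m rv n i j) $$ (p, q) = \<alpha> H * rv n i j $$ (p, q)" using pq by (simp add: rv_def)
      consider "p = i" "q = j" | "p = opp n j" "q = opp n i"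
        | "\<not> (p = i \<and> q = j)" "\<not> (p = opp n j \<and> q = opp n i)" by blast
      then have "(H $$ (p, p) - H $$ (q, q)) * rv n i j $$ (p, q) = (H $$ (i, i) - H $$ (j, j)) * rv n i j $$ (p, q)"
      proof cases
        case 2
        then show ?thesis using Ho[OF ij(1)] Ho[OF ij(2)] by simp
      next
        case 3
        then show ?thesis unfolding index_rv_0[OF pq 3] by simp
      qed simp
      then show "lie_bracket H (rv n i j) $$ (p, q) = (\<alpha> H \<cdot>\<^sub>m rv n i j) $$ (p, q)"
        unfolding r bracket_cartan[OF H rv_carrier pq] unfolding \<alpha>[OF H] .
    qed (use sp_carrier[OF Hs] in \<open>auto simp: rv_def lie_bracket_def\<close>)
  qed (rule rv_sp[OF ij(1,2)])
  ultimately show "rv n i j \<in> \<pp>" by blast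
next
  assume r: "rv n i j \<in> \<pp>"
  define H :: "'a mat" where "H = cartan_elt n (wt n i j)"
  have H: "H \<in> sp_cartan n" unfolding H_def by (rule cartan_elt) (simp add: wt_opp ij)
  have Hd: "H $$ (k, k) = of_int (wt n i j k)" if "k < 2 * n" for k using that by (simp add: H_def cartan_elt_def)
  have r': "rv n (opp n j) (opp n i) \<in> \<pp>"
    unfolding rv_opp[OF ij(1,2)] by (rule lie_subalgebraD(4)[OF \<pp>(1) r])
  show "root_space n \<alpha> \<subseteq> \<pp>"
  proof
    fix X assume X: "X \<in> root_space n \<alpha>"
    then have Xs: "X \<in> sp n" and XH: "lie_bracket H X = \<alpha> H \<cdot>\<^sub>m X" using H by (auto simp: root_space_def)
    show "X \<in> \<pp>"
    proof (rule subalgebra_by_support[OF \<pp> Xs])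
      fix p q assume pq: "p < 2 * n" "q < 2 * n" "p \<noteq> q" "X $$ (p, q) \<noteq> 0"
      have "lie_bracket H X $$ (p, q) = \<alpha> H * X $$ (p, q)" unfolding XH using pq sp_carrier[OF Xs] by simp
      then have "(H $$ (p, p) - H $$ (q, q)) * X $$ (p, q) = (H $$ (i, i) - H $$ (j, j)) * X $$ (p, q)"
        unfolding bracket_cartan[OF H sp_carrier[OF Xs] pq(1,2)] \<alpha>[OF H] .
      then have "H $$ (p, p) - H $$ (q, q) = H $$ (i, i) - H $$ (j, j)" using pq(4) by simp
      then have "(of_int (wt n i j p - wt n i j q) :: 'a) = of_int (wt n i j i - wt n i j j)"
        using Hd pq ij by simp
      then have "wt n i j p - wt n i j q = wt n i j i - wt n i j j" by (simp only: of_int_eq_iff)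
      then have "p = i \<and> q = j \<or> p = opp n j \<and> q = opp n i" by (rule wt_unique[OF ij pq(1,2)])
      then show "rv n p q \<in> \<pp>" using r r' by auto
    qed
  qed
qed

text \<open>The combinatorial core of the classification of standard parabolics: a step down from
  \<open>i\<close> to \<open>j\<close> yields all elementary steps between them and is composed of
  these. Transitivity is assumed for distinct indices only, as \<open>rv n i i\<close> is no root
  vector.\<close>

lemma relation_below_walls:
  fixes S :: "nat \<Rightarrow> nat \<Rightarrow> bool"
  assumes tr: "\<And>i j k. i < M \<Longrightarrow> j < M \<Longrightarrow> k < M \<Longrightarrow> i \<noteq> j \<Longrightarrow> j \<noteq> k \<Longrightarrow> i \<noteq> k \<Longrightarrow> S i j \<Longrightarrow> S j k \<Longrightarrow> S i k"
    and up: "\<And>i j. i < j \<Longrightarrow> j < M \<Longrightarrow> S i j"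
    and W: "\<And>k. Suc k < M \<Longrightarrow> S (Suc k) k \<longleftrightarrow> k \<notin> W"
    and ij: "i < M" "j < M" "i \<noteq> j"
  shows "S i j \<longleftrightarrow> (\<forall>k\<in>W. \<not> (j \<le> k \<and> k < i))"
proof (cases "i < j")
  case True
  then show ?thesis using up ij by auto
next
  case False
  then have ji: "j < i" using ij by simp
  show ?thesis
  proof
    assume S: "S i j"
    show "\<forall>k\<in>W. \<not> (j \<le> k \<and> k < i)"
    proof (intro ballI notI)
      fix k assume k: "k \<in> W" "j \<le> k \<and> k < i"
      have "S (Suc k) j"
      proof (cases "Suc k = i")
        case False
        then show ?thesis using k ij S up[of "Suc k" i] by (intro tr[of "Suc k" i j]) auto
      qed (use S in simp)
      then have "S (Suc k) k"
      proof (cases "j = k")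
        case False
        then show ?thesis using k ij \<open>S (Suc k) j\<close> up[of j k] by (intro tr[of "Suc k" j k]) auto
      qed simp
      then show False using W[of k] k ij by simp
    qed
  next
    assume "\<forall>k\<in>W. \<not> (j \<le> k \<and> k < i)"
    with ji ij(1) show "S i j"
    proof (induction i)
      case (Suc i)
      have s: "S (Suc i) i" using W[of i] Suc.prems by auto
      show ?case
      proof (cases "i = j")
        case False
        have "\<forall>k\<in>W. \<not> (j \<le> k \<and> k < i)" using Suc.prems(3) less_SucI by blast
        then have "S i j" using Suc.IH Suc.prems False by simp
        then show ?thesis using False Suc.prems s by (intro tr[of "Suc i" i j]) auto
      qed (use s in simp)
    qed simp
  qed
qed

section \<open>Simple roots, walls and standard parabolics\<close>

lemma simple_root_cartan:
  assumes "H \<in> sp_cartan n" "1 \<le> i" "i \<le> n"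
  shows "simple_root n i H = H $$ (i - 1, i - 1) - (H $$ (i, i) :: 'a::field)"
proof (cases "i < n")
  case True
  then show ?thesis by (simp add: simple_root_def diag_entry_def)
next
  case False
  then have i: "i = n" using assms by simp
  have H: "H \<in> sp n" using assms(1) by (simp add: sp_cartan_def)
  \<comment> \<open>The long root fits the same pattern: the entry at position \<open>n\<close> is
    minus the one at \<open>n - 1\<close>, so twice the latter is a difference of consecutive
    diagonal entries.\<close>
  have "opp n (n - 1) = n" using assms i by (simp add: opp_def)
  moreover have "n - 1 < 2 * n" using assms i by simp
  ultimately have "H $$ (n, n) = - H $$ (n - 1, n - 1)" using sp_entry[OF H, of "n - 1" "n - 1"] by simp
  then show ?thesis using i by (simp add: simple_root_def diag_entry_def)
qed

text \<open>Needed to recover the index set \<open>K\<close> from the set of roots. Roots are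
  functions on all matrices, so the test matrix may lie outside sp(2n).\<close>

lemma inj_simple_root: "inj_on (simple_root n :: nat \<Rightarrow> 'a::field_char_0 mat \<Rightarrow> 'a) {1..n}"
proof (rule inj_onI)
  have ne: "simple_root n i \<noteq> (simple_root n j :: 'a mat \<Rightarrow> 'a)" if "1 \<le> i" "i < j" "j \<le> n" for i j
  proof
    assume eq: "simple_root n i = (simple_root n j :: 'a mat \<Rightarrow> 'a)"
    define H :: "'a mat" where "H = mat (Suc n) (Suc n) (\<lambda>(p, q). if p = i - 1 then 1 else 0)"
    have "simple_root n i H = 1" using that by (auto simp: simple_root_def diag_entry_def H_def)
    moreover have "simple_root n j H = 0" using that by (auto simp: simple_root_def diag_entry_def H_def)
    ultimately show False using eq by simp
  qed
  fix i j assume "i \<in> {1..n}" "j \<in> {1..n}" "simple_root n i = (simple_root n j :: 'a mat \<Rightarrow> 'a)"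
  then show "i = j" using ne[of i j] ne[of j i] by (cases i j rule: linorder_cases) auto
qed

text \<open>A wall \<open>k\<close> separates the positions \<open>k\<close> and \<open>k + 1\<close> (counted from \<open>0\<close>); the simple root \<open>\<alpha>\<^sub>i\<close> gives
  the wall \<open>i - 1\<close> and its mirror image.\<close>

definition walls :: "nat \<Rightarrow> nat set \<Rightarrow> nat set" where
  "walls n K = (\<lambda>i. i - 1) ` K \<union> (\<lambda>i. 2 * n - 1 - i) ` K"

lemma walls_iff:
  assumes "K \<subseteq> {1..n}" "i \<in> {1..n}"
  shows "i - 1 \<in> walls n K \<longleftrightarrow> i \<in> K"
proof
  assume "i - 1 \<in> walls n K"
  then consider k where "k \<in> K" "i - 1 = k - 1" | k where "k \<in> K" "i - 1 = 2 * n - 1 - k"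
    unfolding walls_def by blast
  then show "i \<in> K"
  proof cases
    case 1
    then have "i = k" using assms by fastforce
    then show ?thesis using 1 by simp
  next
    case 2
    then have "k \<le> n" "1 \<le> k" using assms(1) by auto
    moreover have "1 \<le> i" "i \<le> n" using assms(2) by auto
    ultimately have "i = k" using 2(2) by arith
    then show ?thesis using 2 by simp
  qed
qed (auto simp: walls_def)

lemma walls_sym:
  assumes "K \<subseteq> {1..n}" "Suc k < 2 * n"
  shows "2 * n - 2 - k \<in> walls n K \<longleftrightarrow> k \<in> walls n K"
proof -
  have "2 * n - 2 - k \<in> walls n K" if k: "k \<in> walls n K" "Suc k < 2 * n" for k
  proof -
    from k(1) consider i where "i \<in> K" "k = i - 1" | i where "i \<in> K" "k = 2 * n - 1 - i"
      unfolding walls_def by blast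
    then show ?thesis
    proof cases
      case 1
      then have "1 \<le> i" "i \<le> n" using assms(1) by auto
      then have "2 * n - 2 - k = 2 * n - 1 - i" using 1(2) by arith
      then show ?thesis using 1 by (auto simp: walls_def)
    next
      case 2
      then have "1 \<le> i" "i \<le> n" using assms(1) by auto
      then have "2 * n - 2 - k = i - 1" using 2(2) by arith
      then show ?thesis using 2 by (auto simp: walls_def)
    qed
  qed
  note * = this
  have "2 * n - 2 - (2 * n - 2 - k) = k" "Suc (2 * n - 2 - k) < 2 * n" using assms(2) by arith+
  then show ?thesis using *[of k] *[of "2 * n - 2 - k"] assms(2) by metis
qed

lemma borel_subset:
  shows "\<pp> = supp_sp n R \<Longrightarrow> (\<And>i j. i \<le> j \<Longrightarrow> (i, j) \<in> R) \<Longrightarrow> sp_borel_plus n \<subseteq> (\<pp> :: 'a::field mat set)"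
    and "\<pp> = supp_sp n R \<Longrightarrow> (\<And>i j. j \<le> i \<Longrightarrow> (i, j) \<in> R) \<Longrightarrow> sp_borel_minus n \<subseteq> \<pp>"
proof -
  have gen: "H + U \<in> supp_sp n R" if H: "H \<in> sp_cartan n" and U: "U \<in> sp n"
    and z: "\<And>i j. i < 2 * n \<Longrightarrow> j < 2 * n \<Longrightarrow> (i, j) \<notin> R \<Longrightarrow> U $$ (i, j) = 0" and R: "\<And>i. (i, i) \<in> R" for H U :: "'a mat"
  proof -
    have Hs: "H \<in> sp n" "diagonal_mat H" using H by (auto simp: sp_cartan_def)
    have "(H + U) $$ (i, j) = 0" if ij: "i < 2 * n" "j < 2 * n" "(i, j) \<notin> R" for i j
    proof -
      have "i \<noteq> j" using ij R by auto
      then have "H $$ (i, j) = 0" using Hs sp_carrier[OF Hs(1)] ij unfolding diagonal_mat_def by auto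
      then show ?thesis using z[OF ij] ij sp_carrier[OF U] by simp
    qed
    then show ?thesis using sp_add[OF Hs(1) U] unfolding supp_sp_def by blast
  qed
  show "sp_borel_plus n \<subseteq> \<pp>" if "\<pp> = supp_sp n R" "\<And>i j. i \<le> j \<Longrightarrow> (i, j) \<in> R"
  proof
    fix X :: "'a mat" assume "X \<in> sp_borel_plus n"
    then obtain H U where X: "X = H + U" "H \<in> sp_cartan n" "U \<in> sp_upper n" by (auto simp: sp_borel_plus_def)
    show "X \<in> \<pp>" unfolding X(1) that(1)
    proof (rule gen[OF X(2)])
      show "U $$ (i, j) = 0" if "i < 2 * n" "j < 2 * n" "(i, j) \<notin> R" for i j
        using X(3) that \<open>\<And>i j. i \<le> j \<Longrightarrow> (i, j) \<in> R\<close>[of i j] unfolding sp_upper_def by force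
    qed (use X(3) that in \<open>auto simp: sp_upper_def\<close>)
  qed
  show "sp_borel_minus n \<subseteq> \<pp>" if "\<pp> = supp_sp n R" "\<And>i j. j \<le> i \<Longrightarrow> (i, j) \<in> R"
  proof
    fix X :: "'a mat" assume "X \<in> sp_borel_minus n"
    then obtain H U where X: "X = H + U" "H \<in> sp_cartan n" "U \<in> sp_lower n" by (auto simp: sp_borel_minus_def)
    show "X \<in> \<pp>" unfolding X(1) that(1)
    proof (rule gen[OF X(2)])
      show "U $$ (i, j) = 0" if "i < 2 * n" "j < 2 * n" "(i, j) \<notin> R" for i j
        using X(3) that \<open>\<And>i j. j \<le> i \<Longrightarrow> (i, j) \<in> R\<close>[of j i] unfolding sp_lower_def by force
    qed (use X(3) that in \<open>auto simp: sp_lower_def\<close>)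
  qed
qed

lemma subset_borel:
  fixes \<pp> :: "'a::field_char_0 mat set"
  assumes "lie_subalgebra (2 * n) (sp n) \<pp>"
  shows "sp_borel_plus n \<subseteq> \<pp> \<Longrightarrow> sp_cartan n \<subseteq> \<pp>"
    and "sp_borel_minus n \<subseteq> \<pp> \<Longrightarrow> sp_cartan n \<subseteq> \<pp>"
    and "sp_borel_plus n \<subseteq> \<pp> \<Longrightarrow> i < j \<Longrightarrow> j < 2 * n \<Longrightarrow> rv n i j \<in> \<pp>"
    and "sp_borel_minus n \<subseteq> \<pp> \<Longrightarrow> j < i \<Longrightarrow> i < 2 * n \<Longrightarrow> rv n i j \<in> \<pp>"
proof -
  let ?z = "0\<^sub>m (2 * n) (2 * n) :: 'a mat"
  have z: "?z \<in> sp_upper n" "?z \<in> sp_lower n" "?z \<in> sp_cartan n"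
    using sp_zero[of n, where 'a = 'a] by (auto simp: sp_upper_def sp_lower_def sp_cartan_def diagonal_mat_def)
  have zr: "X + ?z = X" "?z + X = X" if "X \<in> sp n" for X using sp_carrier[OF that] by auto
  have c: "X \<in> sp_borel_plus n" "X \<in> sp_borel_minus n" if "X \<in> sp_cartan n" for X :: "'a mat"
  proof -
    have "X = X + ?z" using zr(1)[of X] that by (simp add: sp_cartan_def)
    then show "X \<in> sp_borel_plus n" "X \<in> sp_borel_minus n"
      using that z unfolding sp_borel_plus_def sp_borel_minus_def by blast+
  qed
  show "sp_borel_plus n \<subseteq> \<pp> \<Longrightarrow> sp_cartan n \<subseteq> \<pp>" "sp_borel_minus n \<subseteq> \<pp> \<Longrightarrow> sp_cartan n \<subseteq> \<pp>"
    using c by blast+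
  have r0: "rv n i j $$ (p, q) = (0 :: 'a)" if "p < 2 * n" "q < 2 * n" "i < 2 * n" "j < 2 * n" "i < j \<and> q \<le> p \<or> j < i \<and> p \<le> q" for i j p q
  proof (rule index_rv_0[OF that(1,2)])
    show "\<not> (p = opp n j \<and> q = opp n i)" using that by (auto simp: opp_def)
  qed (use that in auto)
  show "rv n i j \<in> \<pp>" if "sp_borel_plus n \<subseteq> \<pp>" "i < j" "j < 2 * n"
  proof -
    have r: "rv n i j \<in> (sp n :: 'a mat set)" using that by (intro rv_sp) auto
    then have "rv n i j \<in> (sp_upper n :: 'a mat set)" using r0[of _ _ i j] that unfolding sp_upper_def by auto
    moreover have "rv n i j = ?z + rv n i j" using zr(2)[OF r] by simp
    ultimately have "rv n i j \<in> (sp_borel_plus n :: 'a mat set)" using z(3) unfolding sp_borel_plus_def by blast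
    then show ?thesis using that by blast
  qed
  show "rv n i j \<in> \<pp>" if "sp_borel_minus n \<subseteq> \<pp>" "j < i" "i < 2 * n"
  proof -
    have r: "rv n i j \<in> (sp n :: 'a mat set)" using that by (intro rv_sp) auto
    then have "rv n i j \<in> (sp_lower n :: 'a mat set)" using r0[of _ _ i j] that unfolding sp_lower_def by auto
    moreover have "rv n i j = ?z + rv n i j" using zr(2)[OF r] by simp
    ultimately have "rv n i j \<in> (sp_borel_minus n :: 'a mat set)" using z(3) unfolding sp_borel_minus_def by blast
    then show ?thesis using that by blast
  qed
qed

lemma rv_swap_iff:
  fixes \<pp> :: "'a::field mat set"
  assumes \<pp>: "lie_subalgebra (2 * n) (sp n) \<pp>" and ij: "i < 2 * n" "j < 2 * n"
  shows "rv n (opp n j) (opp n i) \<in> \<pp> \<longleftrightarrow> rv n i j \<in> \<pp>"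
proof -
  have *: "rv n (opp n j) (opp n i) \<in> \<pp>" if "rv n i j \<in> \<pp>" "i < 2 * n" "j < 2 * n" for i j
    unfolding rv_opp[OF that(2,3)] by (rule lie_subalgebraD(4)[OF \<pp> that(1)])
  from *[of i j] *[of "opp n j" "opp n i"] ij show ?thesis by (auto simp: opp)
qed

text \<open>The positions of block upper triangular matrices with blocks cut at the walls.\<close>

definition below :: "nat set \<Rightarrow> (nat \<times> nat) set" where
  "below W = {(i, j). \<forall>k\<in>W. \<not> (j \<le> k \<and> k < i)}"

lemma below_trans: "(i, i) \<in> below W" "(i, j) \<in> below W \<Longrightarrow> (j, k) \<in> below W \<Longrightarrow> (i, k) \<in> below W"
  by (auto simp: below_def)

lemma below_opp:
  assumes K: "K \<subseteq> {1..n}" and ij: "i < 2 * n" "j < 2 * n" "(i, j) \<in> below (walls n K)"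
  shows "(opp n j, opp n i) \<in> below (walls n K)"
  unfolding below_def
proof (intro CollectI case_prodI ballI notI)
  fix k assume k: "k \<in> walls n K" "opp n i \<le> k \<and> k < opp n j"
  then have "Suc k < 2 * n" by (auto simp: opp_def)
  then have "2 * n - 2 - k \<in> walls n K" using walls_sym[OF K] k by blast
  moreover have "j \<le> 2 * n - 2 - k" "2 * n - 2 - k < i" using k(2) ij by (auto simp: opp_def)
  ultimately show False using ij(3) unfolding below_def by blast
qed

text \<open>The simple roots decide the walls below \<open>n\<close>; the remaining ones are mirror
  images.\<close>

lemma simple_walls:
  fixes S :: "nat \<Rightarrow> bool"
  assumes K: "K \<subseteq> {1..n}" and sym: "\<And>k. Suc k < 2 * n \<Longrightarrow> S (2 * n - 2 - k) \<longleftrightarrow> S k"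
    and S: "\<And>i. i \<in> {1..n} \<Longrightarrow> S (i - 1) \<longleftrightarrow> i \<notin> K" and k: "Suc k < 2 * n"
  shows "S k \<longleftrightarrow> k \<notin> walls n K"
proof -
  have low: "S k \<longleftrightarrow> k \<notin> walls n K" if "k < n" for k
    using S[of "Suc k"] walls_iff[OF K, of "Suc k"] that by simp
  show ?thesis
  proof (cases "k < n")
    case False
    then have "2 * n - 2 - k < n" using k by simp
    then show ?thesis using low sym[OF k] walls_sym[OF K k] by simp
  qed (rule low)
qed

text \<open>The definite description is resolved: the block upper triangular algebra satisfies it,
  and any candidate contains all root vectors above the diagonal, so
  \<open>relation_below_walls\<close> determines it from the simple roots alone.\<close>

lemma parabolic_plus_eq:
  assumes K: "K \<subseteq> {1..n}"
  shows "parabolic_plus n (simple_root n ` K) = (supp_sp n (below (walls n K)) :: 'a::field_char_0 mat set)"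
  unfolding parabolic_plus_def
proof (rule the_equality)
  have rs: "root_space n (\<lambda>H. - simple_root n i H) \<subseteq> \<pp> \<longleftrightarrow> rv n i (i - 1) \<in> \<pp>"
    if "lie_subalgebra (2 * n) (sp n) \<pp>" "sp_cartan n \<subseteq> \<pp>" "i \<in> {1..n}" for \<pp> :: "'a mat set" and i
    using that by (intro root_space_subset_iff) (auto simp: simple_root_cartan)
  let ?P = "supp_sp n (below (walls n K)) :: 'a mat set"
  have P: "lie_subalgebra (2 * n) (sp n) ?P" "sp_cartan n \<subseteq> ?P"
    by (rule supp_sp_subalgebra; use below_trans in blast)+
  have "root_space n (\<lambda>H. - simple_root n i H) \<subseteq> ?P \<longleftrightarrow> i \<notin> K" if i: "i \<in> {1..n}" for i
  proof -
    have "rv n i (i - 1) \<in> ?P \<longleftrightarrow> (i, i - 1) \<in> below (walls n K)"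
      by (rule rv_supp_sp) (use below_opp[OF K] i in auto)
    also have "\<dots> \<longleftrightarrow> i - 1 \<notin> walls n K"
    proof -
      have *: "i - 1 \<le> k \<and> k < i \<longleftrightarrow> k = i - 1" for k using i by auto
      show ?thesis unfolding below_def mem_Collect_eq case_prod_conv * by blast
    qed
    finally show ?thesis using rs[OF P i] walls_iff[OF K i] by blast
  qed
  then have "simple_root n ` K = {\<alpha> \<in> simple_roots n. \<not> root_space n (\<lambda>H. - \<alpha> H) \<subseteq> ?P}"
    unfolding simple_roots_def using K by blast
  moreover have "sp_borel_plus n \<subseteq> ?P" by (rule borel_subset(1)[OF refl]) (auto simp: below_def)
  ultimately show "lie_subalgebra (2 * n) (sp n) ?P \<and> sp_borel_plus n \<subseteq> ?P \<and>
      simple_root n ` K = {\<alpha> \<in> simple_roots n. \<not> root_space n (\<lambda>H. - \<alpha> H) \<subseteq> ?P}" using P by blast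
  fix \<pp> :: "'a mat set"
  assume a: "lie_subalgebra (2 * n) (sp n) \<pp> \<and> sp_borel_plus n \<subseteq> \<pp> \<and>
      simple_root n ` K = {\<alpha> \<in> simple_roots n. \<not> root_space n (\<lambda>H. - \<alpha> H) \<subseteq> \<pp>}"
  then have \<pp>: "lie_subalgebra (2 * n) (sp n) \<pp>" and b: "sp_borel_plus n \<subseteq> \<pp>" by auto
  have h: "sp_cartan n \<subseteq> \<pp>" by (rule subset_borel(1)[OF \<pp> b])
  show "\<pp> = ?P"
  proof (rule subalgebra_eq_supp_sp[OF \<pp> h below_trans(1)])
    fix i j assume ij: "i < 2 * n" "j < 2 * n" "i \<noteq> j"
    have "rv n i j \<in> \<pp> \<longleftrightarrow> (\<forall>k\<in>walls n K. \<not> (j \<le> k \<and> k < i))"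
    proof (rule relation_below_walls[of "2 * n" "\<lambda>i j. rv n i j \<in> \<pp>", OF _ _ _ ij])
      show "rv n i k \<in> \<pp>" if "i < 2 * n" "j < 2 * n" "k < 2 * n" "i \<noteq> j" "j \<noteq> k" "i \<noteq> k" "rv n i j \<in> \<pp>" "rv n j k \<in> \<pp>" for i j k
        by (rule rv_trans[OF \<pp> h that])
      show "rv n i j \<in> \<pp>" if "i < j" "j < 2 * n" for i j by (rule subset_borel(3)[OF \<pp> b that])
      show "rv n (Suc k) k \<in> \<pp> \<longleftrightarrow> k \<notin> walls n K" if k: "Suc k < 2 * n" for k
      proof (rule simple_walls[OF K _ _ k, of "\<lambda>k. rv n (Suc k) k \<in> \<pp>"])
        fix k assume k: "Suc k < 2 * n"
        then have "Suc (2 * n - 2 - k) = opp n k" "2 * n - 2 - k = opp n (Suc k)" by (auto simp: opp_def)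
        then show "rv n (Suc (2 * n - 2 - k)) (2 * n - 2 - k) \<in> \<pp> \<longleftrightarrow> rv n (Suc k) k \<in> \<pp>"
          using rv_swap_iff[OF \<pp>, of "Suc k" k] k by simp
      next
        fix i assume i: "i \<in> {1..n}"
        then have sr: "simple_root n i \<in> simple_roots n" by (simp add: simple_roots_def)
        have "(simple_root n i :: 'a mat \<Rightarrow> 'a) \<in> simple_root n ` K \<longleftrightarrow> i \<in> K"
          using inj_on_image_mem_iff[OF inj_simple_root i K] .
        then have "i \<in> K \<longleftrightarrow> \<not> root_space n (\<lambda>H. - simple_root n i H) \<subseteq> \<pp>" using a sr by blast
        then have "rv n i (i - 1) \<in> \<pp> \<longleftrightarrow> i \<notin> K" using rs[OF \<pp> h i] by blast
        moreover have "Suc (i - 1) = i" using i by auto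
        ultimately show "rv n (Suc (i - 1)) (i - 1) \<in> \<pp> \<longleftrightarrow> i \<notin> K" by simp
      qed
    qed
    then show "rv n i j \<in> \<pp> \<longleftrightarrow> (i, j) \<in> below (walls n K)" by (simp add: below_def)
  qed
qed

lemma parabolic_minus_eq:
  assumes K: "K \<subseteq> {1..n}"
  shows "parabolic_minus n (simple_root n ` K) = (supp_sp n ((below (walls n K))\<inverse>) :: 'a::field_char_0 mat set)"
  unfolding parabolic_minus_def
proof (rule the_equality)
  have rs: "root_space n (simple_root n i) \<subseteq> \<pp> \<longleftrightarrow> rv n (i - 1) i \<in> \<pp>"
    if "lie_subalgebra (2 * n) (sp n) \<pp>" "sp_cartan n \<subseteq> \<pp>" "i \<in> {1..n}" for \<pp> :: "'a mat set" and i
    using that by (intro root_space_subset_iff) (auto simp: simple_root_cartan)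
  let ?P = "supp_sp n ((below (walls n K))\<inverse>) :: 'a mat set"
  have P: "lie_subalgebra (2 * n) (sp n) ?P" "sp_cartan n \<subseteq> ?P"
    by (rule supp_sp_subalgebra; use below_trans in blast)+
  have "root_space n (simple_root n i) \<subseteq> ?P \<longleftrightarrow> i \<notin> K" if i: "i \<in> {1..n}" for i
  proof -
    have "rv n (i - 1) i \<in> ?P \<longleftrightarrow> (i - 1, i) \<in> (below (walls n K))\<inverse>"
      by (rule rv_supp_sp) (use below_opp[OF K] i in auto)
    also have "\<dots> \<longleftrightarrow> i - 1 \<notin> walls n K"
    proof -
      have *: "i - 1 \<le> k \<and> k < i \<longleftrightarrow> k = i - 1" for k using i by auto
      show ?thesis unfolding below_def converse_iff mem_Collect_eq case_prod_conv * by blast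
    qed
    finally show ?thesis using rs[OF P i] walls_iff[OF K i] by blast
  qed
  then have "simple_root n ` K = {\<alpha> \<in> simple_roots n. \<not> root_space n \<alpha> \<subseteq> ?P}"
    unfolding simple_roots_def using K by blast
  moreover have "sp_borel_minus n \<subseteq> ?P" by (rule borel_subset(2)[OF refl]) (auto simp: below_def)
  ultimately show "lie_subalgebra (2 * n) (sp n) ?P \<and> sp_borel_minus n \<subseteq> ?P \<and>
      simple_root n ` K = {\<alpha> \<in> simple_roots n. \<not> root_space n \<alpha> \<subseteq> ?P}" using P by blast
  fix \<pp> :: "'a mat set"
  assume a: "lie_subalgebra (2 * n) (sp n) \<pp> \<and> sp_borel_minus n \<subseteq> \<pp> \<and>
      simple_root n ` K = {\<alpha> \<in> simple_roots n. \<not> root_space n \<alpha> \<subseteq> \<pp>}"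
  then have \<pp>: "lie_subalgebra (2 * n) (sp n) \<pp>" and b: "sp_borel_minus n \<subseteq> \<pp>" by auto
  have h: "sp_cartan n \<subseteq> \<pp>" by (rule subset_borel(2)[OF \<pp> b])
  show "\<pp> = ?P"
  proof (rule subalgebra_eq_supp_sp[OF \<pp> h])
    show "(i, i) \<in> (below (walls n K))\<inverse>" for i using below_trans(1) by blast
    fix i j assume ij: "i < 2 * n" "j < 2 * n" "i \<noteq> j"
    \<comment> \<open>The relation is used transposed, so that the given Borel subalgebra again
      supplies the increasing pairs.\<close>
    have "rv n i j \<in> \<pp> \<longleftrightarrow> (\<forall>k\<in>walls n K. \<not> (i \<le> k \<and> k < j))"
    proof (rule relation_below_walls[of "2 * n" "\<lambda>i j. rv n j i \<in> \<pp>", OF _ _ _ ij(2,1) ij(3)[symmetric]])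
      show "rv n k i \<in> \<pp>" if "i < 2 * n" "j < 2 * n" "k < 2 * n" "i \<noteq> j" "j \<noteq> k" "i \<noteq> k" "rv n j i \<in> \<pp>" "rv n k j \<in> \<pp>" for i j k
        using that by (intro rv_trans[OF \<pp> h, of k j i]) auto
      show "rv n j i \<in> \<pp>" if "i < j" "j < 2 * n" for i j by (rule subset_borel(4)[OF \<pp> b that])
      show "rv n k (Suc k) \<in> \<pp> \<longleftrightarrow> k \<notin> walls n K" if k: "Suc k < 2 * n" for k
      proof (rule simple_walls[OF K _ _ k, of "\<lambda>k. rv n k (Suc k) \<in> \<pp>"])
        fix k assume k: "Suc k < 2 * n"
        then have "Suc (2 * n - 2 - k) = opp n k" "2 * n - 2 - k = opp n (Suc k)" by (auto simp: opp_def)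
        then show "rv n (2 * n - 2 - k) (Suc (2 * n - 2 - k)) \<in> \<pp> \<longleftrightarrow> rv n k (Suc k) \<in> \<pp>"
          using rv_swap_iff[OF \<pp>, of k "Suc k"] k by simp
      next
        fix i assume i: "i \<in> {1..n}"
        then have sr: "simple_root n i \<in> simple_roots n" by (simp add: simple_roots_def)
        have "(simple_root n i :: 'a mat \<Rightarrow> 'a) \<in> simple_root n ` K \<longleftrightarrow> i \<in> K"
          using inj_on_image_mem_iff[OF inj_simple_root i K] .
        then have "i \<in> K \<longleftrightarrow> \<not> root_space n (simple_root n i) \<subseteq> \<pp>" using a sr by blast
        then have "rv n (i - 1) i \<in> \<pp> \<longleftrightarrow> i \<notin> K" using rs[OF \<pp> h i] by blast
        moreover have "Suc (i - 1) = i" using i by auto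
        ultimately show "rv n (i - 1) (Suc (i - 1)) \<in> \<pp> \<longleftrightarrow> i \<notin> K" by simp
      qed
    qed
    then show "rv n i j \<in> \<pp> \<longleftrightarrow> (i, j) \<in> (below (walls n K))\<inverse>" by (simp add: below_def)
  qed
qed

lemma seaweed_C_eq:
  assumes "0 < a" "0 < b" "a + b \<le> n"
  shows "(seaweed_C n [n] [a, b] :: 'a::field_char_0 mat set)
    = supp_sp n (below (walls n {n}) \<inter> (below (walls n {a, a + b}))\<inverse>)"
proof -
  have 1: "comp_roots n [n] = (simple_root n ` {n} :: ('a mat \<Rightarrow> 'a) set)"
    unfolding comp_roots_def by (auto simp: le_Suc_eq intro: exI[of _ 1])
  have 2: "comp_roots n [a, b] = (simple_root n ` {a, a + b} :: ('a mat \<Rightarrow> 'a) set)"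
  proof -
    have "{k. 1 \<le> k \<and> k \<le> length [a, b]} = {1, 2}" by auto
    then have "comp_roots n [a, b] = (\<lambda>k. simple_root n (sum_list (take k [a, b]))) ` {1, 2}"
      unfolding comp_roots_def by blast
    then show ?thesis by simp
  qed
  have "{n} \<subseteq> {1..n}" "{a, a + b} \<subseteq> {1..n}" using assms by auto
  note 3 = parabolic_plus_eq[OF this(1)] parabolic_minus_eq[OF this(2)]
  show ?thesis
    unfolding seaweed_C_def seaweed_def 1 2 3 by (auto simp: supp_sp_def)
qed

subsection \<open>Transfer of the index\<close>

definition fm_of :: "nat \<Rightarrow> 'a::field mat \<Rightarrow> 'a fm" where
  "fm_of N X = Fm (\<lambda>i j. if i < N \<and> j < N then X $$ (i, j) else 0)"

definition mat_of :: "nat \<Rightarrow> 'a::field fm \<Rightarrow> 'a mat" where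
  "mat_of N x = mat N N (\<lambda>(i, j). ent x i j)"

lemma ent_fm_of: "ent (fm_of N X) i j = (if i < N \<and> j < N then X $$ (i, j) else 0)"
  by (simp add: fm_of_def)

lemma mat_of_carrier [simp]: "mat_of N x \<in> carrier_mat N N"
  by (simp add: mat_of_def)

lemma mat_of_fm_of: "X \<in> carrier_mat N N \<Longrightarrow> mat_of N (fm_of N X) = X"
  by (rule eq_matI) (auto simp: mat_of_def ent_fm_of)

lemma fm_of_mat_of: "x \<in> Inc ({..<N} \<times> {..<N}) \<Longrightarrow> fm_of N (mat_of N x) = x"
  by (rule fm_eqI) (auto simp: mat_of_def ent_fm_of Inc_def)

lemma fm_of_Inc: "fm_of N X \<in> Inc ({..<N} \<times> {..<N})"
  by (auto simp: Inc_def ent_fm_of)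

lemma fm_of_add: "X \<in> carrier_mat N N \<Longrightarrow> Y \<in> carrier_mat N N \<Longrightarrow> fm_of N (X + Y) = fm_of N X + fm_of N Y"
  by (rule fm_eqI) (auto simp: ent_fm_of)

lemma fm_of_smult: "X \<in> carrier_mat N N \<Longrightarrow> fm_of N (c \<cdot>\<^sub>m X) = mscale c (fm_of N X)"
  by (rule fm_eqI) (auto simp: ent_fm_of)

lemma fm_of_zero: "fm_of N (0\<^sub>m N N) = 0"
  by (rule fm_eqI) (auto simp: ent_fm_of)

lemma fm_of_bracket:
  assumes "X \<in> carrier_mat N N" "Y \<in> carrier_mat N N"
  shows "fm_of N (lie_bracket X Y) = br N (fm_of N X) (fm_of N Y)"
proof (rule fm_eqI)
  fix i j
  show "ent (fm_of N (lie_bracket X Y)) i j = ent (br N (fm_of N X) (fm_of N Y)) i j"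
    unfolding br_def ent_simps ent_mm ent_fm_of
    using index_bracket[OF assms, of i j] by auto
qed

lemma inj_on_fm_of: "inj_on (fm_of N) (carrier_mat N N)"
  by (rule inj_on_inverseI[of _ "mat_of N"]) (rule mat_of_fm_of)

lemma subspace_fm_of:
  assumes "W \<subseteq> carrier_mat N N" "fm.subspace (fm_of N ` W)"
  shows "VectorSpace.subspace class_ring W (module_mat TYPE('a::field) N N)"
  unfolding subspace_mat_iff
proof (intro conjI ballI allI)
  have mem: "X \<in> W" if "X \<in> carrier_mat N N" "fm_of N X \<in> fm_of N ` W" for X
    using inj_on_image_mem_iff[OF inj_on_fm_of that(1) assms(1)] that(2) by simp
  show "0\<^sub>m N N \<in> W"
    by (rule mem) (simp_all add: fm_of_zero fm.subspace_0[OF assms(2)])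
  show "X + Y \<in> W" if "X \<in> W" "Y \<in> W" for X Y
  proof (rule mem)
    have "X \<in> carrier_mat N N" "Y \<in> carrier_mat N N" using that assms(1) by auto
    then show "X + Y \<in> carrier_mat N N" "fm_of N (X + Y) \<in> fm_of N ` W"
      using that fm.subspace_add[OF assms(2)] by (auto simp: fm_of_add)
  qed
  show "c \<cdot>\<^sub>m X \<in> W" if "X \<in> W" for c X
  proof (rule mem)
    have "X \<in> carrier_mat N N" using that assms(1) by auto
    then show "c \<cdot>\<^sub>m X \<in> carrier_mat N N" "fm_of N (c \<cdot>\<^sub>m X) \<in> fm_of N ` W"
      using that fm.subspace_scale[OF assms(2)] by (auto simp: fm_of_smult)
  qed
qed (rule assms(1))

text \<open>A basis of the image is pulled back along the injective \<open>fm_of\<close> and shown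
  to be a basis in the sense of the carrier-based vector space; both dimensions are the size of that
  basis.\<close>

lemma subspace_dim_fm_of:
  fixes W :: "'a::field mat set"
  assumes W: "W \<subseteq> carrier_mat N N" and sub: "fm.subspace (fm_of N ` W)"
  shows "subspace_dim N W = fm.dim (fm_of N ` W)"
proof -
  define M where "M = (module_mat TYPE('a) N N)\<lparr>carrier := W\<rparr>"
  interpret v: vectorspace class_ring "module_mat TYPE('a) N N" by (rule matrix_vs)
  interpret w: vectorspace class_ring M
    unfolding M_def by (rule v.subspace_is_vs[OF subspace_fm_of[OF W sub]])
  have M: "carrier M = W" "add M = (+)" "(\<odot>\<^bsub>M\<^esub>) = (\<cdot>\<^sub>m)" "zero M = 0\<^sub>m N N"
    by (simp_all add: M_def module_mat_simps)
  have lc: "fm_of N (w.lincomb c A) = (\<Sum>X\<in>A. mscale (c X) (fm_of N X))" if "finite A" "A \<subseteq> W" for c A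
    using that
  proof (induction A rule: finite_induct)
    case empty
    then show ?case by (simp add: w.lincomb_def M fm_of_zero)
  next
    case (insert X A)
    have cl: "w.lincomb c A \<in> W" using w.lincomb_closed[of A c] insert by (simp add: M)
    have XA: "X \<in> carrier_mat N N" "w.lincomb c A \<in> carrier_mat N N" "c X \<cdot>\<^sub>m X \<in> carrier_mat N N"
      using insert cl W by auto
    have "w.lincomb c (insert X A) = c X \<cdot>\<^sub>m X + w.lincomb c A"
      using w.lincomb_insert2[of A c X] insert by (simp add: M)
    then show ?case using insert XA by (simp add: fm_of_add fm_of_smult)
  qed
  have fdW: "fd (fm_of N ` W)"
    by (rule fd_subset[OF fd_Inc[of "{..<N} \<times> {..<N}"] sub]) (auto simp: fm_of_Inc)
  obtain B where B: "B \<subseteq> fm_of N ` W" "finite B" "fm.independent B" "fm.span B = fm_of N ` W"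
    "card B = fm.dim (fm_of N ` W)" using fd_basis[OF fdW] .
  obtain A where A: "A \<subseteq> W" "B = fm_of N ` A" using subset_imageE[OF B(1)] .
  have injA: "inj_on (fm_of N) A" by (rule inj_on_subset[OF inj_on_fm_of]) (use A W in auto)
  have finA: "finite A" using B(2) A(2) injA finite_imageD by blast
  have sumB: "(\<Sum>b\<in>fm_of N ` A'. mscale (g b) b) = (\<Sum>X\<in>A'. mscale (g (fm_of N X)) (fm_of N X))"
    if "A' \<subseteq> A" for A' g
    using sum.reindex[OF inj_on_subset[OF injA that], of "\<lambda>b. mscale (g b) b"] by (simp add: o_def)
  have indep: "w.lin_indpt A"
  proof
    assume "w.lin_dep A"
    then obtain A' c X where d: "finite A'" "A' \<subseteq> A" "w.lincomb c A' = 0\<^sub>m N N" "X \<in> A'" "c X \<noteq> 0"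
      unfolding w.lin_dep_def by (auto simp: M)
    define g where "g b = c (mat_of N b)" for b
    have gc: "g (fm_of N Y) = c Y" if "Y \<in> A'" for Y
      using that d A W mat_of_fm_of[of Y N] unfolding g_def by (metis subset_iff)
    have "0 = (\<Sum>Y\<in>A'. mscale (c Y) (fm_of N Y))" using lc[of A' c] d A by (simp add: fm_of_zero)
    also have "\<dots> = (\<Sum>b\<in>fm_of N ` A'. mscale (g b) b)"
      unfolding sumB[OF d(2)] by (rule sum.cong) (simp_all add: gc)
    finally have "(\<Sum>b\<in>fm_of N ` A'. mscale (g b) b) = 0" by simp
    then have "g (fm_of N X) = 0"
      using fm.independentD[OF B(3), of "fm_of N ` A'" g "fm_of N X"] d A by auto
    then show False using gc d by simp
  qed
  have gen: "w.span A = carrier M"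
  proof (intro equalityI subsetI)
    fix X assume "X \<in> w.span A"
    then show "X \<in> carrier M" using w.span_is_subset2[of A] A by (auto simp: M)
  next
    fix X assume "X \<in> carrier M"
    then have X: "X \<in> W" by (simp add: M)
    then have "fm_of N X \<in> fm.span B" using B(4) by blast
    then obtain g where g: "fm_of N X = (\<Sum>b\<in>B. mscale (g b) b)"
      unfolding fm.span_finite[OF B(2)] by blast
    define c where "c Y = g (fm_of N Y)" for Y
    have "fm_of N X = fm_of N (w.lincomb c A)"
      unfolding g A(2) sumB[OF subset_refl] lc[OF finA A(1)] c_def ..
    moreover have "w.lincomb c A \<in> W" using w.lincomb_closed[of A c] A by (simp add: M)
    ultimately have "X = w.lincomb c A"
      using inj_onD[OF inj_on_fm_of, of N X "w.lincomb c A"] X W by blast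
    then show "X \<in> w.span A" unfolding w.span_def using finA by auto
  qed
  have "w.basis A" unfolding w.basis_def using indep gen A by (simp add: M)
  then have "w.dim = card A" by (rule w.dim_basis[OF finA])
  also have "\<dots> = card B" unfolding A(2) by (rule card_image[OF injA, symmetric])
  finally show ?thesis unfolding subspace_dim_def B(5) M_def .
qed

text \<open>\<open>f\<close> is linear on \<open>L\<close> only and arbitrary elsewhere, like the
  functionals in the definition of the index.\<close>

lemma linear_functional_extend:
  assumes sub: "fm.subspace L" and add: "\<And>x y. x \<in> L \<Longrightarrow> y \<in> L \<Longrightarrow> f (x + y) = f x + f y"
    and scale: "\<And>c x. x \<in> L \<Longrightarrow> f (mscale c x) = c * f x"
  obtains \<phi> where "linf \<phi>" "\<And>x. x \<in> L \<Longrightarrow> \<phi> x = f x"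
proof -
  obtain B where B: "B \<subseteq> L" "fm.independent B" "L \<subseteq> fm.span B" "card B = fm.dim L"
    using fm.basis_exists by blast
  obtain \<phi> where \<phi>: "linf \<phi>" "\<forall>x\<in>B. \<phi> x = f x" using fmf.linear_independent_extend[OF B(2), of f] by blast
  have "f 0 = 0" using scale[of 0 0] fm.subspace_0[OF sub] by simp
  then have "fm.subspace {x \<in> L. \<phi> x = f x}"
    using sub add scale fmf.linear_0[OF \<phi>(1)] fmf.linear_add[OF \<phi>(1)] fmf.linear_scale[OF \<phi>(1)]
    by (auto simp: fm.subspace_def)
  then have "fm.span B \<subseteq> {x \<in> L. \<phi> x = f x}" using B \<phi> by (intro fm.span_minimal) auto
  then have "\<phi> x = f x" if "x \<in> L" for x using that B(3) by auto
  with \<phi>(1) show thesis by (rule that)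
qed

text \<open>Both minima are over the same set of numbers. A functional on matrices is moved through
  \<open>mat_of\<close> and then extended from the subspace; in the other direction it is composed
  with \<open>fm_of\<close>.\<close>

lemma lie_index_eq_lieind:
  fixes \<gg> :: "'a::field mat set"
  assumes \<gg>: "\<gg> \<subseteq> carrier_mat N N" and sub: "fm.subspace (fm_of N ` \<gg>)"
    and cl: "\<And>X Y. X \<in> \<gg> \<Longrightarrow> Y \<in> \<gg> \<Longrightarrow> lie_bracket X Y \<in> \<gg>"
  shows "lie_index N \<gg> = lieind N (fm_of N ` \<gg>)"
proof -
  have sg: "X + Y \<in> \<gg>" "c \<cdot>\<^sub>m X \<in> \<gg>" if "X \<in> \<gg>" "Y \<in> \<gg>" for X Y c
    using subspace_fm_of[OF \<gg> sub] that unfolding subspace_mat_iff by auto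
  have ker: "subspace_dim N (kirillov_kernel \<gg> f) = fm.dim (rad (fm_of N ` \<gg>) (kform N \<phi>))"
    if \<phi>: "linf \<phi>" and eq: "\<And>X. X \<in> \<gg> \<Longrightarrow> \<phi> (fm_of N X) = f X" for f \<phi>
  proof -
    have k: "kform N \<phi> (fm_of N X) (fm_of N Y) = f (lie_bracket X Y)" if "X \<in> \<gg>" "Y \<in> \<gg>" for X Y
    proof -
      have "X \<in> carrier_mat N N" "Y \<in> carrier_mat N N" using that \<gg> by auto
      then have "kform N \<phi> (fm_of N X) (fm_of N Y) = \<phi> (fm_of N (lie_bracket X Y))"
        by (simp add: kform_def fm_of_bracket)
      then show ?thesis using eq[OF cl[OF that]] by simp
    qed
    have "fm_of N ` kirillov_kernel \<gg> f = rad (fm_of N ` \<gg>) (kform N \<phi>)"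
    proof (intro equalityI subsetI)
      fix x assume "x \<in> fm_of N ` kirillov_kernel \<gg> f"
      then obtain X where X: "x = fm_of N X" "X \<in> \<gg>" "\<forall>Y\<in>\<gg>. f (lie_bracket X Y) = 0"
        unfolding kirillov_kernel_def by blast
      then show "x \<in> rad (fm_of N ` \<gg>) (kform N \<phi>)" unfolding rad_def using k by auto
    next
      fix x assume x: "x \<in> rad (fm_of N ` \<gg>) (kform N \<phi>)"
      then obtain X where X: "x = fm_of N X" "X \<in> \<gg>" unfolding rad_def by blast
      have "f (lie_bracket X Y) = 0" if "Y \<in> \<gg>" for Y
        using x k[OF X(2) that] that unfolding rad_def X(1) by auto
      then show "x \<in> fm_of N ` kirillov_kernel \<gg> f" using X unfolding kirillov_kernel_def by blast
    qed
    moreover have "fm.subspace (rad (fm_of N ` \<gg>) (kform N \<phi>))"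
      by (rule subspace_rad[OF bilin_kform[OF \<phi>] sub])
    ultimately show ?thesis
      using subspace_dim_fm_of[of "kirillov_kernel \<gg> f" N] \<gg> by (auto simp: kirillov_kernel_def)
  qed
  have "(\<exists>f\<in>linear_functionals \<gg>. d = subspace_dim N (kirillov_kernel \<gg> f)) \<longleftrightarrow>
    (\<exists>\<phi>. linf \<phi> \<and> d = fm.dim (rad (fm_of N ` \<gg>) (kform N \<phi>)))" for d
  proof
    assume "\<exists>f\<in>linear_functionals \<gg>. d = subspace_dim N (kirillov_kernel \<gg> f)"
    then obtain f where f: "f \<in> linear_functionals \<gg>" "d = subspace_dim N (kirillov_kernel \<gg> f)" by blast
    have inv: "mat_of N (fm_of N X) = X" "X \<in> carrier_mat N N" if "X \<in> \<gg>" for X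
      using that \<gg> mat_of_fm_of by auto
    obtain \<phi> where \<phi>: "linf \<phi>" "\<And>x. x \<in> fm_of N ` \<gg> \<Longrightarrow> \<phi> x = f (mat_of N x)"
    proof (rule linear_functional_extend[OF sub, of "\<lambda>x. f (mat_of N x)"])
      fix x y assume "x \<in> fm_of N ` \<gg>" "y \<in> fm_of N ` \<gg>"
      then obtain X Y where XY: "x = fm_of N X" "y = fm_of N Y" "X \<in> \<gg>" "Y \<in> \<gg>" by blast
      then have "x + y = fm_of N (X + Y)" using inv by (simp add: fm_of_add)
      then show "f (mat_of N (x + y)) = f (mat_of N x) + f (mat_of N y)"
        using XY f(1) sg by (simp add: inv linear_functionals_def)
    next
      fix c x assume "x \<in> fm_of N ` \<gg>"
      then obtain X where X: "x = fm_of N X" "X \<in> \<gg>" by blast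
      then have "mscale c x = fm_of N (c \<cdot>\<^sub>m X)" using inv by (simp add: fm_of_smult)
      then show "f (mat_of N (mscale c x)) = c * f (mat_of N x)"
        using X f(1) sg by (simp add: inv linear_functionals_def)
    qed blast
    have "\<phi> (fm_of N X) = f X" if "X \<in> \<gg>" for X using \<phi>(2) that inv by simp
    then show "\<exists>\<phi>. linf \<phi> \<and> d = fm.dim (rad (fm_of N ` \<gg>) (kform N \<phi>))"
      using ker[OF \<phi>(1), of f] f(2) \<phi>(1) by metis
  next
    assume "\<exists>\<phi>. linf \<phi> \<and> d = fm.dim (rad (fm_of N ` \<gg>) (kform N \<phi>))"
    then obtain \<phi> where \<phi>: "linf \<phi>" "d = fm.dim (rad (fm_of N ` \<gg>) (kform N \<phi>))" by blast
    have car: "X \<in> carrier_mat N N" if "X \<in> \<gg>" for X using that \<gg> by auto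
    have "(\<lambda>X. \<phi> (fm_of N X)) \<in> linear_functionals \<gg>"
      unfolding linear_functionals_def using car
      by (auto simp: fm_of_add fm_of_smult fmf.linear_add[OF \<phi>(1)] fmf.linear_scale[OF \<phi>(1)])
    then show "\<exists>f\<in>linear_functionals \<gg>. d = subspace_dim N (kirillov_kernel \<gg> f)"
      using ker[OF \<phi>(1), of "\<lambda>X. \<phi> (fm_of N X)"] \<phi>(2) by metis
  qed
  then show ?thesis unfolding lie_index_def lieind_def by simp
qed

section \<open>Identification of the seaweed with its coordinate form\<close>

context two_part_seaweed
begin

abbreviation shape :: "(nat \<times> nat) set" where
  "shape \<equiv> below (walls n {n}) \<inter> (below (walls n {a, a + b}))\<inverse>"

lemma opp_mir: "opp n i = mir i"
  by (simp add: opp_def mir_def N_def mult_2)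

text \<open>The wall \<open>n - 1\<close> comes from the first parabolic, those of \<open>a\<close>
  and \<open>a + b\<close> with their mirror images from the second. The conditions are put
  additively to avoid truncated subtraction.\<close>

lemma shape_iff:
  "(i, j) \<in> shape \<longleftrightarrow> \<not> (j < n \<and> n \<le> i) \<and> \<not> (i < a \<and> a \<le> j) \<and> \<not> (i < m \<and> m \<le> j)
    \<and> \<not> (i + a < N \<and> N \<le> j + a) \<and> \<not> (i + m < N \<and> N \<le> j + m)"
proof -
  have w: "walls n {n} = {n - 1}" "walls n {a, a + b} = {a - 1, m - 1, N - 1 - a, N - 1 - m}"
    by (auto simp: walls_def N_def m_def mult_2)
  have n: "0 < a" "0 < m" "0 < n" "a < N" "m < N" using a r by (auto simp: N_def n_def m_def)
  have k: "x \<le> k - 1 \<longleftrightarrow> x < k" "k - 1 < x \<longleftrightarrow> k \<le> x" if "0 < k" for x k :: nat using that by auto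
  have l: "x \<le> N - 1 - k \<longleftrightarrow> x + k < N" "N - 1 - k < x \<longleftrightarrow> N \<le> x + k" if "k < N" for x k using that by auto
  show ?thesis
    unfolding w below_def Int_iff converse_iff mem_Collect_eq case_prod_conv ball_simps
      k[OF n(1)] k[OF n(2)] k[OF n(3)] l[OF n(4)] l[OF n(5)] by blast
qed

text \<open>In each quadrant most wall conditions hold or fail automatically; what remains is
  \<open>fl\<close>, its mirror image, or confinement to \<open>U\<close>.\<close>

lemma shape:
  "i < n \<Longrightarrow> j < n \<Longrightarrow> (i, j) \<in> shape \<longleftrightarrow> (i, j) \<in> fl"
  "n \<le> i \<Longrightarrow> j < n \<Longrightarrow> (i, j) \<notin> shape"
  "i < n \<Longrightarrow> n \<le> j \<Longrightarrow> j < N \<Longrightarrow> (i, j) \<in> shape \<longleftrightarrow> i \<in> U \<and> mir j \<in> U"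
  "n \<le> i \<Longrightarrow> n \<le> j \<Longrightarrow> i < N \<Longrightarrow> j < N \<Longrightarrow> (i, j) \<in> shape \<longleftrightarrow> (mir j, mir i) \<in> fl"
proof -
  have n: "N = n + n" "m < n" "a \<le> m" using r by (auto simp: N_def n_def m_def)
  show "(i, j) \<in> shape \<longleftrightarrow> (i, j) \<in> fl" if "i < n" "j < n"
  proof -
    have "\<not> N \<le> j + a" "\<not> N \<le> j + m" using n that by linarith+
    then show ?thesis unfolding shape_iff fl_iff using that by auto
  qed
  show "(i, j) \<notin> shape" if "n \<le> i" "j < n"
    unfolding shape_iff using that by blast
  show "(i, j) \<in> shape \<longleftrightarrow> i \<in> U \<and> mir j \<in> U" if ij: "i < n" "n \<le> j" "j < N"
  proof -
    have "a \<le> j" "m \<le> j" "i + a < N" "i + m < N" "i < a \<Longrightarrow> i < m" "N \<le> j + a \<Longrightarrow> N \<le> j + m" "\<not> j < n"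
      using n ij by linarith+
    moreover have "m \<le> mir j \<longleftrightarrow> \<not> N \<le> j + m" "mir j < n" using n ij unfolding mir_def by linarith+
    ultimately show ?thesis unfolding shape_iff U_def atLeastLessThan_iff using ij by auto
  qed
  show "(i, j) \<in> shape \<longleftrightarrow> (mir j, mir i) \<in> fl" if ij: "n \<le> i" "n \<le> j" "i < N" "j < N"
  proof -
    have "\<not> i < a" "\<not> i < m" "\<not> j < n" using n ij by linarith+
    moreover have "mir j < n" "mir i < n" "mir j < a \<longleftrightarrow> N \<le> j + a" "mir j < m \<longleftrightarrow> N \<le> j + m"
      "mir i < a \<longleftrightarrow> \<not> i + a < N" "mir i < m \<longleftrightarrow> \<not> i + m < N"
      using n ij unfolding mir_def by linarith+
    ultimately show ?thesis unfolding shape_iff fl_iff by blast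
  qed
qed

lemma fm_of_seaweed:
  assumes "0 < b"
  shows "fm_of N ` (seaweed_C n [n] [a, b] :: 'a::field_char_0 mat set) = Q"
proof -
  have N2: "2 * n = N" by (simp add: N_def)
  have "seaweed_C n [n] [a, b] = (supp_sp n shape :: 'a mat set)"
    by (rule seaweed_C_eq) (use a assms in \<open>auto simp: n_def m_def\<close>)
  moreover have "fm_of N X \<in> Q" if X: "X \<in> supp_sp n shape" for X :: "'a mat"
  proof -
    have c: "X \<in> carrier_mat N N" and s: "\<And>i j. i < N \<Longrightarrow> j < N \<Longrightarrow> X $$ (mir j, mir i) = - eta n i * eta n j * X $$ (i, j)"
      and z: "\<And>i j. i < N \<Longrightarrow> j < N \<Longrightarrow> (i, j) \<notin> shape \<Longrightarrow> X $$ (i, j) = 0"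
      using X unfolding supp_sp_def sp_iff N2 opp_mir by blast+
    have nN: "n \<le> N" by (simp add: N_def)
    show ?thesis unfolding Q_def
    proof (intro CollectI conjI allI impI)
      show "fm_of N X \<in> Inc ({..<N} \<times> {..<N})" by (rule fm_of_Inc)
      show "ent (fm_of N X) i j = 0" if "i < n" "j < n" "(i, j) \<notin> fl" for i j
        unfolding ent_fm_of using z[of i j] shape(1)[OF that(1,2)] that by auto
      show "ent (fm_of N X) i j = 0" if "n \<le> i" "j < n" for i j
        unfolding ent_fm_of using z[of i j] shape(2)[OF that] by auto
      show "ent (fm_of N X) i j = 0" if "i < n" "n \<le> j" "\<not> (i \<in> U \<and> mir j \<in> U)" for i j
        unfolding ent_fm_of using z[of i j] shape(3)[OF that(1,2)] that(3) by auto
      show "ent (fm_of N X) (mir j) (mir i) = - ent (fm_of N X) i j" if "i < n" "j < n" for i j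
      proof -
        have "i < N" "j < N" using that nN by auto
        then show ?thesis unfolding ent_fm_of using s[of i j] mir(1)[of i] mir(1)[of j] that by (simp add: eta_def)
      qed
      show "ent (fm_of N X) (mir j) (mir i) = ent (fm_of N X) i j" if "i < n" "n \<le> j" "j < N" for i j
      proof -
        have "i < N" using that nN by auto
        then show ?thesis unfolding ent_fm_of using s[of i j] mir(1)[of i] mir(1)[of j] that by (simp add: eta_def)
      qed
    qed
  qed
  moreover have "mat_of N x \<in> supp_sp n shape \<and> x \<in> Inc ({..<N} \<times> {..<N})" if x: "x \<in> Q" for x :: "'a fm"
  proof -
    have q: "x \<in> Inc ({..<N} \<times> {..<N})" "\<And>i j. i < n \<Longrightarrow> j < n \<Longrightarrow> (i, j) \<notin> fl \<Longrightarrow> ent x i j = 0"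
      "\<And>i j. n \<le> i \<Longrightarrow> j < n \<Longrightarrow> ent x i j = 0"
      "\<And>i j. i < n \<Longrightarrow> n \<le> j \<Longrightarrow> \<not> (i \<in> U \<and> mir j \<in> U) \<Longrightarrow> ent x i j = 0"
      "\<And>i j. i < n \<Longrightarrow> j < n \<Longrightarrow> ent x (mir j) (mir i) = - ent x i j"
      "\<And>i j. i < n \<Longrightarrow> n \<le> j \<Longrightarrow> j < N \<Longrightarrow> ent x (mir j) (mir i) = ent x i j"
      using x unfolding Q_def by blast+
    have ix: "mat_of N x $$ (i, j) = ent x i j" if "i < N" "j < N" for i j
      using that by (simp add: mat_of_def)
    have "ent x (mir j) (mir i) = - eta n i * eta n j * ent x i j" if ij: "i < N" "j < N" for i j
    proof -
      consider "i < n" "j < n" | "i < n" "n \<le> j" | "n \<le> i" "j < n" | "n \<le> i" "n \<le> j" by linarith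
      then show ?thesis
      proof cases
        case 1
        then show ?thesis using q(5)[OF 1] by (simp add: eta_def)
      next
        case 2
        then show ?thesis using q(6)[OF 2 ij(2)] by (simp add: eta_def)
      next
        case 3
        then have "n \<le> mir j" "mir i < n" using mir(3)[OF ij(1)] mir(4)[OF ij(2)] by auto
        then show ?thesis using q(3)[OF 3] q(3)[of "mir j" "mir i"] by simp
      next
        case 4
        then have "mir j < n" "mir i < n" using mir(3)[OF ij(1)] mir(3)[OF ij(2)] by auto
        then show ?thesis using q(5)[of "mir j" "mir i"] mir(2)[OF ij(1)] mir(2)[OF ij(2)] 4 by (simp add: eta_def)
      qed
    qed
    then have "mat_of N x \<in> sp n" unfolding sp_iff N2 opp_mir by (simp add: ix mir(1))
    moreover have "ent x i j = 0" if ij: "i < N" "j < N" "(i, j) \<notin> shape" for i j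
    proof -
      consider "i < n" "j < n" | "i < n" "n \<le> j" | "n \<le> i" "j < n" | "n \<le> i" "n \<le> j" by linarith
      then show ?thesis
      proof cases
        case 1
        then show ?thesis using q(2)[OF 1] shape(1)[OF 1] ij(3) by blast
      next
        case 2
        then show ?thesis using q(4)[OF 2] shape(3)[OF 2 ij(2)] ij(3) by blast
      next
        case 3
        then show ?thesis using q(3)[OF 3] by blast
      next
        case 4
        then have l: "mir j < n" "mir i < n" using mir(3)[OF ij(1)] mir(3)[OF ij(2)] by auto
        then have "ent x (mir j) (mir i) = 0" using q(2)[OF l] shape(4)[OF 4 ij(1,2)] ij(3) by blast
        then show ?thesis using q(5)[OF l] mir(2)[OF ij(1)] mir(2)[OF ij(2)] by simp
      qed
    qed
    ultimately show ?thesis unfolding supp_sp_def N2 using q(1) ix by auto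
  qed
  ultimately show ?thesis
  proof (intro equalityI subsetI)
    fix x :: "'a fm" assume eq: "seaweed_C n [n] [a, b] = (supp_sp n shape :: 'a mat set)"
      and Q: "\<And>x :: 'a fm. x \<in> Q \<Longrightarrow> mat_of N x \<in> supp_sp n shape \<and> x \<in> Inc ({..<N} \<times> {..<N})" and "x \<in> Q"
    then have "mat_of N x \<in> seaweed_C n [n] [a, b]" "fm_of N (mat_of N x) = x" using fm_of_mat_of by auto
    then show "x \<in> fm_of N ` seaweed_C n [n] [a, b]" by (rule image_eqI[OF sym, rotated])
  qed auto
qed

lemma lie_index_seaweed:
  assumes "0 < b"
  shows "lie_index (2 * n) (seaweed_C n [n] [a, b] :: 'a::{alg_closed_field,field_char_0} mat set) = gcd (a + b) (b + r) - 1"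
proof -
  have N2: "2 * n = N" by (simp add: N_def)
  let ?q = "seaweed_C n [n] [a, b] :: 'a mat set"
  have eq: "?q = supp_sp n shape"
    by (rule seaweed_C_eq) (use a assms in \<open>auto simp: n_def m_def\<close>)
  have "lie_subalgebra (2 * n) (sp n) ?q" unfolding eq
    by (rule supp_sp_subalgebra(1)) (use below_trans in blast)+
  then have q: "?q \<subseteq> carrier_mat N N" "\<And>X Y. X \<in> ?q \<Longrightarrow> Y \<in> ?q \<Longrightarrow> lie_bracket X Y \<in> ?q"
    "VectorSpace.subspace class_ring ?q (module_mat TYPE('a) N N)"
    unfolding lie_subalgebra_def N2[symmetric] using sp_carrier by blast+
  have "fm.subspace (fm_of N ` ?q)"
    unfolding fm.subspace_def
  proof (intro conjI ballI allI)
    note s = q(3)[unfolded subspace_mat_iff]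
    show "0 \<in> fm_of N ` ?q" using s fm_of_zero[of N, where 'a = 'a] by (metis image_eqI)
    show "x + y \<in> fm_of N ` ?q" if xy: "x \<in> fm_of N ` ?q" "y \<in> fm_of N ` ?q" for x y
    proof -
      obtain X Y where XY: "x = fm_of N X" "y = fm_of N Y" "X \<in> ?q" "Y \<in> ?q" using xy by blast
      then have "X \<in> carrier_mat N N" "Y \<in> carrier_mat N N" "X + Y \<in> ?q" using s by blast+
      then show ?thesis using fm_of_add[of X N Y] XY by (metis image_eqI)
    qed
    show "mscale c x \<in> fm_of N ` ?q" if x: "x \<in> fm_of N ` ?q" for c x
    proof -
      obtain X where X: "x = fm_of N X" "X \<in> ?q" using x by blast
      then have "X \<in> carrier_mat N N" "c \<cdot>\<^sub>m X \<in> ?q" using s by blast+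
      then show ?thesis using fm_of_smult[of X N c] X by (metis image_eqI)
    qed
  qed
  then have "lie_index N ?q = lieind N (fm_of N ` ?q)" by (rule lie_index_eq_lieind[OF q(1) _ q(2)])
  then show ?thesis unfolding fm_of_seaweed[OF assms] lieind_Q N2 .
qed

end

theorem theorem5p5:
  fixes a b n :: nat
  assumes "a > 0" and "b > 0" and "n > 0"
  shows "(a + b = n - 1 \<longrightarrow>
      lie_index (2 * n) (seaweed_C n [n] [a, b] :: 'a::{alg_closed_field, field_char_0} mat set) =
        gcd (a + b) (b + 1) - 1) \<and>
    (a + b = n - 2 \<longrightarrow>
      lie_index (2 * n) (seaweed_C n [n] [a, b] :: 'a mat set) =
        gcd (a + b) (b + 2) - 1)"
proof -
  have "lie_index (2 * n) (seaweed_C n [n] [a, b] :: 'a mat set) = gcd (a + b) (b + r) - 1"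
    if "n = a + b + r" "r = 1 \<or> r = 2" for r
  proof -
    interpret two_part_seaweed a b r by unfold_locales (use assms that in auto)
    show ?thesis using lie_index_seaweed[OF assms(2), where 'a = 'a] that(1) unfolding n_def m_def by simp
  qed
  moreover have "n = a + b + 1" if "a + b = n - 1" using that assms by simp
  \<comment> \<open>Since \<open>a\<close> and \<open>b\<close> are positive, the subtraction is not
    truncated.\<close>
  moreover have "n = a + b + 2" if "a + b = n - 2" using that assms by simp
  ultimately show ?thesis by blast
qed

end
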